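(* Let $p\ge 2$, $K\ge 1$, $T$ be integers with $p+K<T$, and let $\mathbf{X}_t=\mathbf{B}\mathbf{f}_t+\mathbf{u}_t$, $t=1,\dots,T$, be the factor model described in the context, with $\mathbf{f}_t$ and $\mathbf{u}_t$ independent and normally distributed. Let $1\le j\le p$ and let $$T_j=\frac{T-K-p+1}{p-1}\big(v_{jj}v_{jj}^{(-)}-1\big).$$ Then: (a) The density of $T_j$ is given, for $x>0$, by $$F_{T_j}(x)=F_{p-1,T-K-p+1}(x)\,(1+\lambda_j)^{-(T-K)/2}\;{}_2F_1\Big(\tfrac{T-K}{2},\tfrac{T-K}{2},\tfrac{p-1}{2};\ \tfrac{(p-1)x}{T-K-p+1+(p-1)x}\,\tfrac{\lambda_j}{1+\lambda_j}\Big),$$ where $\lambda_j=\omega_{jj}\omega_{jj}^{(-)}-1$. (b) If $\omega_{jj}\omega_{jj}^{(-)}=1$ (hypothesis $H_{0,j}$), then $T_j\sim\mathcal{F}_{p-1,T-K-p+1}$.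
   Context: Model: $\mathbf{B}$ is a deterministic $p\times K$ matrix; $\mathbf{f}_1,\dots,\mathbf{f}_T$ are i.i.d. $K$-dimensional normal vectors with mean zero and positive definite covariance matrix; $\mathbf{u}_1,\dots,\mathbf{u}_T$ are i.i.d. $p$-dimensional normal vectors with mean zero and positive definite covariance matrix $\boldsymbol{\Sigma}_u$ (not assumed diagonal); the sequences $(\mathbf{f}_t)$ and $(\mathbf{u}_t)$ are independent. Put $\mathbf{Y}_t=(\mathbf{X}_t^\top,\mathbf{f}_t^\top)^\top\in\mathbb{R}^{p+K}$ and $\boldsymbol{\Omega}=\{\mathrm{cov}(\mathbf{Y}_t)\}^{-1}=(\omega_{ij})$, with upper-left $p\times p$ block $\boldsymbol{\Omega}_{11}$; write $\boldsymbol{\Omega}_{11}^{-1}=(\omega_{ij}^{(-)})_{1\le i,j\le p}$. Let $\mathbf{Y}=(\mathbf{Y}_1,\dots,\mathbf{Y}_T)$, $\mathbf{S}=\frac1T\mathbf{Y}\mathbf{Y}^\top$, $\mathbf{V}=(T\mathbf{S})^{-1}=(v_{ij})$, with upper-left $p\times p$ block $\mathbf{V}_{11}$; write $\mathbf{V}_{11}^{-1}=(v_{ij}^{(-)})_{1\le i,j\le p}$. Notation: $\mathcal{F}_{a,b}$ is the (central) $\mathcal F$-distribution with $a$ and $b$ degrees of freedom and $F_{a,b}$ is its density; ${}_2F_1(a,b,c;x)=\frac{\Gamma(c)}{\Gamma(a)\Gamma(b)}\sum_{k=0}^\infty\frac{\Gamma(a+k)\Gamma(b+k)}{\Gamma(c+k)}\frac{x^k}{k!}$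 is the hypergeometric function. *)

theory Defs
  imports "HOL-Probability.Probability"
begin

definition pos_def :: "real^'n^'n \<Rightarrow> bool" where
  "pos_def A \<longleftrightarrow> transpose A = A \<and> (\<forall>x. x \<noteq> 0 \<longrightarrow> x \<bullet> (A *v x) > 0)"

text \<open>Lebesgue density of the normal law; meaningful for positive definite \<open>\<Sigma>\<close>.\<close>

definition mvn_density :: "real^'n \<Rightarrow> real^'n^'n \<Rightarrow> real^'n \<Rightarrow> real" where
  "mvn_density \<mu> \<Sigma> x =
     exp (- ((x - \<mu>) \<bullet> (matrix_inv \<Sigma> *v (x - \<mu>))) / 2) /
       sqrt ((2 * pi) ^ CARD('n) * det \<Sigma>)"

definition normal_vector :: "'a measure \<Rightarrow> real^'n \<Rightarrow> real^'n^'n \<Rightarrow> ('a \<Rightarrow> real^'n) \<Rightarrow> bool" where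
  "normal_vector M \<mu> \<Sigma> Z \<longleftrightarrow>
     pos_def \<Sigma> \<and> distributed M lborel Z (\<lambda>x. ennreal (mvn_density \<mu> \<Sigma> x))"

text \<open>The library's \<open>indep_var\<close> forces both variables to have the same value type.\<close>

definition indep_pair ::
    "'a measure \<Rightarrow> 'b measure \<Rightarrow> ('a \<Rightarrow> 'b) \<Rightarrow> 'c measure \<Rightarrow> ('a \<Rightarrow> 'c) \<Rightarrow> bool" where
  "indep_pair M N U N' W \<longleftrightarrow>
     U \<in> measurable M N \<and> W \<in> measurable M N' \<and>
     prob_space.indep_set M {U -` A \<inter> space M | A. A \<in> sets N} {W -` A \<inter> space M | A. A \<in> sets N'}"

definition cov_matrix :: "'a measure \<Rightarrow> ('a \<Rightarrow> real^'n) \<Rightarrow> real^'n^'n" where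
  "cov_matrix M Z =
     (\<chi> i j. \<integral>\<omega>. (Z \<omega> $ i - (\<integral>\<omega>'. Z \<omega>' $ i \<partial>M)) * (Z \<omega> $ j - (\<integral>\<omega>'. Z \<omega>' $ j \<partial>M)) \<partial>M)"

definition stack_vec :: "real^'p::finite \<Rightarrow> real^'k::finite \<Rightarrow> real^('p + 'k)" where
  "stack_vec x y = (\<chi> i. case i of Inl a \<Rightarrow> x $ a | Inr b \<Rightarrow> y $ b)"

definition upper_left :: "real^('p::finite + 'k::finite)^('p + 'k) \<Rightarrow> real^'p^'p" where
  "upper_left A = (\<chi> i j. A $ Inl i $ Inl j)"

definition F_density :: "real \<Rightarrow> real \<Rightarrow> real \<Rightarrow> real" where
  "F_density a b x =
     (if x > 0 then
        Gamma ((a + b) / 2) / (Gamma (a / 2) * Gamma (b / 2)) *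
        (a / b) powr (a / 2) * x powr (a / 2 - 1) * (1 + a / b * x) powr (- (a + b) / 2)
      else 0)"

definition F_distribution :: "real \<Rightarrow> real \<Rightarrow> real measure" where
  "F_distribution a b = density lborel (\<lambda>x. ennreal (F_density a b x))"

definition hyp2F1 :: "real \<Rightarrow> real \<Rightarrow> real \<Rightarrow> real \<Rightarrow> real" where
  "hyp2F1 a b c x =
     Gamma c / (Gamma a * Gamma b) *
     (\<Sum>k. Gamma (a + real k) * Gamma (b + real k) / Gamma (c + real k) * (x ^ k / fact k))"

end

theory Submission
  imports Defs "HOL-Real_Asymp.Real_Asymp"
begin

text \<open>
  Stack the observations so that the index of the coordinate, not time, enumerates the vectors: each
  coordinate of \<open>Y\<close> is a vector in \<open>\<real>\<^sup>T\<close>, and \<open>T S\<close> is the Gram matrix of these vectors. For the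
  inverse \<open>V\<close> of a Gram matrix, \<open>v\<^sub>j\<^sub>j\<close> is the reciprocal squared length of the residual of the
  \<open>j\<close>-th vector on the span \<open>H\<close> of all the others, while the \<open>j\<close>-th diagonal entry of the inverse of the
  upper-left block is the squared length of its residual on the span \<open>G\<close> of the factors alone
  (\<open>upper_left_inverse_gram\<close>). Hence \<open>v\<^sub>j\<^sub>j v\<^sub>j\<^sub>j\<^sup>(\<^sup>-\<^sup>) - 1\<close> is the ratio of the squared lengths of two orthogonal
  projections of that vector, onto the orthogonal complement of \<open>G\<close> in \<open>H\<close> (dimension \<open>p - 1\<close>) and onto
  the orthogonal complement of \<open>H\<close> (dimension \<open>T - K - p + 1\<close>). The same lemma computes \<open>\<lambda>\<^sub>j\<close> from a factor
  of the covariance matrix.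

  Choose a factor \<open>L\<close> of \<open>\<Sigma>\<^sub>u\<close> whose \<open>j\<close>-th row vanishes outside \<open>j\<close> and one further index
  \<open>i\<close>, and whose other rows vanish at \<open>j\<close> (\<open>pos_def_factor\<close>). In terms of the standardized noise and
  factors, which are i.i.d. standard Gaussian vectors \<open>w\<^sub>m\<close> of \<open>\<real>\<^sup>T\<close>, the ratio becomes
  \<open>\<parallel>res\<^sub>G(w\<^sub>j + \<rho> w\<^sub>i)\<parallel>\<^sup>2 / \<parallel>res\<^sub>H w\<^sub>j\<parallel>\<^sup>2 - 1\<close> with \<open>\<rho>\<^sup>2 = \<lambda>\<^sub>j\<close>, where \<open>H\<close> does not involve \<open>w\<^sub>j\<close>.

  Integrate over \<open>w\<^sub>j\<close> first. Almost surely \<open>H\<close> has dimension \<open>p + K - 1\<close>, and in an orthonormal basis adapted to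
  \<open>G \<subseteq> H\<close> the ratio is a noncentral over a central \<open>\<chi>\<^sup>2\<close> variable with noncentrality
  \<open>\<rho>\<^sup>2 \<parallel>res\<^sub>G w\<^sub>i\<parallel>\<^sup>2\<close>, so its law is a Poisson mixture of beta prime laws (\<open>nn_integral_gauss_ratio\<close>). Integrating
  over \<open>w\<^sub>i\<close> next, \<open>\<parallel>res\<^sub>G w\<^sub>i\<parallel>\<^sup>2\<close> is \<open>\<chi>\<^sup>2\<close> with \<open>T - K\<close> degrees of freedom, which turns the Poisson weights into
  negative binomial ones (\<open>nn_integral_ratio_mixture\<close>). Summing the mixture gives the hypergeometric
  series (\<open>mix_density_sums\<close>). All laws are handled as equations between integrals of an arbitrary
  nonnegative Borel function, and conditioning is replaced by resampling one coordinate of a product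
  measure.
\<close>

section \<open>Matrices and measurability\<close>

lemma borel_measurable_vec:
  fixes f :: "'a \<Rightarrow> real^'n"
  assumes "\<And>i. (\<lambda>x. f x $ i) \<in> borel_measurable M"
  shows "f \<in> borel_measurable M"
proof (subst borel_measurable_euclidean_space, intro ballI)
  fix b :: "real^'n" assume "b \<in> Basis"
  then obtain i where "b = axis i 1" by (auto simp: Basis_vec_def)
  then show "(\<lambda>x. f x \<bullet> b) \<in> borel_measurable M" using assms[of i] by (simp add: inner_axis)
qed

lemma borel_measurable_vec_nth [measurable]:
  fixes f :: "'a \<Rightarrow> real^'n"
  assumes "f \<in> borel_measurable M"
  shows "(\<lambda>x. f x $ i) \<in> borel_measurable M"
  using measurable_compose[OF assms, of "\<lambda>x. x $ i" borel]
  by (simp add: borel_measurable_continuous_onI continuous_on_component)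

lemma measurable_vec_lambda [measurable]:
  "vec_lambda \<in> measurable (PiM UNIV (\<lambda>_::'n::finite. borel :: real measure)) borel"
  by (rule borel_measurable_vec) simp

lemma borel_measurable_det:
  fixes A :: "'a \<Rightarrow> real^'n^'n"
  assumes [measurable]: "\<And>i k. (\<lambda>x. A x $ i $ k) \<in> borel_measurable M"
  shows "(\<lambda>x. det (A x)) \<in> borel_measurable M"
  unfolding det_def by measurable

lemma matrix_inv_inverse:
  assumes "invertible (A::real^'n^'n)"
  shows "A ** matrix_inv A = mat 1" "matrix_inv A ** A = mat 1"
proof -
  have "A ** matrix_inv A = mat 1 \<and> matrix_inv A ** A = mat 1"
    using assms unfolding invertible_def matrix_inv_def by (rule someI_ex)
  then show "A ** matrix_inv A = mat 1" "matrix_inv A ** A = mat 1" by auto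
qed

lemma matrix_inv_unique:
  assumes "A ** C = mat 1" "C ** A = mat (1::real)"
  shows "matrix_inv (A::real^'n^'n) = C"
proof -
  have "invertible A" using assms by (auto simp: invertible_def)
  then have "matrix_inv A = matrix_inv A ** (A ** C)" by (simp add: assms)
  also have "\<dots> = C" using matrix_inv_inverse(2)[OF \<open>invertible A\<close>] by (simp add: matrix_mul_assoc)
  finally show ?thesis .
qed

lemma matrix_vector_mult_eq_iff: "invertible (A::real^'n^'n) \<Longrightarrow> A *v x = b \<longleftrightarrow> x = matrix_inv A *v b"
  by (metis matrix_inv_inverse matrix_vector_mul_assoc matrix_vector_mul_lid)

lemma matrix_inv_entry:
  fixes A :: "real^'n^'n"
  assumes "det A \<noteq> 0"
  shows "matrix_inv A $ i $ k =
    det (\<chi> a b. if b = i then axis k 1 $ a else A $ a $ b) / det A"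
proof -
  have inv: "invertible A" using assms by (simp add: invertible_det_nz)
  have "A *v (matrix_inv A *v axis k 1) = axis k 1"
    using inv matrix_vector_mult_eq_iff by blast
  with cramer[OF assms, of "matrix_inv A *v axis k 1" "axis k 1"]
  have "matrix_inv A *v axis k 1 =
    (\<chi> i. det (\<chi> a b. if b = i then axis k 1 $ a else A $ a $ b) / det A)" by simp
  moreover have "(matrix_inv A *v axis k 1) $ i = matrix_inv A $ i $ k"
    by (simp add: matrix_vector_mult_basis column_def)
  ultimately show ?thesis by simp
qed

text \<open>At singular matrices \<open>matrix_inv\<close> is one fixed unspecified matrix, so no exceptional set is needed.\<close>

lemma borel_measurable_matrix_inv:
  fixes A :: "'a \<Rightarrow> real^'n^'n"
  assumes [measurable]: "\<And>i k. (\<lambda>x. A x $ i $ k) \<in> borel_measurable M"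
  shows "(\<lambda>x. matrix_inv (A x) $ i $ k) \<in> borel_measurable M"
proof -
  define c :: "real^'n^'n" where "c = (SOME A'. False)"
  have sing: "matrix_inv B = c" if "det B = 0" for B :: "real^'n^'n"
  proof -
    have "(\<lambda>A'. B ** A' = mat 1 \<and> A' ** B = mat 1) = (\<lambda>A'. False)"
      using that by (metis invertible_det_nz invertible_def)
    then show ?thesis unfolding matrix_inv_def c_def by simp
  qed
  have eq: "(\<lambda>x. matrix_inv (A x) $ i $ k) = (\<lambda>x. if det (A x) = 0 then c $ i $ k else
      det (\<chi> a b. if b = i then axis k 1 $ a else A x $ a $ b) / det (A x))"
    using sing matrix_inv_entry by (auto simp: fun_eq_iff)
  have [measurable]: "(\<lambda>x. det (A x)) \<in> borel_measurable M"
    "(\<lambda>x. det (\<chi> a b. if b = i then axis k 1 $ a else A x $ a $ b)) \<in> borel_measurable M"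
    by (rule borel_measurable_det; simp; measurable)+
  show ?thesis unfolding eq by measurable
qed

section \<open>Standard Gaussian vectors\<close>

text \<open>The standard normal law on the line.\<close>

definition std_normal :: "real measure" where
  "std_normal = density lborel (\<lambda>x. ennreal (std_normal_density x))"

text \<open>The standard Gaussian law on \<open>\<real>\<^sup>n\<close>, defined by independent coordinates; its Lebesgue density is
  derived below.\<close>

definition gauss :: "(real^'n) measure" where
  "gauss = distr (PiM UNIV (\<lambda>_. std_normal)) borel vec_lambda"

lemma space_std_normal [simp]: "space std_normal = UNIV"
  and sets_std_normal [simp, measurable_cong]: "sets std_normal = sets borel"
  by (simp_all add: std_normal_def)

lemma space_gauss [simp]: "space gauss = UNIV"
  and sets_gauss [simp, measurable_cong]: "sets gauss = sets borel"
  by (simp_all add: gauss_def)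

lemma prob_space_std_normal: "prob_space std_normal"
  unfolding std_normal_def by (rule prob_space_normal_density) simp

lemma measurable_vec_lambda_std_normal [measurable]:
  "vec_lambda \<in> measurable (PiM UNIV (\<lambda>_::'n::finite. std_normal)) borel"
proof -
  have "sets (PiM UNIV (\<lambda>_::'n. std_normal)) = sets (PiM UNIV (\<lambda>_::'n. borel :: real measure))"
    by (rule sets_PiM_cong) auto
  then show ?thesis using measurable_vec_lambda measurable_cong_sets by blast
qed

lemma prob_space_gauss: "prob_space gauss"
  unfolding gauss_def
  by (intro prob_space.prob_space_distr prob_space_PiM prob_space_std_normal)
    measurable

lemma PiE_UNIV: "PiE UNIV A = {f. \<forall>i. f i \<in> A i}"
  by (auto simp: PiE_def Pi_def extensional_def)

lemma measurable_PiM_resample: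
  "(\<lambda>(w, x). w(i := x)) \<in> measurable (PiM UNIV M \<Otimes>\<^sub>M M i) (PiM UNIV M)"
  using measurable_add_dim[of i UNIV M] by (simp add: insert_absorb)

text \<open>Replacing one coordinate of a product-distributed family by an independent copy does not
  change the law. Used repeatedly, this stands in for conditioning on all the other coordinates.\<close>

lemma distr_PiM_resample:
  fixes M :: "'i::finite \<Rightarrow> 'a measure"
  assumes prob: "\<And>i. prob_space (M i)"
  shows "distr (PiM UNIV M \<Otimes>\<^sub>M M i) (PiM UNIV M) (\<lambda>(w, x). w(i := x)) = PiM UNIV M"
proof -
  interpret Mi: prob_space "M i" by (rule prob)
  interpret P: product_prob_space M UNIV
    by (rule product_prob_spaceI) (rule prob)
  interpret Q: prob_space "PiM UNIV M" by (rule P.prob_space_axioms)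
  interpret pair_sigma_finite "PiM UNIV M" "M i" ..
  have meas [measurable]: "(\<lambda>(w, x). w(i := x)) \<in> measurable (PiM UNIV M \<Otimes>\<^sub>M M i) (PiM UNIV M)"
    by (rule measurable_PiM_resample)
  show ?thesis
  proof (rule P.PiM_eqI)
    fix A assume A: "\<And>i. i \<in> UNIV \<Longrightarrow> A i \<in> sets (M i)"
    have [measurable]: "Pi\<^sub>E UNIV A \<in> sets (PiM UNIV M)" using A by (intro sets_PiM_I_finite) auto
    then have [measurable]: "{f. \<forall>i. f i \<in> A i} \<in> sets (PiM UNIV M)" by (simp add: PiE_UNIV)
    have B: "(A(i := space (M i))) l \<in> sets (M l)" for l using A by auto
    have "emeasure (distr (PiM UNIV M \<Otimes>\<^sub>M M i) (PiM UNIV M) (\<lambda>(w, x). w(i := x))) (PiE UNIV A)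
       = emeasure (PiM UNIV M \<Otimes>\<^sub>M M i) (PiE UNIV (A(i := space (M i))) \<times> A i)"
      by (subst emeasure_distr)
        (auto simp: PiE_UNIV space_pair_measure space_PiM split: if_splits
          intro!: arg_cong[where f="emeasure (PiM UNIV M \<Otimes>\<^sub>M M i)"] dest: A[THEN sets.sets_into_space, THEN subsetD, rotated])
    also have "\<dots> = emeasure (PiM UNIV M) (PiE UNIV (A(i := space (M i)))) * emeasure (M i) (A i)"
      using A B by (intro sigma_finite_measure.emeasure_pair_measure_Times[OF Mi.sigma_finite_measure_axioms] sets_PiM_I_finite) auto
    also have "emeasure (PiM UNIV M) (PiE UNIV (A(i := space (M i)))) = (\<Prod>l\<in>UNIV. emeasure (M l) ((A(i := space (M i))) l))"
      using B by (intro P.emeasure_PiM) auto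
    also have "\<dots> = (\<Prod>l\<in>UNIV-{i}. emeasure (M l) (A l))"
      by (subst prod.remove[of _ i]) (auto simp: Mi.emeasure_space_1 intro!: prod.cong)
    also have "\<dots> * emeasure (M i) (A i) = (\<Prod>l\<in>UNIV. emeasure (M l) (A l))"
      by (subst (2) prod.remove[of _ i]) (auto simp: mult.commute)
    finally show "emeasure (distr (PiM UNIV M \<Otimes>\<^sub>M M i) (PiM UNIV M) (\<lambda>(w, x). w(i := x))) (PiE UNIV A)
      = (\<Prod>l\<in>UNIV. emeasure (M l) (A l))" .
  qed auto
qed

lemma nn_integral_PiM_resample:
  fixes M :: "'i::finite \<Rightarrow> 'a measure"
  assumes prob: "\<And>i. prob_space (M i)" and F [measurable]: "F \<in> borel_measurable (PiM UNIV M)"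
  shows "(\<integral>\<^sup>+w. F w \<partial>PiM UNIV M) = (\<integral>\<^sup>+w. (\<integral>\<^sup>+x. F (w(i := x)) \<partial>M i) \<partial>PiM UNIV M)"
proof -
  interpret Mi: prob_space "M i" by (rule prob)
  have meas [measurable]: "(\<lambda>(w, x). w(i := x)) \<in> measurable (PiM UNIV M \<Otimes>\<^sub>M M i) (PiM UNIV M)"
    by (rule measurable_PiM_resample)
  have "(\<integral>\<^sup>+w. F w \<partial>PiM UNIV M) = (\<integral>\<^sup>+w. F w \<partial>distr (PiM UNIV M \<Otimes>\<^sub>M M i) (PiM UNIV M) (\<lambda>(w, x). w(i := x)))"
    by (simp add: distr_PiM_resample prob)
  also have "\<dots> = (\<integral>\<^sup>+wx. F ((\<lambda>(w, x). w(i := x)) wx) \<partial>(PiM UNIV M \<Otimes>\<^sub>M M i))"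
    by (rule nn_integral_distr) auto
  also have "\<dots> = (\<integral>\<^sup>+w. (\<integral>\<^sup>+x. F (w(i := x)) \<partial>M i) \<partial>PiM UNIV M)"
    by (subst Mi.nn_integral_fst[symmetric]) (auto simp: case_prod_beta')
  finally show ?thesis .
qed

lemma AE_PiM_resampleI:
  fixes M :: "'i::finite \<Rightarrow> 'a measure"
  assumes prob: "\<And>i. prob_space (M i)" and P [measurable]: "Measurable.pred (PiM UNIV M) P"
    and AE: "\<And>w. w \<in> space (PiM UNIV M) \<Longrightarrow> AE x in M i. P (w(i := x))"
  shows "AE w in PiM UNIV M. P w"
proof -
  have meas [measurable]: "w \<in> space (PiM UNIV M) \<Longrightarrow> (\<lambda>x. w(i := x)) \<in> measurable (M i) (PiM UNIV M)" for w
    using measurable_add_dim[of i UNIV M]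
    by (auto simp: insert_absorb intro!: measurable_fun_upd[where J="UNIV"] )
  have "(\<integral>\<^sup>+w. indicator {w \<in> space (PiM UNIV M). \<not> P w} w \<partial>PiM UNIV M) =
    (\<integral>\<^sup>+w. (\<integral>\<^sup>+x. indicator {w \<in> space (PiM UNIV M). \<not> P w} (w(i := x)) \<partial>M i) \<partial>PiM UNIV M)"
    by (rule nn_integral_PiM_resample[OF prob]) auto
  also have "\<dots> = (\<integral>\<^sup>+w. 0 \<partial>PiM UNIV M)"
  proof (rule nn_integral_cong)
    fix w assume w: "w \<in> space (PiM UNIV M)"
    have "AE x in M i. indicator {w \<in> space (PiM UNIV M). \<not> P w} (w(i := x)) = (0::ennreal)"
      using AE[OF w] by eventually_elim auto
    then have "(\<integral>\<^sup>+x. indicator {w \<in> space (PiM UNIV M). \<not> P w} (w(i := x)) \<partial>M i) = (\<integral>\<^sup>+x. 0 \<partial>M i)"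
      by (intro nn_integral_cong_AE) (auto )
    then show "(\<integral>\<^sup>+x. indicator {w \<in> space (PiM UNIV M). \<not> P w} (w(i := x)) \<partial>M i) = 0" by simp
  qed
  finally have "emeasure (PiM UNIV M) {w \<in> space (PiM UNIV M). \<not> P w} = 0"
    by (subst (asm) nn_integral_indicator) auto
  then show ?thesis by (subst AE_iff_measurable[OF _ refl]) auto
qed

lemma AE_PiM_resampleD:
  fixes M :: "'i::finite \<Rightarrow> 'a measure"
  assumes prob: "\<And>i. prob_space (M i)" and P [measurable]: "Measurable.pred (PiM UNIV M) P"
    and AE: "AE w in PiM UNIV M. P w"
  shows "AE w in PiM UNIV M. AE x in M i. P (w(i := x))"
proof -
  interpret Mi: prob_space "M i" by (rule prob)
  have upd [measurable]: "(\<lambda>(w, x). w(i := x)) \<in> measurable (PiM UNIV M \<Otimes>\<^sub>M M i) (PiM UNIV M)"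
    by (rule measurable_PiM_resample)
  let ?f = "\<lambda>w. indicator {w \<in> space (PiM UNIV M). \<not> P w} w :: ennreal"
  have "(\<integral>\<^sup>+w. ?f w \<partial>PiM UNIV M) = (\<integral>\<^sup>+w. 0 \<partial>PiM UNIV M)"
    using AE by (intro nn_integral_cong_AE) auto
  then have "(\<integral>\<^sup>+w. (\<integral>\<^sup>+x. ?f (w(i := x)) \<partial>M i) \<partial>PiM UNIV M) = 0"
    by (subst nn_integral_PiM_resample[OF prob, symmetric]) auto
  then have "AE w in PiM UNIV M. (\<integral>\<^sup>+x. ?f (w(i := x)) \<partial>M i) = 0"
    by (subst (asm) nn_integral_0_iff_AE) measurable
  then show ?thesis using AE_space[of "PiM UNIV M"]
  proof eventually_elim
    case (elim w)
    have m: "(\<lambda>x. w(i := x)) \<in> measurable (M i) (PiM UNIV M)"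
      using measurable_compose[OF measurable_Pair1'[OF elim(2)] upd] by simp
    then have "AE x in M i. ?f (w(i := x)) = 0"
      using elim(1) by (subst (asm) nn_integral_0_iff_AE) (auto intro!: measurable_compose[OF m])
    then show ?case
      using AE_space by eventually_elim (use measurable_space[OF m] in \<open>auto simp: indicator_def split: if_splits\<close>)
  qed
qed

subsection \<open>Densities and linear images\<close>

lemma distr_vec_lambda_lborel:
  "distr (PiM UNIV (\<lambda>_. lborel)) borel vec_lambda = (lborel :: (real^'n) measure)"
proof (rule lborel_eqI[symmetric])
  interpret product_sigma_finite "\<lambda>_::'n. lborel :: real measure" by standard
  have [measurable]: "vec_lambda \<in> measurable (PiM UNIV (\<lambda>_::'n. lborel :: real measure)) borel"
    using measurable_vec_lambda by (simp cong: measurable_cong_sets sets_PiM_cong)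
  fix l u :: "real^'n" assume le: "\<And>b. b \<in> Basis \<Longrightarrow> l \<bullet> b \<le> u \<bullet> b"
  have le': "l $ i \<le> u $ i" for i using le[of "axis i 1"] by (simp add: inner_axis axis_in_Basis_iff)
  have "vec_lambda -` box l u \<inter> space (PiM UNIV (\<lambda>_::'n. lborel :: real measure)) = PiE UNIV (\<lambda>i. {l $ i <..< u $ i})"
    by (auto simp: PiE_UNIV space_PiM mem_box_cart)
  then have "emeasure (distr (PiM UNIV (\<lambda>_. lborel)) borel vec_lambda) (box l u) =
    (\<Prod>i\<in>UNIV. emeasure lborel {l $ i <..< u $ i})"
    by (subst emeasure_distr) (auto intro!: emeasure_PiM)
  also have "\<dots> = ennreal (\<Prod>i\<in>UNIV. (u - l) $ i)" using le' by (simp add: prod_ennreal)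
  also have "(\<Prod>i\<in>UNIV. (u - l) $ i) = (\<Prod>b\<in>Basis. (u - l) \<bullet> b)"
    unfolding Basis_vec_def
    by (subst prod.reindex_bij_betw[of "\<lambda>i. axis i (1::real)" UNIV, symmetric])
      (auto simp: bij_betw_def inj_on_def axis_eq_axis inner_axis)
  finally show "emeasure (distr (PiM UNIV (\<lambda>_. lborel)) borel vec_lambda) (box l u) = (\<Prod>b\<in>Basis. (u - l) \<bullet> b)" .
qed simp

lemma PiM_density_lborel:
  fixes g :: "'n::finite \<Rightarrow> real \<Rightarrow> ennreal"
  assumes [measurable]: "\<And>i. g i \<in> borel_measurable borel"
    and pr: "\<And>i. prob_space (density lborel (g i))"
  shows "PiM UNIV (\<lambda>i. density lborel (g i)) = density (PiM UNIV (\<lambda>_. lborel)) (\<lambda>x. \<Prod>i\<in>UNIV. g i (x i))"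
proof (rule product_sigma_finite.PiM_eqI[symmetric])
  interpret L: product_sigma_finite "\<lambda>_::'n. lborel :: real measure" by standard
  show "product_sigma_finite (\<lambda>i. density lborel (g i))"
    using pr by (auto intro!: product_sigma_finite.intro simp: prob_space_imp_sigma_finite)
  fix A assume "\<And>i. i \<in> UNIV \<Longrightarrow> A i \<in> sets (density lborel (g i))"
  then have A[measurable]: "A i \<in> sets borel" for i by auto
  have "emeasure (density (PiM UNIV (\<lambda>_. lborel)) (\<lambda>x. \<Prod>i\<in>UNIV. g i (x i))) (PiE UNIV A) =
    (\<integral>\<^sup>+x. (\<Prod>i\<in>UNIV. g i (x i)) * indicator (PiE UNIV A) x \<partial>PiM UNIV (\<lambda>_. lborel))"
    by (rule emeasure_density) (auto intro!: sets_PiM_I_finite)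
  also have "\<dots> = (\<integral>\<^sup>+x. (\<Prod>i\<in>UNIV. g i (x i) * indicator (A i) (x i)) \<partial>PiM UNIV (\<lambda>_. lborel))"
    by (rule nn_integral_cong) (auto simp: PiE_UNIV prod.distrib indicator_def prod_zero_iff)
  also have "\<dots> = (\<Prod>i\<in>UNIV. \<integral>\<^sup>+x. g i x * indicator (A i) x \<partial>lborel)"
    by (rule L.product_nn_integral_prod) auto
  also have "\<dots> = (\<Prod>i\<in>UNIV. emeasure (density lborel (g i)) (A i))"
    by (simp add: emeasure_density)
  finally show "emeasure (density (PiM UNIV (\<lambda>_. lborel)) (\<lambda>x. \<Prod>i\<in>UNIV. g i (x i))) (PiE UNIV A) =
    (\<Prod>i\<in>UNIV. emeasure (density lborel (g i)) (A i))" .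
qed (auto cong: sets_PiM_cong)

text \<open>The Lebesgue density of \<open>gauss\<close>.\<close>

definition gauss_density :: "real^'n \<Rightarrow> real" where
  "gauss_density x = exp (- (x \<bullet> x) / 2) / sqrt ((2 * pi) ^ CARD('n))"

lemma gauss_density_prod: "gauss_density x = (\<Prod>i\<in>UNIV. std_normal_density (x $ i))"
proof -
  have "(\<Prod>i\<in>UNIV. std_normal_density (x $ i)) = (\<Prod>i\<in>UNIV. exp (- (x $ i)\<^sup>2 / 2)) / (\<Prod>i\<in>(UNIV::'a set). sqrt (2 * pi))"
    by (simp only: std_normal_density_def prod_dividef times_divide_eq_left mult_1)
  also have "(\<Prod>i\<in>UNIV. exp (- (x $ i)\<^sup>2 / 2)) = exp (- (x \<bullet> x) / 2)"
    by (simp add: exp_sum[symmetric] inner_vec_def power2_eq_square sum_divide_distrib sum_negf)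
  also have "(\<Prod>i\<in>(UNIV::'a set). sqrt (2 * pi)) = sqrt ((2 * pi) ^ CARD('a))"
    by (simp only: prod_constant real_sqrt_power)
  finally show ?thesis by (simp add: gauss_density_def)
qed

lemma borel_measurable_gauss_density [measurable]: "gauss_density \<in> borel_measurable borel"
  unfolding gauss_density_def by measurable

lemma gauss_eq_density: "gauss = density lborel (\<lambda>x::real^'n. ennreal (gauss_density x))"
proof -
  have "gauss = distr (PiM UNIV (\<lambda>_. std_normal)) borel (vec_lambda :: _ \<Rightarrow> real^'n)" by (rule gauss_def)
  also have "PiM UNIV (\<lambda>_::'n. std_normal) = density (PiM UNIV (\<lambda>_. lborel)) (\<lambda>x. \<Prod>i\<in>UNIV. ennreal (std_normal_density (x i)))"
    unfolding std_normal_def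
    by (rule PiM_density_lborel) (auto intro!: prob_space_normal_density)
  also have "(\<lambda>x::'n \<Rightarrow> real. \<Prod>i\<in>UNIV. ennreal (std_normal_density (x i))) = (\<lambda>x. ennreal (gauss_density (vec_lambda x)))"
    by (auto simp: gauss_density_prod prod_ennreal)
  also have "distr (density (PiM UNIV (\<lambda>_. lborel)) (\<lambda>x. ennreal (gauss_density (vec_lambda x)))) borel (vec_lambda :: _ \<Rightarrow> real^'n)
     = density (distr (PiM UNIV (\<lambda>_. lborel)) borel vec_lambda) (\<lambda>x. ennreal (gauss_density x))"
    using measurable_vec_lambda
    by (intro density_distr[symmetric]) (auto cong: measurable_cong_sets sets_PiM_cong)
  finally show ?thesis by (simp add: distr_vec_lambda_lborel)
qed

text \<open>By Tonelli, \<open>\<mu> A\<close> is the integral of \<open>1\<^sub>A(x) g(y - x)\<close> over \<open>x\<close> and \<open>y\<close> for any \<open>g\<close> of unit mass;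
  translating first in \<open>x\<close> and then in \<open>y\<close> gives a constant multiple of the Lebesgue measure of \<open>A\<close>.\<close>

lemma translation_invariant_eq_lborel:
  fixes \<mu> :: "'a::euclidean_space measure"
  assumes sf: "sigma_finite_measure \<mu>" and sets [measurable_cong, simp]: "sets \<mu> = sets borel"
    and inv: "\<And>a. distr \<mu> borel (\<lambda>x. x + a) = \<mu>"
  shows "\<exists>c. \<mu> = density lborel (\<lambda>_. c)"
proof -
  interpret m: sigma_finite_measure \<mu> by fact
  interpret pair_sigma_finite \<mu> "lborel :: 'a measure" ..
  define g :: "'a \<Rightarrow> ennreal" where "g = indicator (cbox 0 One)"
  have [measurable]: "g \<in> borel_measurable borel" unfolding g_def by simp
  have g1: "(\<integral>\<^sup>+y. g (y - x) \<partial>lborel) = 1" for x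
  proof -
    have "(\<integral>\<^sup>+y. g (y - x) \<partial>lborel) = (\<integral>\<^sup>+y. g (y - x) \<partial>distr lborel borel ((+) x))"
      by (simp add: lborel_distr_plus)
    also have "\<dots> = (\<integral>\<^sup>+y. g y \<partial>lborel)" by (subst nn_integral_distr) auto
    also have "\<dots> = 1" unfolding g_def by simp
    finally show ?thesis .
  qed
  define c where "c = (\<integral>\<^sup>+x. g (- x) \<partial>\<mu>)"
  have "emeasure \<mu> A = c * emeasure lborel A" if A [measurable]: "A \<in> sets borel" for A
  proof -
    have "emeasure \<mu> A = (\<integral>\<^sup>+x. indicator A x * (\<integral>\<^sup>+y. g (y - x) \<partial>lborel) \<partial>\<mu>)"
      by (simp add: g1)
    also have "\<dots> = (\<integral>\<^sup>+x. (\<integral>\<^sup>+y. indicator A x * g (y - x) \<partial>lborel) \<partial>\<mu>)"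
      by (simp add: nn_integral_cmult)
    also have "\<dots> = (\<integral>\<^sup>+y. (\<integral>\<^sup>+x. indicator A x * g (y - x) \<partial>\<mu>) \<partial>lborel)"
      by (rule Fubini'[symmetric]) measurable
    also have "\<dots> = (\<integral>\<^sup>+y. (\<integral>\<^sup>+x. indicator A x * g (y - x) \<partial>distr \<mu> borel (\<lambda>x. x + y)) \<partial>lborel)"
      by (simp add: inv)
    also have "\<dots> = (\<integral>\<^sup>+y. (\<integral>\<^sup>+x. indicator A (x + y) * g (- x) \<partial>\<mu>) \<partial>lborel)"
      by (intro nn_integral_cong, subst nn_integral_distr) auto
    also have "\<dots> = (\<integral>\<^sup>+x. (\<integral>\<^sup>+y. indicator A (x + y) * g (- x) \<partial>lborel) \<partial>\<mu>)"
      by (rule Fubini') measurable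
    also have "\<dots> = (\<integral>\<^sup>+x. (\<integral>\<^sup>+y. indicator A y \<partial>distr lborel borel ((+) x)) * g (- x) \<partial>\<mu>)"
      by (intro nn_integral_cong, subst nn_integral_distr) (auto simp: nn_integral_multc)
    also have "\<dots> = (\<integral>\<^sup>+x. emeasure lborel A * g (- x) \<partial>\<mu>)"
      by (simp add: lborel_distr_plus)
    also have "\<dots> = c * emeasure lborel A"
      unfolding c_def by (simp add: nn_integral_cmult mult.commute)
    finally show ?thesis .
  qed
  then have "\<mu> = density lborel (\<lambda>_. c)"
    by (intro measure_eqI) (auto simp: emeasure_density nn_integral_cmult_indicator)
  then show ?thesis by blast
qed

lemma borel_measurable_matrix_vector_mult:
  fixes L :: "real^'n^'m" shows "(\<lambda>x. L *v x) \<in> borel_measurable borel"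
  by (intro borel_measurable_continuous_onI linear_continuous_on)
    (simp add: matrix_vector_mul_linear linear_linear)

lemma distr_lborel_matrix:
  fixes L :: "real^'n^'n"
  assumes inv: "invertible L"
  shows "\<exists>c. distr lborel borel (\<lambda>x. L *v x) = density lborel (\<lambda>_. c)"
proof (rule translation_invariant_eq_lborel)
  note [measurable] = borel_measurable_matrix_vector_mult
  define C where "C = matrix_inv L"
  have LC: "L ** C = mat 1" "C ** L = mat 1" using matrix_inv_inverse[OF inv] by (auto simp: C_def)
  have LCv: "L *v (C *v x) = x" "C *v (L *v x) = x" for x
    by (simp_all add: matrix_vector_mul_assoc LC)
  show "sigma_finite_measure (distr lborel borel (\<lambda>x. L *v x))"
  proof (rule sigma_finite_measure_distr[where f="\<lambda>x. C *v x"])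
    show "sigma_finite_measure (distr (distr lborel borel (\<lambda>x. L *v x)) borel (\<lambda>x. C *v x))"
      by (subst distr_distr) (auto simp: o_def LCv distr_id2 sigma_finite_lborel)
  qed measurable
  show "distr (distr lborel borel (\<lambda>x. L *v x)) borel (\<lambda>x. x + a) = distr lborel borel (\<lambda>x. L *v x)" for a
  proof -
    have "distr (distr lborel borel (\<lambda>x. L *v x)) borel (\<lambda>x. x + a) = distr lborel borel (\<lambda>x. L *v (C *v a + x))"
      by (subst distr_distr) (auto simp: o_def matrix_vector_right_distrib LCv add.commute)
    also have "\<dots> = distr (distr lborel borel ((+) (C *v a))) borel (\<lambda>x. L *v x)"
      by (subst distr_distr) (auto simp: o_def)
    finally show ?thesis by (simp add: lborel_distr_plus)
  qed
qed simp

text \<open>The Jacobian need not be computed: both sides are probability measures whose densities are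
  proportional, which fixes the constant.\<close>

lemma distr_gauss_matrix:
  fixes L \<Sigma> :: "real^'n^'n"
  assumes LL: "L ** transpose L = \<Sigma>" and inv: "invertible L"
    and pr: "prob_space (density lborel (\<lambda>x. ennreal (mvn_density 0 \<Sigma> x)))"
  shows "distr gauss borel (\<lambda>x. L *v x) = density lborel (\<lambda>x. ennreal (mvn_density 0 \<Sigma> x))"
proof -
  note [measurable] = borel_measurable_matrix_vector_mult
  define C where "C = matrix_inv L"
  have LC: "L ** C = mat 1" "C ** L = mat 1" using matrix_inv_inverse[OF inv] by (auto simp: C_def)
  have TT: "transpose L ** transpose C = mat 1" "transpose C ** transpose L = mat 1"
    using LC by (metis matrix_transpose_mul transpose_mat)+
  have inv\<Sigma>: "matrix_inv \<Sigma> = transpose C ** C"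
  proof (rule matrix_inv_unique)
    have "\<Sigma> ** (transpose C ** C) = L ** (transpose L ** transpose C) ** C"
      unfolding LL[symmetric] by (simp add: matrix_mul_assoc)
    then show "\<Sigma> ** (transpose C ** C) = mat 1" by (simp add: TT LC)
    have "(transpose C ** C) ** \<Sigma> = transpose C ** (C ** L) ** transpose L"
      unfolding LL[symmetric] by (simp add: matrix_mul_assoc)
    then show "(transpose C ** C) ** \<Sigma> = mat 1" by (simp add: TT LC)
  qed
  define d where "d = 1 / sqrt (det \<Sigma>)"
  have dens: "mvn_density 0 \<Sigma> x = d * gauss_density (C *v x)" for x
  proof -
    have "x \<bullet> (matrix_inv \<Sigma> *v x) = (C *v x) \<bullet> (C *v x)"
      unfolding inv\<Sigma> by (metis dot_lmul_matrix matrix_vector_mul_assoc transpose_matrix_vector vector_transpose_matrix inner_commute)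
    then show ?thesis
      unfolding mvn_density_def gauss_density_def d_def
      by (simp add: real_sqrt_mult)
  qed
  have CL: "C *v (L *v x) = x" for x by (simp add: matrix_vector_mul_assoc LC)
  obtain c where c: "distr lborel borel (\<lambda>x. L *v x) = density lborel (\<lambda>_. c)"
    using distr_lborel_matrix[OF inv] by blast
  let ?E = "\<lambda>x. ennreal (gauss_density (C *v x))"
  have "distr gauss borel (\<lambda>x. L *v x) = distr (density lborel (\<lambda>x. ?E (L *v x))) borel (\<lambda>x. L *v x)"
    by (simp add: CL gauss_eq_density)
  also have "\<dots> = density (distr lborel borel (\<lambda>x. L *v x)) ?E"
    by (subst density_distr) auto
  also have "\<dots> = density lborel (\<lambda>x. c * ?E x)"
    unfolding c by (subst density_density_eq) auto
  finally have eq: "distr gauss borel (\<lambda>x. L *v x) = density lborel (\<lambda>x. c * ?E x)" .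
  have E0: "gauss_density x \<ge> 0" for x :: "real^'n" by (simp add: gauss_density_def)
  have mvn: "ennreal (mvn_density 0 \<Sigma> x) = ennreal d * ?E x" for x
    by (simp add: dens ennreal_mult'' E0)
  have "prob_space (distr gauss borel (\<lambda>x. L *v x))"
    by (intro prob_space.prob_space_distr prob_space_gauss) measurable
  from prob_space.emeasure_space_1[OF this]
  have 1: "c * (\<integral>\<^sup>+x. ?E x \<partial>lborel) = 1"
    unfolding eq by (simp add: emeasure_density nn_integral_cmult)
  from prob_space.emeasure_space_1[OF pr]
  have 2: "ennreal d * (\<integral>\<^sup>+x. ?E x \<partial>lborel) = 1"
    unfolding mvn by (simp add: emeasure_density nn_integral_cmult)
  \<comment> \<open>both constants normalise the same function to total mass one\<close>
  have "c = c * (ennreal d * (\<integral>\<^sup>+x. ?E x \<partial>lborel))" by (simp add: 2)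
  also have "\<dots> = ennreal d * (c * (\<integral>\<^sup>+x. ?E x \<partial>lborel))" by (simp add: mult_ac)
  also have "\<dots> = ennreal d" by (simp add: 1)
  finally show ?thesis unfolding eq mvn by simp
qed

lemma distr_gauss_orthogonal:
  fixes L :: "real^'n^'n"
  assumes LL: "orthogonal_matrix L"
  shows "distr gauss borel (\<lambda>x. L *v x) = gauss"
proof -
  have "matrix_inv (mat 1 :: real^'n^'n) = mat 1" by (rule matrix_inv_unique) auto
  then have eq: "mvn_density 0 (mat 1) = (gauss_density :: real^'n \<Rightarrow> real)"
    by (simp add: fun_eq_iff mvn_density_def gauss_density_def)
  have "invertible L" "L ** transpose L = mat 1"
    using LL by (auto simp: orthogonal_matrix_def invertible_def)
  from distr_gauss_matrix[OF this(2,1)] show ?thesis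
    using prob_space_gauss by (simp add: eq gauss_eq_density)
qed

subsection \<open>Rows and columns of a Gaussian matrix\<close>

lemma distr_PiM_gauss_rows:
  "distr (PiM (UNIV :: ('a::finite \<times> 'b::finite) set) (\<lambda>_. std_normal)) (PiM UNIV (\<lambda>_. borel))
     (\<lambda>w a. \<chi> b. w (a, b)) = PiM UNIV (\<lambda>_::'a. gauss :: (real^'b) measure)"
proof -
  let ?P = "PiM (UNIV :: ('a \<times> 'b) set) (\<lambda>_. std_normal)"
  interpret P: product_prob_space "\<lambda>_::'a\<times>'b. std_normal" UNIV
    by (rule product_prob_spaceI) (rule prob_space_std_normal)
  let ?X = "\<lambda>a w. (\<chi> b. w (a, b)) :: real^'b"
  have meas: "?X a \<in> measurable ?P borel" for a by (rule borel_measurable_vec) simp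
  have restr: "distr ?P (PiM I (\<lambda>_. std_normal)) (\<lambda>w. restrict w I) = PiM I (\<lambda>_. std_normal)" for I
    using distr_PiM_reindex[of UNIV "\<lambda>_. std_normal" id I] prob_space_std_normal by simp
  have coord: "distr ?P std_normal (\<lambda>w. w i) = std_normal" for i
    using distr_PiM_component[of UNIV "\<lambda>_. std_normal" i] prob_space_std_normal by simp
  have "P.indep_vars (\<lambda>_. std_normal) (\<lambda>i w. w i) UNIV"
    using P.indep_vars_iff_distr_eq_PiM[where I = UNIV and M' = "\<lambda>_. std_normal" and X = "\<lambda>i w. w i"] restr[of UNIV]
    by (simp add: coord restrict_UNIV)
  then have "P.indep_vars (\<lambda>a. PiM ({a} \<times> UNIV) (\<lambda>_. std_normal)) (\<lambda>a w. restrict w ({a} \<times> UNIV)) UNIV"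
    by (rule P.indep_vars_restrict) (auto simp: disjoint_family_on_def)
  then have "P.indep_vars (\<lambda>_. borel) (\<lambda>a w. ?X a (restrict w ({a} \<times> UNIV))) UNIV"
    by (rule P.indep_vars_compose2) (rule borel_measurable_vec, simp)
  then have ind: "P.indep_vars (\<lambda>_. borel) ?X UNIV" by simp
  have law: "distr ?P borel (?X a) = gauss" for a
  proof -
    have "distr ?P borel (?X a) = distr (distr ?P (PiM UNIV (\<lambda>_. std_normal)) (\<lambda>w b. w (a, b))) borel vec_lambda"
      by (subst distr_distr) (auto simp: o_def intro!: measurable_PiM_single')
    also have "distr ?P (PiM UNIV (\<lambda>_. std_normal)) (\<lambda>w b. w (a, b)) = PiM UNIV (\<lambda>_. std_normal)"
      using distr_PiM_reindex[of UNIV "\<lambda>_. std_normal" "Pair a" "UNIV :: 'b set"] prob_space_std_normal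
      by (simp add: inj_on_def restrict_UNIV)
    finally show ?thesis by (simp add: gauss_def)
  qed
  show ?thesis
    using P.indep_vars_iff_distr_eq_PiM[where I = UNIV and M' = "\<lambda>_. borel" and X = ?X] ind meas by (simp add: law restrict_UNIV)
qed

lemma measurable_transpose_rows:
  "(\<lambda>w b. (\<chi> a. w a $ b)) \<in> measurable (PiM UNIV (\<lambda>_::'a::finite. borel :: (real^'b::finite) measure)) (PiM UNIV (\<lambda>_::'b. borel :: (real^'a) measure))"
proof (rule measurable_PiM_single')
  show "(\<lambda>w. \<chi> a. w a $ b) \<in> measurable (PiM UNIV (\<lambda>_::'a::finite. borel :: (real^'b::finite) measure)) borel" for b :: 'b
    by (rule borel_measurable_vec) simp
qed auto

text \<open>The rows of a matrix are i.i.d. standard Gaussian iff the columns are, since both mean that all the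
  entries are i.i.d. This turns i.i.d. observations into i.i.d. coordinate vectors.\<close>

lemma distr_PiM_gauss_transpose:
  "distr (PiM UNIV (\<lambda>_::'a::finite. gauss :: (real^'b::finite) measure)) (PiM UNIV (\<lambda>_. borel))
     (\<lambda>w b. \<chi> a. w a $ b) = PiM UNIV (\<lambda>_::'b. gauss :: (real^'a) measure)"
proof -
  let ?P = "PiM (UNIV :: ('a \<times> 'b) set) (\<lambda>_. std_normal)"
  let ?Q = "PiM (UNIV :: ('b \<times> 'a) set) (\<lambda>_. std_normal)"
  have m1: "(\<lambda>w a. \<chi> b. w (a, b)) \<in> measurable ?P (PiM UNIV (\<lambda>_::'a. borel :: (real^'b) measure))"
    by (rule measurable_PiM_single') (auto intro!: borel_measurable_vec)
  have m2: "(\<lambda>w a. \<chi> b. w (a, b)) \<in> measurable ?Q (PiM UNIV (\<lambda>_::'b. borel :: (real^'a) measure))"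
    by (rule measurable_PiM_single') (auto intro!: borel_measurable_vec)
  have m3: "(\<lambda>w n. w (prod.swap n)) \<in> measurable ?P ?Q"
    by (rule measurable_PiM_single') auto
  have swap: "distr ?P ?Q (\<lambda>w n. w (prod.swap n)) = ?Q"
    using distr_PiM_reindex[of UNIV "\<lambda>_. std_normal" prod.swap "UNIV :: ('b \<times> 'a) set"] prob_space_std_normal
    by (simp add: inj_on_def restrict_UNIV)
  have "distr (PiM UNIV (\<lambda>_::'a::finite. gauss :: (real^'b::finite) measure)) (PiM UNIV (\<lambda>_. borel)) (\<lambda>w b. \<chi> a. w a $ b)
     = distr ?P (PiM UNIV (\<lambda>_. borel)) (\<lambda>w b. \<chi> a. w (a, b))"
    unfolding distr_PiM_gauss_rows[symmetric]
    by (subst distr_distr[OF measurable_transpose_rows m1]) (simp add: o_def)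
  also have "\<dots> = distr (distr ?P ?Q (\<lambda>w n. w (prod.swap n))) (PiM UNIV (\<lambda>_. borel)) (\<lambda>w a. \<chi> b. w (a, b))"
    by (subst distr_distr[OF m2 m3]) (simp add: o_def)
  also have "\<dots> = PiM UNIV (\<lambda>_::'b. gauss :: (real^'a) measure)"
    unfolding swap by (rule distr_PiM_gauss_rows)
  finally show ?thesis .
qed

subsection \<open>Moments and null sets\<close>

lemma gauss_moments:
  shows "integrable gauss (\<lambda>w::real^'n. w $ i)" "(\<integral>w. w $ i \<partial>gauss) = 0"
    "integrable gauss (\<lambda>w::real^'n. w $ i * w $ k)" "(\<integral>w. w $ i * w $ k \<partial>gauss) = (if i = k then 1 else 0)"
proof -
  interpret N: prob_space std_normal by (rule prob_space_std_normal)
  interpret P: product_prob_space "\<lambda>_::'n. std_normal" UNIV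
    by (rule product_prob_spaceI) (rule prob_space_std_normal)
  have N1: "integrable std_normal (\<lambda>x. x)" "(\<integral>x. x \<partial>std_normal) = 0"
    unfolding std_normal_def using integrable_std_normal_moment[of 1] std_normal_moment_odd[of 0]
    by (simp_all add: integrable_density integral_density has_bochner_integral_iff)
  have N2: "integrable std_normal (\<lambda>x. x * x)" "(\<integral>x. x * x \<partial>std_normal) = 1"
    unfolding std_normal_def using integrable_std_normal_moment[of 2] std_normal_moment_even[of 1]
    by (simp_all add: integrable_density integral_density has_bochner_integral_iff power2_eq_square fact_numeral)
  have one: "integrable std_normal (\<lambda>x. 1 :: real)" "(\<integral>x. 1 \<partial>std_normal) = (1 :: real)"
    using N.prob_space by simp_all
  define h :: "'n \<Rightarrow> 'n \<Rightarrow> real \<Rightarrow> real" where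
    "h k l x = (if l = i then x else 1) * (if l = k then x else 1)" for k l x
  have h: "integrable std_normal (h k l) \<and> (\<integral>x. h k l x \<partial>std_normal) =
      (if (l = i) = (l = k) then 1 else 0)" for k l
  proof -
    consider "l = i" "l = k" | "l = i" "l \<noteq> k" | "l \<noteq> i" "l = k" | "l \<noteq> i" "l \<noteq> k" by blast
    then show ?thesis
    proof cases
      case 1
      then have "h k l = (\<lambda>x. x * x)" by (auto simp: h_def)
      with 1 show ?thesis using N2 by simp
    next
      case 2
      then have "h k l = (\<lambda>x. x)" by (auto simp: h_def)
      with 2 show ?thesis using N1 by simp
    next
      case 3
      then have "h k l = (\<lambda>x. x)" by (auto simp: h_def)
      with 3 show ?thesis using N1 by simp
    next
      case 4
      then have "h k l = (\<lambda>x. 1)" by (auto simp: h_def)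
      with 4 show ?thesis using one by simp
    qed
  qed
  have hp: "(\<Prod>l\<in>UNIV. h k l (w l)) = w i * w k" for k w
    unfolding h_def by (simp add: prod.distrib)
  have hprod: "(\<Prod>l\<in>UNIV. \<integral>x. h k l x \<partial>std_normal) = (if i = k then 1 else 0)" for k
  proof (cases "i = k")
    case False
    then have "(\<Prod>l\<in>UNIV. if (l = i) = (l = k) then 1 else 0 :: real) = 0"
      by (intro prod_zero) auto
    with False show ?thesis using h by simp
  qed (use h in simp)
  have I2: "integrable (PiM UNIV (\<lambda>_. std_normal)) (\<lambda>w. w i * w k)"
    "(\<integral>w. w i * w k \<partial>PiM UNIV (\<lambda>_. std_normal)) = (if i = k then 1 else 0)" for k
    using P.product_integrable_prod[of UNIV "h k"] P.product_integral_prod[of UNIV "h k"] h[of k]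
    unfolding hprod hp by simp_all
  define g :: "'n \<Rightarrow> real \<Rightarrow> real" where "g l x = (if l = i then x else 1)" for l x
  have g: "integrable std_normal (g l) \<and> (\<integral>x. g l x \<partial>std_normal) = (if l = i then 0 else 1)" for l
  proof (cases "l = i")
    case True
    then have "g l = (\<lambda>x. x)" by (auto simp: g_def)
    with True show ?thesis using N1 by simp
  next
    case False
    then have "g l = (\<lambda>x. 1)" by (auto simp: g_def)
    with False show ?thesis using one by simp
  qed
  have gp: "(\<Prod>l\<in>UNIV. g l (w l)) = w i" for w
    unfolding g_def by simp
  have "(\<Prod>l\<in>UNIV. if l = i then 0 else 1 :: real) = 0" by (intro prod_zero) auto
  then have gprod: "(\<Prod>l\<in>UNIV. \<integral>x. g l x \<partial>std_normal) = 0" using g by simp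
  have I1: "integrable (PiM UNIV (\<lambda>_. std_normal)) (\<lambda>w. w i)"
    "(\<integral>w. w i \<partial>PiM UNIV (\<lambda>_. std_normal)) = 0"
    using P.product_integrable_prod[of UNIV g] P.product_integral_prod[of UNIV g] g
    unfolding gprod gp by simp_all
  show "integrable gauss (\<lambda>w::real^'n. w $ i)" "(\<integral>w. w $ i \<partial>gauss) = 0"
    "integrable gauss (\<lambda>w::real^'n. w $ i * w $ k)" "(\<integral>w. w $ i * w $ k \<partial>gauss) = (if i = k then 1 else 0)"
    unfolding gauss_def using I1 I2 by (simp_all add: integrable_distr_eq integral_distr)
qed

lemma AE_gauss_not_in_subspace:
  fixes S :: "(real^'n) set"
  assumes "subspace S" "dim S < CARD('n)"
  shows "AE x in gauss. x \<notin> S"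
proof -
  have "negligible S" using assms by (intro negligible_lowdim) simp
  moreover have "S \<in> sets borel" using closed_subspace[OF assms(1)] by simp
  ultimately have "S \<in> null_sets lborel"
    by (simp add: negligible_iff_null_sets null_sets_completion_iff)
  then have "AE x in lborel. x \<notin> S" by (rule AE_not_in)
  then show ?thesis unfolding gauss_eq_density by (subst AE_density) auto
qed

section \<open>Gamma, beta prime and mixture integrals\<close>

text \<open>The Gamma density with shape \<open>a\<close> and rate \<open>1/2\<close>, that is, the \<open>\<chi>\<^sup>2\<close> density with \<open>2a\<close> degrees of
  freedom.\<close>

definition gam :: "real \<Rightarrow> real \<Rightarrow> real" where
  "gam a y = (if y > 0 then y powr (a - 1) * exp (- y / 2) / (2 powr a * Gamma a) else 0)"

lemma gam_nonneg [simp]: "a > 0 \<Longrightarrow> gam a y \<ge> 0"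
  by (simp add: gam_def Gamma_real_pos less_imp_le)

lemma borel_measurable_gam [measurable]: "gam a \<in> borel_measurable borel"
  unfolding gam_def[abs_def] by measurable

lemma nn_integral_scale:
  fixes f :: "real \<Rightarrow> ennreal"
  assumes [measurable]: "f \<in> borel_measurable borel" and c: "c > 0"
  shows "(\<integral>\<^sup>+x. f x \<partial>lborel) = ennreal c * (\<integral>\<^sup>+x. f (c * x) \<partial>lborel)"
  using nn_integral_real_affine[of f c 0] c by simp

lemma nn_integral_gamma_rate:
  assumes a: "a > 0" and c: "c > (0::real)"
  shows "(\<integral>\<^sup>+x. ennreal (if x > 0 then x powr (a - 1) * exp (- c * x) else 0) \<partial>lborel) = ennreal (Gamma a / c powr a)"
proof -
  have "(\<integral>\<^sup>+x. ennreal (if x > 0 then x powr (a - 1) * exp (- x) else 0) \<partial>lborel)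
    = (\<integral>\<^sup>+x. ennreal (indicator {0..} x * x powr (a - 1) / exp x) \<partial>lborel)"
    by (intro nn_integral_cong) (auto simp: indicator_def exp_minus divide_inverse)
  also have "\<dots> = ennreal (Gamma a)"
    using Gamma_conv_nn_integral_real[OF a] by simp
  finally have "ennreal (Gamma a) = (\<integral>\<^sup>+x. ennreal (if x > 0 then x powr (a - 1) * exp (- x) else 0) \<partial>lborel)" ..
  also have "\<dots> = ennreal c * (\<integral>\<^sup>+x. ennreal (if c * x > 0 then (c * x) powr (a - 1) * exp (- (c * x)) else 0) \<partial>lborel)"
    by (rule nn_integral_scale) (use c in auto)
  also have "\<dots> = (\<integral>\<^sup>+x. ennreal (c powr a) * ennreal (if x > 0 then x powr (a - 1) * exp (- c * x) else 0) \<partial>lborel)"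
  proof (subst nn_integral_cmult[symmetric], measurable, rule nn_integral_cong)
    fix x :: real
    have "c * (c * x) powr (a - 1) = c powr a * x powr (a - 1)" if "x > 0"
      using that c by (simp add: powr_mult powr_diff)
    then show "ennreal c * ennreal (if c * x > 0 then (c * x) powr (a - 1) * exp (- (c * x)) else 0)
      = ennreal (c powr a) * ennreal (if x > 0 then x powr (a - 1) * exp (- c * x) else 0)"
      using c by (cases "x > 0") (auto simp: ennreal_mult'[symmetric] zero_less_mult_iff mult.assoc[symmetric] simp del: ennreal_mult')
  qed
  also have "\<dots> = ennreal (c powr a) * (\<integral>\<^sup>+x. ennreal (if x > 0 then x powr (a - 1) * exp (- c * x) else 0) \<partial>lborel)"
    by (rule nn_integral_cmult) measurable
  finally have "ennreal (1 / c powr a) * ennreal (Gamma a) =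
    ennreal (1 / c powr a) * (ennreal (c powr a) * (\<integral>\<^sup>+x. ennreal (if x > 0 then x powr (a - 1) * exp (- c * x) else 0) \<partial>lborel))"
    by simp
  then show ?thesis using c
    by (simp add: mult.assoc[symmetric] ennreal_mult'[symmetric] del: ennreal_mult')
qed

lemma nn_integral_Beta_scaled:
  assumes a: "a > 0" and b: "b > (0::real)" and s: "s > 0"
  shows "(\<integral>\<^sup>+x. ennreal (if 0 < x \<and> x < s then x powr (b - 1) * (s - x) powr (a - 1) else 0) \<partial>lborel)
     = ennreal (Beta a b * s powr (a + b - 1))"
proof -
  have "(\<integral>\<^sup>+x. ennreal (if 0 < x \<and> x < s then x powr (b - 1) * (s - x) powr (a - 1) else 0) \<partial>lborel) =
    ennreal s * (\<integral>\<^sup>+x. ennreal (if 0 < s * x \<and> s * x < s then (s * x) powr (b - 1) * (s - s * x) powr (a - 1) else 0) \<partial>lborel)"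
    by (rule nn_integral_scale) (use s in auto)
  also have "\<dots> = (\<integral>\<^sup>+x. ennreal (s powr (a + b - 1)) * (indicator {0..1} x * ennreal (x powr (b - 1) * (1 - x) powr (a - 1))) \<partial>lborel)"
  proof (subst nn_integral_cmult[symmetric], measurable, rule nn_integral_cong)
    fix x :: real
    show "ennreal s * ennreal (if 0 < s * x \<and> s * x < s then (s * x) powr (b - 1) * (s - s * x) powr (a - 1) else 0)
      = ennreal (s powr (a + b - 1)) * (indicator {0..1} x * ennreal (x powr (b - 1) * (1 - x) powr (a - 1)))"
    proof (cases "0 < x \<and> x < 1")
      case True
      have "s - s * x = s * (1 - x)" by (simp add: algebra_simps)
      then have "s * ((s * x) powr (b - 1) * (s - s * x) powr (a - 1)) = s powr (a + b - 1) * (x powr (b - 1) * (1 - x) powr (a - 1))"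
      proof -
        have "s powr (a + b - 1) = s powr (1 + (b - 1) + (a - 1))" by (simp add: algebra_simps)
        also have "\<dots> = s * s powr (b - 1) * s powr (a - 1)" using s by (simp only: powr_add powr_one)
        finally show ?thesis using s True \<open>s - s * x = s * (1 - x)\<close> by (simp add: powr_mult)
      qed
      then show ?thesis using True s by (simp add: ennreal_mult'[symmetric])
    next
      case False
      then have "\<not> (0 < s * x \<and> s * x < s)" using s by (simp add: zero_less_mult_iff)
      moreover have "x \<notin> {0..1} \<or> x = 0 \<or> x = 1" using False by auto
      ultimately show ?thesis by auto
    qed
  qed
  also have "\<dots> = ennreal (s powr (a + b - 1)) * ennreal (Beta b a)"
    using nn_integral_has_integral_lebesgue[OF _ has_integral_Beta_real[OF b a]]
    by (subst nn_integral_cmult, measurable) (simp add: ennreal_mult' ennreal_indicator[symmetric] del: ennreal_indicator)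
  finally show ?thesis by (simp add: ennreal_mult'' Beta_commute mult.commute)
qed

lemma gam_convolution:
  assumes a: "a > 0" and b: "b > 0" and [measurable]: "h \<in> borel_measurable borel"
  shows "(\<integral>\<^sup>+x. ennreal (gam b x) * (\<integral>\<^sup>+y. ennreal (gam a y) * h (y + x) \<partial>lborel) \<partial>lborel)
    = (\<integral>\<^sup>+s. ennreal (gam (a + b) s) * h s \<partial>lborel)"
proof -
  have shift: "(\<integral>\<^sup>+y. ennreal (gam a y) * h (y + x) \<partial>lborel) = (\<integral>\<^sup>+s. ennreal (gam a (s - x)) * h s \<partial>lborel)" for x
    using nn_integral_real_affine[of "\<lambda>s. ennreal (gam a (s - x)) * h s" 1 x] by (simp add: add.commute)
  have "(\<integral>\<^sup>+x. ennreal (gam b x) * (\<integral>\<^sup>+y. ennreal (gam a y) * h (y + x) \<partial>lborel) \<partial>lborel)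
    = (\<integral>\<^sup>+x. (\<integral>\<^sup>+s. h s * ennreal (gam b x * gam a (s - x)) \<partial>lborel) \<partial>lborel)"
    unfolding shift using a b
    by (intro nn_integral_cong, subst nn_integral_cmult[symmetric]) (auto simp: ennreal_mult mult_ac)
  also have "\<dots> = (\<integral>\<^sup>+s. (\<integral>\<^sup>+x. h s * ennreal (gam b x * gam a (s - x)) \<partial>lborel) \<partial>lborel)"
    by (rule lborel_pair.Fubini') measurable
  also have "\<dots> = (\<integral>\<^sup>+s. ennreal (gam (a + b) s) * h s \<partial>lborel)"
  proof (rule nn_integral_cong)
    fix s :: real
    define C where "C = exp (- s / 2) / (2 powr (a + b) * Gamma a * Gamma b)"
    have C: "C \<ge> 0" using a b by (simp add: C_def Gamma_real_pos less_imp_le)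
    have "gam b x * gam a (s - x) = C * (if 0 < x \<and> x < s then x powr (b - 1) * (s - x) powr (a - 1) else 0)" for x
    proof (cases "0 < x \<and> x < s")
      case True
      have "exp (- s / 2) = exp (- x / 2) * exp (- (s - x) / 2)"
        by (simp add: mult_exp_exp field_simps)
      moreover have "(x' * E) / (u * U) * ((y' * F) / (v * V)) = (E * F) / (v * u * V * U) * (x' * y')"
        for x' E u U y' F v V :: real by (simp add: mult_ac)
      ultimately show ?thesis using True by (simp only: gam_def C_def powr_add if_True diff_gt_0_iff_gt simp_thms)
    qed (auto simp: gam_def)
    then have "(\<integral>\<^sup>+x. ennreal (gam b x * gam a (s - x)) \<partial>lborel) =
      ennreal C * (\<integral>\<^sup>+x. ennreal (if 0 < x \<and> x < s then x powr (b - 1) * (s - x) powr (a - 1) else 0) \<partial>lborel)"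
      using C by (subst nn_integral_cmult[symmetric]) (auto simp: ennreal_mult')
    also have "\<dots> = ennreal (gam (a + b) s)"
    proof (cases "s > 0")
      case True
      have "Gamma a > 0" "Gamma b > 0" "Gamma (a + b) > 0" using a b by (auto intro: Gamma_real_pos)
      then have "C * (Beta a b * s powr (a + b - 1)) = gam (a + b) s"
        using True by (simp add: C_def Beta_def gam_def)
      then show ?thesis using True C by (simp add: nn_integral_Beta_scaled a b ennreal_mult'[symmetric])
    next
      case False
      then have "(\<integral>\<^sup>+x. ennreal (if 0 < x \<and> x < s then x powr (b - 1) * (s - x) powr (a - 1) else 0) \<partial>lborel) = (\<integral>\<^sup>+x. 0 \<partial>(lborel :: real measure))"
        by (intro nn_integral_cong) auto
      then show ?thesis using False by (simp add: gam_def)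
    qed
    finally show "(\<integral>\<^sup>+x. h s * ennreal (gam b x * gam a (s - x)) \<partial>lborel) = ennreal (gam (a + b) s) * h s"
      by (subst nn_integral_cmult) (auto simp: mult.commute)
  qed
  finally show ?thesis .
qed

text \<open>The beta prime density, the law of the ratio of two independent Gamma variables of shapes \<open>a\<close> and
  \<open>b\<close>.\<close>

definition bprime :: "real \<Rightarrow> real \<Rightarrow> real \<Rightarrow> real" where
  "bprime a b r = (if r > 0 then Gamma (a + b) / (Gamma a * Gamma b) * r powr (a - 1) * (1 + r) powr (- (a + b)) else 0)"

lemma bprime_nonneg [simp]: "a > 0 \<Longrightarrow> b > 0 \<Longrightarrow> bprime a b r \<ge> 0"
  by (simp add: bprime_def Gamma_real_pos less_imp_le)

lemma borel_measurable_bprime [measurable]: "bprime a b \<in> borel_measurable borel"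
  unfolding bprime_def[abs_def] by measurable

lemma gam_ratio:
  assumes a: "a > 0" and b: "b > 0" and [measurable]: "h \<in> borel_measurable borel"
  shows "(\<integral>\<^sup>+x. ennreal (gam b x) * (\<integral>\<^sup>+y. ennreal (gam a y) * h (y / x) \<partial>lborel) \<partial>lborel)
    = (\<integral>\<^sup>+r. ennreal (bprime a b r) * h r \<partial>lborel)"
proof -
  have sc: "ennreal (gam b x) * (\<integral>\<^sup>+y. ennreal (gam a y) * h (y / x) \<partial>lborel) =
     (\<integral>\<^sup>+r. h r * ennreal (gam b x * x * gam a (x * r)) \<partial>lborel)" for x
  proof (cases "x > 0")
    case True
    have "(\<integral>\<^sup>+y. ennreal (gam a y) * h (y / x) \<partial>lborel) = ennreal x * (\<integral>\<^sup>+r. ennreal (gam a (x * r)) * h (x * r / x) \<partial>lborel)"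
      by (rule nn_integral_scale) (use True in auto)
    then have "ennreal (gam b x) * (\<integral>\<^sup>+y. ennreal (gam a y) * h (y / x) \<partial>lborel) =
        ennreal (gam b x * x) * (\<integral>\<^sup>+r. ennreal (gam a (x * r)) * h r \<partial>lborel)"
      using True b by (simp add: ennreal_mult mult.assoc)
    also have "\<dots> = (\<integral>\<^sup>+r. ennreal (gam b x * x) * (ennreal (gam a (x * r)) * h r) \<partial>lborel)"
      by (rule nn_integral_cmult[symmetric]) measurable
    also have "\<dots> = (\<integral>\<^sup>+r. h r * ennreal (gam b x * x * gam a (x * r)) \<partial>lborel)"
      using True a b by (intro nn_integral_cong) (simp add: ennreal_mult mult_ac)
    finally show ?thesis .
  qed (simp add: gam_def)
  have "(\<integral>\<^sup>+x. ennreal (gam b x) * (\<integral>\<^sup>+y. ennreal (gam a y) * h (y / x) \<partial>lborel) \<partial>lborel)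
    = (\<integral>\<^sup>+r. (\<integral>\<^sup>+x. h r * ennreal (gam b x * x * gam a (x * r)) \<partial>lborel) \<partial>lborel)"
    unfolding sc by (rule lborel_pair.Fubini') measurable
  also have "\<dots> = (\<integral>\<^sup>+r. ennreal (bprime a b r) * h r \<partial>lborel)"
  proof (rule nn_integral_cong)
    fix r :: real
    have "(\<integral>\<^sup>+x. ennreal (gam b x * x * gam a (x * r)) \<partial>lborel) = ennreal (bprime a b r)"
    proof (cases "r > 0")
      case True
      define C where "C = r powr (a - 1) / (2 powr (a + b) * Gamma a * Gamma b)"
      have C: "C \<ge> 0" using a b by (simp add: C_def Gamma_real_pos less_imp_le)
      define c where "c = (1 + r) / 2"
      have c: "c > 0" using True by (simp add: c_def)
      have "gam b x * x * gam a (x * r) = C * (if x > 0 then x powr (a + b - 1) * exp (- c * x) else 0)" for x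
      proof (cases "x > 0")
        case pos: True
        have e: "exp (- c * x) = exp (- x / 2) * exp (- (x * r) / 2)"
          by (simp add: mult_exp_exp c_def field_simps)
        show ?thesis unfolding gam_def C_def e using pos True
          by (simp add: powr_add powr_mult powr_diff field_simps)
      qed (simp add: gam_def)
      then have "(\<integral>\<^sup>+x. ennreal (gam b x * x * gam a (x * r)) \<partial>lborel) =
          (\<integral>\<^sup>+x. ennreal C * ennreal (if x > 0 then x powr (a + b - 1) * exp (- c * x) else 0) \<partial>lborel)"
        using C by (simp only: ennreal_mult')
      also have "\<dots> = ennreal C * ennreal (Gamma (a + b) / c powr (a + b))"
        using a b c by (subst nn_integral_cmult) (auto simp: nn_integral_gamma_rate[simplified])
      also have "\<dots> = ennreal (bprime a b r)"
        using C True unfolding C_def c_def bprime_def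
        by (subst ennreal_mult'[symmetric]) (simp_all add: powr_divide powr_minus_divide[of "1 + r" "a + b", simplified] mult_ac)
      finally show ?thesis .
    next
      case False
      have "gam b x * x * gam a (x * r) = 0" for x
        using False by (auto simp: gam_def zero_less_mult_iff)
      then have "(\<integral>\<^sup>+x. ennreal (gam b x * x * gam a (x * r)) \<partial>lborel) = (\<integral>\<^sup>+x. 0 \<partial>(lborel :: real measure))"
        by (intro nn_integral_cong) (simp only: ennreal_0)
      then show ?thesis using False by (simp add: bprime_def)
    qed
    then show "(\<integral>\<^sup>+x. h r * ennreal (gam b x * x * gam a (x * r)) \<partial>lborel) = ennreal (bprime a b r) * h r"
      by (subst nn_integral_cmult) (auto simp: mult.commute)
  qed
  finally show ?thesis .
qed

text \<open>The substitution \<open>y = w\<^sup>2\<close> on the half-line.\<close>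

lemma distr_square_lborel:
  "distr (density lborel (\<lambda>w. ennreal (2 * w) * indicator {0..} w)) borel (\<lambda>w. w\<^sup>2) =
    density lborel (indicator {0::real..})"
proof (rule measure_eqI)
  fix A assume "A \<in> sets (distr (density lborel (\<lambda>w. ennreal (2 * w) * indicator {0..} w)) borel (\<lambda>w. w\<^sup>2))"
  then have [measurable]: "A \<in> sets borel" by simp
  have mono: "(\<integral>\<^sup>+y. G y * indicator {0..} y \<partial>lborel) = (SUP n. \<integral>\<^sup>+y. G y * indicator {0..g n} y \<partial>lborel)"
    if [measurable]: "G \<in> borel_measurable borel" and g: "incseq g" "filterlim g at_top sequentially"
    for G :: "real \<Rightarrow> ennreal" and g :: "nat \<Rightarrow> real"
  proof -
    have "(\<Union>n. {0..g n}) = {0..}"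
    proof safe
      fix x :: real assume "0 \<le> x"
      have "\<forall>\<^sub>F n in sequentially. g n \<ge> x" using g(2) by (auto simp: filterlim_at_top)
      then obtain n where "g n \<ge> x" by (auto simp: eventually_sequentially)
      then show "x \<in> (\<Union>n. {0..g n})" using \<open>0 \<le> x\<close> by auto
    qed auto
    then have "(\<integral>\<^sup>+y. G y * indicator {0..} y \<partial>lborel) = emeasure (density lborel G) (\<Union>n. {0..g n})"
      by (simp add: emeasure_density)
    also have "\<dots> = (SUP n. emeasure (density lborel G) {0..g n})"
      using g(1) by (intro SUP_emeasure_incseq[symmetric]) (auto simp: incseq_def intro: order_trans)
    finally show ?thesis by (simp add: emeasure_density)
  qed
  have fin: "(\<integral>\<^sup>+y. ennreal (indicator A y) * indicator {0..(real n)\<^sup>2} y \<partial>lborel) =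
     (\<integral>\<^sup>+w. ennreal (indicator A (w\<^sup>2)) * ennreal (2 * w) * indicator {0..real n} w \<partial>lborel)" for n
  proof -
    have "(\<integral>\<^sup>+y. ennreal (indicator A y * indicator {0\<^sup>2..(real n)\<^sup>2} y) \<partial>lborel) =
      (\<integral>\<^sup>+w. ennreal (indicator A (w\<^sup>2) * (2 * w) * indicator {0..real n} w) \<partial>lborel)"
      by (rule nn_integral_substitution)
        (auto intro!: derivative_eq_intros continuous_intros simp: set_borel_measurable_def)
    moreover have "ennreal (indicator A y * indicator {0\<^sup>2..(real n)\<^sup>2} y) = ennreal (indicator A y) * indicator {0..(real n)\<^sup>2} y" for y
      by (auto simp: indicator_def)
    moreover have "ennreal (indicator A (w\<^sup>2) * (2 * w) * indicator {0..real n} w) =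
       ennreal (indicator A (w\<^sup>2)) * ennreal (2 * w) * indicator {0..real n} w" for w
      by (auto simp: indicator_def)
    ultimately show ?thesis by simp
  qed
  have "(\<integral>\<^sup>+y. ennreal (indicator A y) * indicator {0..} y \<partial>lborel) = (SUP n. \<integral>\<^sup>+y. ennreal (indicator A y) * indicator {0..(real n)\<^sup>2} y \<partial>lborel)"
    by (rule mono) (auto simp: incseq_def intro!: power_mono filterlim_pow_at_top filterlim_real_sequentially)
  also have "\<dots> = (SUP n. \<integral>\<^sup>+w. ennreal (indicator A (w\<^sup>2)) * ennreal (2 * w) * indicator {0..real n} w \<partial>lborel)"
    by (simp only: fin)
  also have "\<dots> = (\<integral>\<^sup>+w. ennreal (indicator A (w\<^sup>2)) * ennreal (2 * w) * indicator {0..} w \<partial>lborel)"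
    by (rule mono[symmetric]) (auto simp: incseq_def filterlim_real_sequentially)
  finally have eq: "(\<integral>\<^sup>+y. indicator {0..} y * indicator A y \<partial>lborel) = (\<integral>\<^sup>+w. (ennreal (2 * w) * indicator {0..} w) * indicator ((\<lambda>w. w\<^sup>2) -` A) w \<partial>lborel)"
    by (simp add: ennreal_indicator mult_ac indicator_vimage)
  have [measurable]: "(\<lambda>w. w\<^sup>2) -` A \<in> sets borel" using measurable_sets[of "\<lambda>w::real. w\<^sup>2" borel borel A] by simp
  show "emeasure (distr (density lborel (\<lambda>w. ennreal (2 * w) * indicator {0..} w)) borel (\<lambda>w. w\<^sup>2)) A =
    emeasure (density lborel (indicator {0::real..})) A"
    by (simp add: emeasure_distr emeasure_density eq)
qed simp

lemma nn_integral_square_substitution: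
  fixes F :: "real \<Rightarrow> ennreal"
  assumes [measurable]: "F \<in> borel_measurable borel"
  shows "(\<integral>\<^sup>+w. F (w\<^sup>2) * ennreal (2 * w) * indicator {0..} w \<partial>lborel) = (\<integral>\<^sup>+y. F y * indicator {0..} y \<partial>lborel)"
proof -
  have "(\<integral>\<^sup>+y. F y \<partial>distr (density lborel (\<lambda>w. ennreal (2 * w) * indicator {0..} w)) borel (\<lambda>w. w\<^sup>2)) =
     (\<integral>\<^sup>+y. F y \<partial>density lborel (indicator {0::real..}))"
    by (simp only: distr_square_lborel)
  then show ?thesis by (simp add: nn_integral_distr nn_integral_density mult_ac)
qed

text \<open>The Poisson weights with mean \<open>l\<close>.\<close>

definition pois :: "real \<Rightarrow> nat \<Rightarrow> real" where "pois l k = exp (- l) * l ^ k / fact k"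

lemma cosh_series: "(\<lambda>k. x ^ (2 * k) / fact (2 * k)) sums cosh (x::real)"
proof -
  have "(\<lambda>n. if even n then x ^ n /\<^sub>R fact n else 0) sums cosh x" by (rule cosh_converges)
  then have "(\<lambda>k. (if even (2 * k) then x ^ (2 * k) /\<^sub>R fact (2 * k) else 0)) sums cosh x"
    by (subst sums_mono_reindex[of "\<lambda>k. 2 * k"]) (auto simp: strict_mono_def elim!: evenE)
  then show ?thesis by (simp add: divide_inverse mult.commute)
qed

lemma fact_double_Gamma: "fact (2 * k) * sqrt pi = 4 ^ k * fact k * Gamma (1/2 + real k)"
proof (induction k)
  case (Suc k)
  have G: "Gamma (1/2 + real (Suc k)) = (1/2 + real k) * Gamma (1/2 + real k)"
    using Gamma_plus1[of "1/2 + real k"] by (auto simp: nonpos_Ints_def add_ac)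
  have "fact (2 * Suc k) * sqrt pi = (2 * real k + 2) * (2 * real k + 1) * (fact (2 * k) * sqrt pi)"
    by (simp add: algebra_simps)
  also have "\<dots> = 4 ^ Suc k * fact (Suc k) * Gamma (1/2 + real (Suc k))"
    unfolding Suc.IH G by (simp add: algebra_simps)
  finally show ?case .
qed (simp add: Gamma_one_half_real)

text \<open>The density of the square of a normal variable with mean \<open>m\<close> is a Poisson mixture of \<open>\<chi>\<^sup>2\<close> densities:
  the two roots combine to a hyperbolic cosine, whose series is matched by the duplication formula.\<close>

lemma noncentral_square_density:
  assumes w: "w > 0"
  shows "(\<Sum>k. ennreal (pois (m\<^sup>2 / 2) k * gam (1/2 + real k) (w\<^sup>2))) * ennreal (2 * w)
    = ennreal (std_normal_density (w - m) + std_normal_density (- w - m))"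
proof -
  have t: "pois (m\<^sup>2 / 2) k * gam (1/2 + real k) (w\<^sup>2) * (2 * w) =
      2 * exp (- (w\<^sup>2 + m\<^sup>2) / 2) / sqrt (2 * pi) * ((w * m) ^ (2 * k) / fact (2 * k))" for k
  proof -
    have wp: "(w\<^sup>2) powr (1/2 + real k - 1) * w = w ^ (2 * k)"
    proof -
      have "w\<^sup>2 = w powr 2" using w by simp
      then have "(w\<^sup>2) powr (1/2 + real k - 1) = w powr (2 * (1/2 + real k - 1))"
        by (simp only: powr_powr)
      also have "\<dots> * w = w powr (2 * (1/2 + real k - 1) + 1)"
        unfolding powr_add using w by (simp only: powr_one less_imp_le)
      also have "2 * (1/2 + real k - 1) + 1 = real (2 * k)" by simp
      finally show ?thesis using powr_realpow[OF w, of "2 * k"] by simp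
    qed
    have Gp: "Gamma (1/2 + real k) > 0" by (intro Gamma_real_pos) (auto intro: add_pos_nonneg)
    have Ge: "Gamma (1/2 + real k) = fact (2 * k) * sqrt pi / (4 ^ k * fact k)"
      using fact_double_Gamma[of k] by (simp add: field_simps)
    have "pois (m\<^sup>2 / 2) k * gam (1/2 + real k) (w\<^sup>2) * (2 * w)
      = 2 * (exp (- (m\<^sup>2 / 2)) * exp (- w\<^sup>2 / 2)) * (m\<^sup>2 / 2) ^ k / fact k * ((w\<^sup>2) powr (1/2 + real k - 1) * w) / (2 powr (1/2 + real k) * Gamma (1/2 + real k))"
      using w by (simp add: pois_def gam_def)
    also have "\<dots> = 2 * exp (- (w\<^sup>2 + m\<^sup>2) / 2) * (m\<^sup>2 / 2) ^ k / fact k * w ^ (2 * k) / (2 powr (1/2 + real k) * Gamma (1/2 + real k))"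
      unfolding wp by (simp add: mult_exp_exp add_divide_distrib add.commute)
    also have "2 powr (1/2 + real k) = sqrt 2 * 2 ^ k" by (simp add: powr_add powr_half_sqrt powr_realpow)
    also have "2 * exp (- (w\<^sup>2 + m\<^sup>2) / 2) * (m\<^sup>2 / 2) ^ k / fact k * w ^ (2 * k) / (sqrt 2 * 2 ^ k * Gamma (1/2 + real k))
       = 2 * exp (- (w\<^sup>2 + m\<^sup>2) / 2) / sqrt (2 * pi) * ((w * m) ^ (2 * k) / fact (2 * k))"
    proof -
      have four: "(4::real) ^ k = 2 ^ k * 2 ^ k" by (simp add: power_mult_distrib[symmetric])
      have gen: "2 * E * (M / P) / F * W / (r * P * (D * q / (P * P * F))) = 2 * E / (r * q) * (W * M / D)"
        if "P \<noteq> 0" "F \<noteq> 0" "D \<noteq> 0" "r \<noteq> 0" "q \<noteq> 0" for E M P F W r D q :: real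
      proof -
        have "2 * E * (M / P) / F * W / (r * P * (D * q / (P * P * F))) = (2 * E * M * W / (P * F)) / (r * D * q / (P * F))"
          using that by (simp only: times_divide_eq_right times_divide_eq_left divide_divide_eq_left divide_divide_eq_right mult_ac) (simp add: divide_simps)
        also have "\<dots> = 2 * E * M * W / (r * D * q)"
          using that by (simp only: divide_divide_eq_right divide_divide_eq_left times_divide_eq_left) simp
        also have "\<dots> = 2 * E / (r * q) * (W * M / D)"
          by (simp only: times_divide_eq_right times_divide_eq_left divide_divide_eq_left mult_ac)
        finally show ?thesis .
      qed
      have "(w * m) ^ (2 * k) = w ^ (2 * k) * (m\<^sup>2) ^ k"
        by (simp add: power_mult_distrib power_mult)
      then show ?thesis unfolding Ge four power_divide real_sqrt_mult
        using gen[of "2 ^ k" "fact k" "fact (2 * k)" "sqrt 2" "sqrt pi" "exp (- (w\<^sup>2 + m\<^sup>2) / 2)" "(m\<^sup>2) ^ k" "w ^ (2 * k)"]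
        by (simp only: power_eq_0_iff) simp
    qed
    finally show ?thesis .
  qed
  define E where "E = 2 * exp (- (w\<^sup>2 + m\<^sup>2) / 2) / sqrt (2 * pi)"
  have pg: "pois (m\<^sup>2 / 2) k * gam (1/2 + real k) (w\<^sup>2) \<ge> 0" for k
    by (intro mult_nonneg_nonneg gam_nonneg) (auto simp: pois_def intro: add_pos_nonneg)
  have "(\<lambda>k. pois (m\<^sup>2 / 2) k * gam (1/2 + real k) (w\<^sup>2) * (2 * w)) sums (E * cosh (w * m))"
    unfolding t E_def by (rule sums_mult[OF cosh_series])
  then have "(\<Sum>k. ennreal (pois (m\<^sup>2 / 2) k * gam (1/2 + real k) (w\<^sup>2) * (2 * w))) = ennreal (E * cosh (w * m))"
    using pg w by (intro suminf_ennreal_eq) auto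
  also have "E * cosh (w * m) = std_normal_density (w - m) + std_normal_density (- w - m)"
  proof -
    have e: "exp (- (w - m)\<^sup>2 / 2) = exp (- (w\<^sup>2 + m\<^sup>2) / 2) * exp (w * m)"
      "exp (- (- w - m)\<^sup>2 / 2) = exp (- (w\<^sup>2 + m\<^sup>2) / 2) * exp (- (w * m))"
      unfolding mult_exp_exp by (simp_all add: power2_eq_square field_simps)
    have "2 * A / r * ((B + D) / 2) = 1 / r * (A * B) + 1 / r * (A * D)" for A B D r :: real
      by (simp add: distrib_left add_divide_distrib)
    then show ?thesis unfolding E_def cosh_field_def std_normal_density_def e .
  qed
  also have "(\<Sum>k. ennreal (pois (m\<^sup>2 / 2) k * gam (1/2 + real k) (w\<^sup>2) * (2 * w))) =
     (\<Sum>k. ennreal (pois (m\<^sup>2 / 2) k * gam (1/2 + real k) (w\<^sup>2))) * ennreal (2 * w)"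
  proof -
    have "ennreal (pois (m\<^sup>2 / 2) k * gam (1/2 + real k) (w\<^sup>2) * (2 * w)) =
        ennreal (pois (m\<^sup>2 / 2) k * gam (1/2 + real k) (w\<^sup>2)) * ennreal (2 * w)" for k
      using pg[of k] w by (intro ennreal_mult) auto
    then show ?thesis by (simp only: ennreal_suminf_multc)
  qed
  finally show ?thesis .
qed

lemma noncentral_square:
  assumes [measurable]: "h \<in> borel_measurable borel"
  shows "(\<integral>\<^sup>+z. h ((z + m)\<^sup>2) \<partial>std_normal) =
    (\<Sum>k. ennreal (pois (m\<^sup>2 / 2) k) * (\<integral>\<^sup>+y. ennreal (gam (1/2 + real k) y) * h y \<partial>lborel))"
proof -
  let ?n = "\<lambda>w. ennreal (std_normal_density (w - m))"
  let ?G = "\<lambda>y. \<Sum>k. ennreal (pois (m\<^sup>2 / 2) k * gam (1/2 + real k) y)"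
  have pg: "pois (m\<^sup>2 / 2) k \<ge> 0" "gam (1/2 + real k) y \<ge> 0" for k y
    by (simp_all add: pois_def add_pos_nonneg)
  have "(\<integral>\<^sup>+z. h ((z + m)\<^sup>2) \<partial>std_normal) = (\<integral>\<^sup>+z. ennreal (std_normal_density z) * h ((z + m)\<^sup>2) \<partial>lborel)"
    unfolding std_normal_def by (simp add: nn_integral_density)
  also have "\<dots> = (\<integral>\<^sup>+w. ?n w * h (w\<^sup>2) \<partial>lborel)"
    using nn_integral_real_affine[of "\<lambda>w. ?n w * h (w\<^sup>2)" 1 m] by (simp add: add.commute)
  also have "\<dots> = (\<integral>\<^sup>+w. ?n w * h (w\<^sup>2) * indicator {0..} w + ?n w * h (w\<^sup>2) * indicator {..<0} w \<partial>lborel)"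
    by (intro nn_integral_cong) (auto simp: indicator_def)
  also have "\<dots> = (\<integral>\<^sup>+w. ?n w * h (w\<^sup>2) * indicator {0..} w \<partial>lborel) + (\<integral>\<^sup>+w. ?n w * h (w\<^sup>2) * indicator {..<0} w \<partial>lborel)"
    by (rule nn_integral_add) auto
  also have "(\<integral>\<^sup>+w. ?n w * h (w\<^sup>2) * indicator {..<0} w \<partial>lborel) = (\<integral>\<^sup>+w. ?n (- w) * h (w\<^sup>2) * indicator {0<..} w \<partial>lborel)"
    by (subst nn_integral_real_affine[where c = "-1" and t = 0]) (auto simp: indicator_def intro!: nn_integral_cong)
  also have "\<dots> = (\<integral>\<^sup>+w. ?n (- w) * h (w\<^sup>2) * indicator {0..} w \<partial>lborel)"
    by (intro nn_integral_cong_AE, use AE_lborel_singleton[of 0] in eventually_elim) (auto simp: indicator_def)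
  also have "(\<integral>\<^sup>+w. ?n w * h (w\<^sup>2) * indicator {0..} w \<partial>lborel) + \<dots> =
     (\<integral>\<^sup>+w. ?n w * h (w\<^sup>2) * indicator {0..} w + ?n (- w) * h (w\<^sup>2) * indicator {0..} w \<partial>lborel)"
    by (rule nn_integral_add[symmetric]) auto
  also have "\<dots> = (\<integral>\<^sup>+w. (?G (w\<^sup>2) * h (w\<^sup>2)) * ennreal (2 * w) * indicator {0..} w \<partial>lborel)"
  proof (intro nn_integral_cong_AE, use AE_lborel_singleton[of 0] in eventually_elim)
    fix w :: real assume "w \<noteq> 0"
    show "?n w * h (w\<^sup>2) * indicator {0..} w + ?n (- w) * h (w\<^sup>2) * indicator {0..} w
      = (?G (w\<^sup>2) * h (w\<^sup>2)) * ennreal (2 * w) * indicator {0..} w"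
    proof (cases "w > 0")
      case True
      have "?n w * h (w\<^sup>2) + ?n (- w) * h (w\<^sup>2) = ennreal (std_normal_density (w - m) + std_normal_density (- w - m)) * h (w\<^sup>2)"
        by (subst ennreal_plus) (simp_all add: distrib_right)
      also have "\<dots> = ?G (w\<^sup>2) * ennreal (2 * w) * h (w\<^sup>2)" by (simp only: noncentral_square_density[OF True])
      also have "\<dots> = ?G (w\<^sup>2) * h (w\<^sup>2) * ennreal (2 * w)" by (simp only: mult.assoc mult.commute mult.left_commute)
      finally show ?thesis using True by (simp only: indicator_simps atLeast_iff less_imp_le mult_1_right)
    next
      case False
      with \<open>w \<noteq> 0\<close> show ?thesis by (auto simp: indicator_def)
    qed
  qed
  also have "\<dots> = (\<integral>\<^sup>+y. (?G y * h y) * indicator {0..} y \<partial>lborel)"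
    by (rule nn_integral_square_substitution) measurable
  also have "\<dots> = (\<integral>\<^sup>+y. (\<Sum>k. ennreal (pois (m\<^sup>2 / 2) k) * (ennreal (gam (1/2 + real k) y) * h y)) \<partial>lborel)"
  proof (rule nn_integral_cong)
    fix y :: real
    have "?G y = 0" if "y < 0" using that by (simp add: gam_def)
    then have "?G y * h y * indicator {0..} y = ?G y * h y" by (cases "y < 0") (auto simp: indicator_def)
    also have "\<dots> = (\<Sum>k. ennreal (pois (m\<^sup>2 / 2) k) * (ennreal (gam (1/2 + real k) y) * h y))"
    proof -
      have "ennreal (pois (m\<^sup>2 / 2) k * gam (1/2 + real k) y) * h y =
          ennreal (pois (m\<^sup>2 / 2) k) * (ennreal (gam (1/2 + real k) y) * h y)" for k
        using pg[of k] by (simp only: ennreal_mult mult.assoc)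
      then show ?thesis by (simp only: ennreal_suminf_multc[symmetric])
    qed
    finally show "?G y * h y * indicator {0..} y = (\<Sum>k. ennreal (pois (m\<^sup>2 / 2) k) * (ennreal (gam (1/2 + real k) y) * h y))" .
  qed
  also have "\<dots> = (\<Sum>k. \<integral>\<^sup>+y. ennreal (pois (m\<^sup>2 / 2) k) * (ennreal (gam (1/2 + real k) y) * h y) \<partial>lborel)"
    by (rule nn_integral_suminf) measurable
  also have "\<dots> = (\<Sum>k. ennreal (pois (m\<^sup>2 / 2) k) * (\<integral>\<^sup>+y. ennreal (gam (1/2 + real k) y) * h y \<partial>lborel))"
    by (intro suminf_cong nn_integral_cmult) measurable
  finally show ?thesis .
qed

lemma central_square:
  assumes [measurable]: "h \<in> borel_measurable borel"
  shows "(\<integral>\<^sup>+z. h (z\<^sup>2) \<partial>std_normal) = (\<integral>\<^sup>+y. ennreal (gam (1/2) y) * h y \<partial>lborel)"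
proof -
  have "(\<integral>\<^sup>+z. h ((z + 0)\<^sup>2) \<partial>std_normal) = (\<Sum>k. ennreal (pois (0\<^sup>2 / 2) k) * (\<integral>\<^sup>+y. ennreal (gam (1/2 + real k) y) * h y \<partial>lborel))"
    by (rule noncentral_square) measurable
  also have "\<dots> = (\<Sum>k\<in>{0}. ennreal (pois (0\<^sup>2 / 2) k) * (\<integral>\<^sup>+y. ennreal (gam (1/2 + real k) y) * h y \<partial>lborel))"
    by (rule suminf_finite) (auto simp: pois_def)
  finally show ?thesis by (simp add: pois_def)
qed

lemma gam_add_square:
  assumes a: "a > 0" and [measurable]: "h \<in> borel_measurable borel"
  shows "(\<integral>\<^sup>+z. (\<integral>\<^sup>+y. ennreal (gam a y) * h (y + z\<^sup>2) \<partial>lborel) \<partial>std_normal) =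
    (\<integral>\<^sup>+y. ennreal (gam (a + 1/2) y) * h y \<partial>lborel)"
proof -
  have [measurable]: "(\<lambda>x. \<integral>\<^sup>+y. ennreal (gam a y) * h (y + x) \<partial>lborel) \<in> borel_measurable borel"
    by measurable
  show ?thesis
    by (subst central_square[where h = "\<lambda>x. \<integral>\<^sup>+y. ennreal (gam a y) * h (y + x) \<partial>lborel"])
      (simp_all add: gam_convolution a)
qed

text \<open>The negative binomial weights with real exponent \<open>a\<close> and odds \<open>l\<close>; they arise from Poisson weights
  whose parameter is \<open>l/2\<close> times a variable with density \<open>gam a\<close>.\<close>

definition nbin :: "real \<Rightarrow> real \<Rightarrow> nat \<Rightarrow> real" where
  "nbin a l k = Gamma (a + real k) / (Gamma a * fact k) * l ^ k * (1 + l) powr (- (a + real k))"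

lemma nbin_nonneg: "a > 0 \<Longrightarrow> l \<ge> 0 \<Longrightarrow> nbin a l k \<ge> 0"
  by (simp add: nbin_def Gamma_real_pos less_imp_le add_pos_nonneg)

lemma gam_pois_mixture:
  assumes a: "a > 0" and l: "l \<ge> 0"
  shows "(\<integral>\<^sup>+s. ennreal (gam a s) * ennreal (pois (l * s / 2) k) \<partial>lborel) = ennreal (nbin a l k)"
proof -
  define C where "C = l ^ k / (2 ^ k * fact k * 2 powr a * Gamma a)"
  define c where "c = (1 + l) / 2"
  have Ga: "Gamma a > 0" "Gamma (a + real k) > 0" using a by (auto intro!: Gamma_real_pos)
  have C: "C \<ge> 0" using Ga l by (simp add: C_def)
  have c: "c > 0" using l by (simp add: c_def)
  have "gam a s * pois (l * s / 2) k = C * (if s > 0 then s powr (a + real k - 1) * exp (- c * s) else 0)" for s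
  proof (cases "s > 0")
    case True
    have e: "exp (- c * s) = exp (- s / 2) * exp (- (l * s / 2))"
      by (simp add: mult_exp_exp c_def field_simps)
    have p: "s powr (a + real k - 1) = s powr (a - 1) * s ^ k"
      using True by (simp add: powr_realpow[symmetric] powr_add[symmetric] algebra_simps)
    show ?thesis unfolding gam_def pois_def C_def e p using True
      by (simp add: power_mult_distrib power_divide mult_ac)
  qed (simp add: gam_def)
  then have "(\<integral>\<^sup>+s. ennreal (gam a s) * ennreal (pois (l * s / 2) k) \<partial>lborel) =
     (\<integral>\<^sup>+s. ennreal C * ennreal (if s > 0 then s powr (a + real k - 1) * exp (- c * s) else 0) \<partial>lborel)"
    using C a by (simp only: ennreal_mult'[symmetric] gam_nonneg)
  also have "\<dots> = ennreal C * ennreal (Gamma (a + real k) / c powr (a + real k))"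
    using a c by (subst nn_integral_cmult) (auto simp: nn_integral_gamma_rate[simplified] add_pos_nonneg)
  also have "\<dots> = ennreal (C * (Gamma (a + real k) / c powr (a + real k)))"
    using C by (rule ennreal_mult'[symmetric])
  also have "C * (Gamma (a + real k) / c powr (a + real k)) = nbin a l k"
  proof -
    have "c powr (a + real k) = (1 + l) powr (a + real k) / (2 powr a * 2 ^ k)"
      using l by (simp add: c_def powr_divide powr_add powr_realpow)
    then show ?thesis using Ga l
      by (simp only: C_def nbin_def powr_minus_divide) (simp add: powr_realpow mult_ac)
  qed
  finally show ?thesis .
qed

lemma summable_hyp2F1:
  fixes a c x :: real
  assumes a: "a > 0" and c: "c > 0" and x: "0 \<le> x" "x < 1"
  shows "summable (\<lambda>k. Gamma (a + real k) * Gamma (a + real k) / Gamma (c + real k) * (x ^ k / fact k))"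
proof (cases "x = 0")
  case False
  define f where "f k = Gamma (a + real k) * Gamma (a + real k) / Gamma (c + real k) * (x ^ k / fact k)" for k
  have pos: "Gamma (a + real k) > 0" "Gamma (c + real k) > 0" for k
    using a c by (auto intro!: Gamma_real_pos add_pos_nonneg)
  have fpos: "f k > 0" for k using pos[of k] x False by (simp add: f_def)
  have step: "f (Suc k) = (a + real k)\<^sup>2 / ((c + real k) * (1 + real k)) * x * f k" for k
  proof -
    have "Gamma (a + real (Suc k)) = (a + real k) * Gamma (a + real k)"
      using Gamma_plus1[of "a + real k"] a by (auto simp: nonpos_Ints_def add_ac)
    moreover have "Gamma (c + real (Suc k)) = (c + real k) * Gamma (c + real k)"
      using Gamma_plus1[of "c + real k"] c by (auto simp: nonpos_Ints_def add_ac)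
    ultimately show ?thesis by (simp add: f_def power2_eq_square mult_ac)
  qed
  have lim: "(\<lambda>k. (a + real k)\<^sup>2 / ((c + real k) * (1 + real k)) * x) \<longlonglongrightarrow> x"
    by real_asymp
  obtain y where y: "x < y" "y < 1" using x dense by blast
  have "\<forall>\<^sub>F k in sequentially. (a + real k)\<^sup>2 / ((c + real k) * (1 + real k)) * x < y"
    using order_tendstoD(2)[OF lim y(1)] .
  then obtain N where N: "\<And>k. k \<ge> N \<Longrightarrow> (a + real k)\<^sup>2 / ((c + real k) * (1 + real k)) * x < y"
    by (auto simp: eventually_sequentially)
  have "summable f"
  proof (rule summable_ratio_test[OF y(2)])
    fix k assume "k \<ge> N"
    then have "f (Suc k) \<le> y * f k"
      unfolding step using N[of k] fpos[of k] by (intro mult_right_mono) auto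
    then show "norm (f (Suc k)) \<le> y * norm (f k)" using fpos[of k] fpos[of "Suc k"] by simp
  qed
  then show ?thesis unfolding f_def .
qed (auto intro!: summable_finite[of "{0}"])

section \<open>Quadratic forms in Gaussian coordinates\<close>

text \<open>Adding the squares of the coordinates in \<open>J\<close> raises the shape by \<open>card J / 2\<close>. The integrand may also
  depend on the remaining coordinates, so that the lemma applies to numerator and denominator of a
  ratio in turn.\<close>

lemma nn_integral_add_squares:
  fixes h :: "real \<Rightarrow> ('t::finite \<Rightarrow> real) \<Rightarrow> ennreal"
  assumes "a > 0"
    and h [measurable]: "case_prod h \<in> borel_measurable (borel \<Otimes>\<^sub>M PiM UNIV (\<lambda>_. std_normal))"
    and indep: "\<And>t y x z. t \<in> J \<Longrightarrow> h y (x(t := z)) = h y x"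
  shows "(\<integral>\<^sup>+x. (\<integral>\<^sup>+y. ennreal (gam a y) * h (y + (\<Sum>t\<in>J. (x t)\<^sup>2)) x \<partial>lborel) \<partial>PiM UNIV (\<lambda>_. std_normal))
     = (\<integral>\<^sup>+x. (\<integral>\<^sup>+y. ennreal (gam (a + real (card J) / 2) y) * h y x \<partial>lborel) \<partial>PiM UNIV (\<lambda>_. std_normal))"
proof -
  have "finite J" by simp
  then show ?thesis using \<open>a > 0\<close> indep
  proof (induction J arbitrary: a rule: finite_induct)
    case (insert t J)
    let ?Q = "PiM UNIV (\<lambda>_::'t. std_normal)"
    have "(\<integral>\<^sup>+x. (\<integral>\<^sup>+y. ennreal (gam a y) * h (y + (\<Sum>t\<in>insert t J. (x t)\<^sup>2)) x \<partial>lborel) \<partial>?Q) =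
      (\<integral>\<^sup>+x. (\<integral>\<^sup>+z. (\<integral>\<^sup>+y. ennreal (gam a y) * h (y + (\<Sum>s\<in>insert t J. ((x(t := z)) s)\<^sup>2)) (x(t := z)) \<partial>lborel) \<partial>std_normal) \<partial>?Q)"
      by (rule nn_integral_PiM_resample[OF prob_space_std_normal]) measurable
    also have "\<dots> = (\<integral>\<^sup>+x. (\<integral>\<^sup>+z. (\<integral>\<^sup>+y. ennreal (gam a y) * h (y + z\<^sup>2 + (\<Sum>s\<in>J. (x s)\<^sup>2)) x \<partial>lborel) \<partial>std_normal) \<partial>?Q)"
    proof (intro nn_integral_cong)
      fix x :: "'t \<Rightarrow> real" and z y :: real
      have "(\<Sum>s\<in>insert t J. ((x(t := z)) s)\<^sup>2) = z\<^sup>2 + (\<Sum>s\<in>J. (x s)\<^sup>2)"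
        using insert.hyps by (simp add: sum.insert) (intro sum.cong, auto)
      then show "ennreal (gam a y) * h (y + (\<Sum>s\<in>insert t J. ((x(t := z)) s)\<^sup>2)) (x(t := z)) =
         ennreal (gam a y) * h (y + z\<^sup>2 + (\<Sum>s\<in>J. (x s)\<^sup>2)) x"
        using insert.prems(2)[of t _ x z] by (simp only: insertI1 add.assoc)
    qed
    also have "\<dots> = (\<integral>\<^sup>+x. (\<integral>\<^sup>+y. ennreal (gam (a + 1/2) y) * h (y + (\<Sum>s\<in>J. (x s)\<^sup>2)) x \<partial>lborel) \<partial>?Q)"
    proof (rule nn_integral_cong)
      fix x :: "'t \<Rightarrow> real" assume [measurable]: "x \<in> space ?Q"
      have "(\<lambda>y. h (y + (\<Sum>s\<in>J. (x s)\<^sup>2)) x) \<in> borel_measurable borel" by measurable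
      from gam_add_square[OF insert.prems(1) this]
      show "(\<integral>\<^sup>+z. (\<integral>\<^sup>+y. ennreal (gam a y) * h (y + z\<^sup>2 + (\<Sum>s\<in>J. (x s)\<^sup>2)) x \<partial>lborel) \<partial>std_normal) =
        (\<integral>\<^sup>+y. ennreal (gam (a + 1/2) y) * h (y + (\<Sum>s\<in>J. (x s)\<^sup>2)) x \<partial>lborel)" .
    qed
    also have "\<dots> = (\<integral>\<^sup>+x. (\<integral>\<^sup>+y. ennreal (gam (a + 1/2 + real (card J) / 2) y) * h y x \<partial>lborel) \<partial>?Q)"
      using insert.prems by (intro insert.IH) auto
    also have "a + 1/2 + real (card J) / 2 = a + real (card (insert t J)) / 2"
      using insert.hyps by (simp add: add_divide_distrib)
    finally show ?case .
  qed simp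
qed

lemma nn_integral_sum_squares:
  fixes h :: "real \<Rightarrow> ('t::finite \<Rightarrow> real) \<Rightarrow> ennreal"
  assumes "J \<noteq> {}"
    and h [measurable]: "case_prod h \<in> borel_measurable (borel \<Otimes>\<^sub>M PiM UNIV (\<lambda>_. std_normal))"
    and indep: "\<And>t y x z. t \<in> J \<Longrightarrow> h y (x(t := z)) = h y x"
  shows "(\<integral>\<^sup>+x. h (\<Sum>t\<in>J. (x t)\<^sup>2) x \<partial>PiM UNIV (\<lambda>_. std_normal))
     = (\<integral>\<^sup>+x. (\<integral>\<^sup>+y. ennreal (gam (real (card J) / 2) y) * h y x \<partial>lborel) \<partial>PiM UNIV (\<lambda>_. std_normal))"
proof -
  let ?Q = "PiM UNIV (\<lambda>_::'t. std_normal)"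
  obtain t where t: "t \<in> J" using assms(1) by blast
  have "(\<integral>\<^sup>+x. h (\<Sum>t\<in>J. (x t)\<^sup>2) x \<partial>?Q) = (\<integral>\<^sup>+x. (\<integral>\<^sup>+z. h (\<Sum>s\<in>J. ((x(t := z)) s)\<^sup>2) (x(t := z)) \<partial>std_normal) \<partial>?Q)"
    by (rule nn_integral_PiM_resample[OF prob_space_std_normal]) measurable
  also have "\<dots> = (\<integral>\<^sup>+x. (\<integral>\<^sup>+z. h (z\<^sup>2 + (\<Sum>s\<in>J-{t}. (x s)\<^sup>2)) x \<partial>std_normal) \<partial>?Q)"
    using t indep by (intro nn_integral_cong) (simp add: sum.remove[of J t])
  also have "\<dots> = (\<integral>\<^sup>+x. (\<integral>\<^sup>+y. ennreal (gam (1/2) y) * h (y + (\<Sum>s\<in>J-{t}. (x s)\<^sup>2)) x \<partial>lborel) \<partial>?Q)"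
  proof (rule nn_integral_cong)
    fix x :: "'t \<Rightarrow> real" assume [measurable]: "x \<in> space ?Q"
    show "(\<integral>\<^sup>+z. h (z\<^sup>2 + (\<Sum>s\<in>J-{t}. (x s)\<^sup>2)) x \<partial>std_normal) =
      (\<integral>\<^sup>+y. ennreal (gam (1/2) y) * h (y + (\<Sum>s\<in>J-{t}. (x s)\<^sup>2)) x \<partial>lborel)"
      by (rule central_square[of "\<lambda>y. h (y + (\<Sum>s\<in>J-{t}. (x s)\<^sup>2)) x"]) measurable
  qed
  also have "\<dots> = (\<integral>\<^sup>+x. (\<integral>\<^sup>+y. ennreal (gam (1/2 + real (card (J - {t})) / 2) y) * h y x \<partial>lborel) \<partial>?Q)"
    by (rule nn_integral_add_squares) (use indep in \<open>auto simp del: fun_upd_apply\<close>)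
  also have "1/2 + real (card (J - {t})) / 2 = real (card J) / 2"
  proof -
    have "card J > 0" using t by (auto simp: card_gt_0_iff)
    then show ?thesis using t by (simp add: card_Diff_singleton of_nat_diff field_simps)
  qed
  finally show ?thesis .
qed

text \<open>A noncentral \<open>\<chi>\<^sup>2\<close> variable over an independent central one, all of the mean sitting in the
  coordinate \<open>t0\<close>.\<close>

lemma nn_integral_noncentral_ratio:
  fixes H :: "real \<Rightarrow> ennreal" and J1 J3 :: "'t::finite set"
  assumes [measurable]: "H \<in> borel_measurable borel"
    and t0: "t0 \<in> J1" and disj: "J1 \<inter> J3 = {}" and ne: "J3 \<noteq> {}"
  shows "(\<integral>\<^sup>+x. H ((\<Sum>t\<in>J1. (x t + (if t = t0 then m else 0))\<^sup>2) / (\<Sum>t\<in>J3. (x t)\<^sup>2)) \<partial>PiM UNIV (\<lambda>_. std_normal))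
    = (\<Sum>k. ennreal (pois (m\<^sup>2 / 2) k) *
        (\<integral>\<^sup>+r. ennreal (bprime (real (card J1) / 2 + real k) (real (card J3) / 2) r) * H r \<partial>lborel))"
proof -
  let ?Q = "PiM UNIV (\<lambda>_::'t. std_normal)"
  interpret Q: prob_space ?Q by (intro prob_space_PiM prob_space_std_normal)
  let ?b = "real (card J3) / 2"
  let ?S = "\<lambda>x. \<Sum>t\<in>J1-{t0}. (x t)\<^sup>2"
  have b: "?b > 0" using ne by (simp add: card_gt_0_iff)
  define D where "D w = (\<integral>\<^sup>+y. ennreal (gam ?b y) * H (w / y) \<partial>lborel)" for w
  have [measurable]: "D \<in> borel_measurable borel" unfolding D_def by measurable
  have N: "(\<Sum>t\<in>J1. (x t + (if t = t0 then m else 0))\<^sup>2) = (x t0 + m)\<^sup>2 + ?S x" for x :: "'t \<Rightarrow> real"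
    using t0 by (simp add: sum.remove[of J1 t0])
  have "(\<integral>\<^sup>+x. H ((\<Sum>t\<in>J1. (x t + (if t = t0 then m else 0))\<^sup>2) / (\<Sum>t\<in>J3. (x t)\<^sup>2)) \<partial>?Q) =
    (\<integral>\<^sup>+x. (\<lambda>s x. H (((x t0 + m)\<^sup>2 + ?S x) / s)) (\<Sum>t\<in>J3. (x t)\<^sup>2) x \<partial>?Q)"
    by (simp only: N)
  also have "\<dots> = (\<integral>\<^sup>+x. D ((x t0 + m)\<^sup>2 + ?S x) \<partial>?Q)"
    unfolding D_def
  proof (rule nn_integral_sum_squares[OF ne])
    fix t y x and z :: real assume "t \<in> J3"
    then have "t \<noteq> t0" "t \<notin> J1" using t0 disj by auto
    then have "?S (x(t := z)) = ?S x" by (intro sum.cong) auto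
    then show "H ((((x(t := z)) t0 + m)\<^sup>2 + ?S (x(t := z))) / y) = H (((x t0 + m)\<^sup>2 + ?S x) / y)"
      using \<open>t \<noteq> t0\<close> by simp
  qed measurable
  also have "\<dots> = (\<integral>\<^sup>+x. (\<integral>\<^sup>+z. D ((z + m)\<^sup>2 + ?S x) \<partial>std_normal) \<partial>?Q)"
    by (subst nn_integral_PiM_resample[OF prob_space_std_normal, where i = t0]) (auto intro!: nn_integral_cong)
  also have "\<dots> = (\<integral>\<^sup>+x. (\<Sum>k. ennreal (pois (m\<^sup>2 / 2) k) * (\<integral>\<^sup>+y. ennreal (gam (1/2 + real k) y) * D (y + ?S x) \<partial>lborel)) \<partial>?Q)"
    by (intro nn_integral_cong noncentral_square) measurable
  also have "\<dots> = (\<Sum>k. ennreal (pois (m\<^sup>2 / 2) k) * (\<integral>\<^sup>+x. (\<integral>\<^sup>+y. ennreal (gam (1/2 + real k) y) * D (y + ?S x) \<partial>lborel) \<partial>?Q))"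
    by (subst nn_integral_suminf, measurable) (intro suminf_cong nn_integral_cmult, measurable)
  also have "\<dots> = (\<Sum>k. ennreal (pois (m\<^sup>2 / 2) k) *
        (\<integral>\<^sup>+r. ennreal (bprime (real (card J1) / 2 + real k) ?b r) * H r \<partial>lborel))"
  proof (rule suminf_cong)
    fix k
    let ?a = "real (card J1) / 2 + real k"
    have "card J1 > 0" using t0 by (auto simp: card_gt_0_iff)
    then have a: "?a > 0" "1/2 + real k + real (card (J1 - {t0})) / 2 = ?a"
      using t0 by (auto simp: card_Diff_singleton of_nat_diff field_simps)
    have "(\<integral>\<^sup>+x. (\<integral>\<^sup>+y. ennreal (gam (1/2 + real k) y) * D (y + ?S x) \<partial>lborel) \<partial>?Q) =
       (\<integral>\<^sup>+x. (\<integral>\<^sup>+y. ennreal (gam ?a y) * D y \<partial>lborel) \<partial>?Q)"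
      unfolding a(2)[symmetric] by (rule nn_integral_add_squares[where h = "\<lambda>y x. D y"]) (auto intro: add_pos_nonneg)
    also have "\<dots> = (\<integral>\<^sup>+y. ennreal (gam ?a y) * D y \<partial>lborel)"
      by (simp add: Q.emeasure_space_1)
    also have "\<dots> = (\<integral>\<^sup>+y. (\<integral>\<^sup>+x. ennreal (gam ?b x) * (ennreal (gam ?a y) * H (y / x)) \<partial>lborel) \<partial>lborel)"
      unfolding D_def by (intro nn_integral_cong, subst nn_integral_cmult[symmetric]) (auto simp: mult_ac)
    also have "\<dots> = (\<integral>\<^sup>+x. (\<integral>\<^sup>+y. ennreal (gam ?b x) * (ennreal (gam ?a y) * H (y / x)) \<partial>lborel) \<partial>lborel)"
      by (rule lborel_pair.Fubini') measurable
    also have "\<dots> = (\<integral>\<^sup>+x. ennreal (gam ?b x) * (\<integral>\<^sup>+y. ennreal (gam ?a y) * H (y / x) \<partial>lborel) \<partial>lborel)"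
      by (intro nn_integral_cong nn_integral_cmult) measurable
    also have "\<dots> = (\<integral>\<^sup>+r. ennreal (bprime ?a ?b r) * H r \<partial>lborel)"
      by (rule gam_ratio[OF a(1) b]) measurable
    finally show "ennreal (pois (m\<^sup>2 / 2) k) * (\<integral>\<^sup>+x. (\<integral>\<^sup>+y. ennreal (gam (1/2 + real k) y) * D (y + ?S x) \<partial>lborel) \<partial>?Q) =
       ennreal (pois (m\<^sup>2 / 2) k) * (\<integral>\<^sup>+r. ennreal (bprime ?a ?b r) * H r \<partial>lborel)" by simp
  qed
  finally show ?thesis .
qed

text \<open>Orthonormal bases of \<open>\<real>\<^sup>T\<close> indexed by the coordinates.\<close>

definition onb :: "('t::finite \<Rightarrow> real^'t) \<Rightarrow> bool" where
  "onb b \<longleftrightarrow> (\<forall>s t. b s \<bullet> b t = (if s = t then 1 else 0))"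

lemma nn_integral_gauss_onb:
  assumes b: "onb b" and [measurable]: "F \<in> borel_measurable (PiM UNIV (\<lambda>_::'t::finite. std_normal))"
  shows "(\<integral>\<^sup>+x. F (\<lambda>t. b t \<bullet> x) \<partial>gauss) = (\<integral>\<^sup>+x. F x \<partial>PiM UNIV (\<lambda>_. std_normal))"
proof -
  define L :: "real^'t^'t" where "L = (\<chi> t. b t)"
  have L: "L *v x = (\<chi> t. b t \<bullet> x)" for x by (simp add: L_def matrix_vector_mult_def inner_vec_def)
  have "L ** transpose L = mat 1"
    using b by (simp add: vec_eq_iff matrix_matrix_mult_def transpose_def mat_def L_def onb_def inner_vec_def)
  then have orth: "orthogonal_matrix L"
    by (simp add: orthogonal_matrix_def matrix_left_right_inverse)
  note [measurable] = borel_measurable_matrix_vector_mult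
  have m [measurable]: "(\<lambda>x t. x $ t) \<in> measurable (borel :: (real^'t) measure) (PiM UNIV (\<lambda>_. std_normal))"
    by (rule measurable_PiM_single') auto
  have "(\<integral>\<^sup>+x. F (\<lambda>t. b t \<bullet> x) \<partial>gauss) = (\<integral>\<^sup>+x. F (\<lambda>t. (L *v x) $ t) \<partial>gauss)" by (simp add: L)
  also have "\<dots> = (\<integral>\<^sup>+x. F (\<lambda>t. x $ t) \<partial>distr gauss borel (\<lambda>x. L *v x))"
    by (subst nn_integral_distr) auto
  also have "\<dots> = (\<integral>\<^sup>+x. F (\<lambda>t. x $ t) \<partial>gauss)" by (simp only: distr_gauss_orthogonal[OF orth])
  also have "\<dots> = (\<integral>\<^sup>+x. F x \<partial>PiM UNIV (\<lambda>_. std_normal))"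
  proof -
    have "($) (vec_lambda x) = x" for x :: "'t \<Rightarrow> real" by (simp add: fun_eq_iff)
    then show ?thesis unfolding gauss_def by (subst nn_integral_distr) simp_all
  qed
  finally show ?thesis .
qed

section \<open>Residuals of orthogonal projections\<close>

text \<open>The residual of \<open>x\<close> after orthogonal projection to \<open>S\<close>; meaningful for subspaces \<open>S\<close> only, where it
  exists and is unique.\<close>

definition resid :: "'a::euclidean_space set \<Rightarrow> 'a \<Rightarrow> 'a" where
  "resid S x = (THE r. x - r \<in> S \<and> (\<forall>s\<in>S. s \<bullet> r = 0))"

lemma resid_eqI:
  assumes S: "subspace S" and r: "x - r \<in> S" "\<And>s. s \<in> S \<Longrightarrow> s \<bullet> r = 0"
  shows "resid S x = r"
  unfolding resid_def
proof (rule the_equality)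
  fix r' assume r': "x - r' \<in> S \<and> (\<forall>s\<in>S. s \<bullet> r' = 0)"
  have "r' - r = (x - r) - (x - r')" by simp
  then have "r' - r \<in> S" using r r' S by (metis subspace_diff)
  then have "(r' - r) \<bullet> (r' - r) = 0" using r r' by (metis diff_self inner_diff_right)
  then show "r' = r" by simp
qed (use r in auto)

lemma
  assumes S: "subspace S"
  shows diff_resid_in: "x - resid S x \<in> S"
    and resid_orthogonal: "s \<in> S \<Longrightarrow> s \<bullet> resid S x = 0"
proof -
  obtain y z where yz: "y \<in> span S" "\<And>w. w \<in> span S \<Longrightarrow> orthogonal z w" "x = y + z"
    using orthogonal_subspace_decomp_exists[of S x] by metis
  moreover have "span S = S" using S by (simp add: span_eq_iff)
  ultimately have "resid S x = z"
    by (intro resid_eqI[OF S]) (auto simp: orthogonal_def inner_commute)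
  with yz \<open>span S = S\<close> show "x - resid S x \<in> S" "s \<in> S \<Longrightarrow> s \<bullet> resid S x = 0"
    by (auto simp: orthogonal_def inner_commute)
qed

lemma resid_add_left: "subspace S \<Longrightarrow> s \<in> S \<Longrightarrow> resid S (s + x) = resid S x"
  by (rule resid_eqI) (auto simp: add_diff_eq[symmetric] diff_resid_in resid_orthogonal intro: subspace_add)

lemma resid_scaleR: "subspace S \<Longrightarrow> resid S (c *\<^sub>R x) = c *\<^sub>R resid S x"
  by (rule resid_eqI)
    (auto simp: scaleR_diff_right[symmetric] resid_orthogonal intro!: subspace_scale diff_resid_in)

lemma resid_eq_0: "subspace S \<Longrightarrow> x \<in> S \<Longrightarrow> resid S x = 0"
  by (rule resid_eqI) auto

lemma resid_eq_0_iff: "subspace S \<Longrightarrow> resid S x = 0 \<longleftrightarrow> x \<in> S"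
  using diff_resid_in[of S x] resid_eq_0 by fastforce

text \<open>Orthonormal sets of vectors.\<close>

definition orthonormal :: "'a::euclidean_space set \<Rightarrow> bool" where
  "orthonormal B \<longleftrightarrow> pairwise orthogonal B \<and> (\<forall>x\<in>B. norm x = 1)"

lemma orthonormal_independent: "orthonormal B \<Longrightarrow> independent B"
  unfolding orthonormal_def by (intro pairwise_orthogonal_independent) auto

lemma orthonormal_extend:
  fixes B T :: "'a::euclidean_space set"
  assumes B: "orthonormal B" and T: "subspace T" and BT: "B \<subseteq> T"
  obtains C where "orthonormal C" "B \<subseteq> C" "span C = T"
proof -
  define N where "N = {y \<in> T. \<forall>x\<in>span B. orthogonal x y}"
  have "N = T \<inter> (\<Inter>x\<in>span B. {y. orthogonal x y})" by (auto simp: N_def)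
  then have N: "subspace N"
    using T by (auto intro!: subspace_inter subspace_Inter subspace_orthogonal_to_vector)
  have sT: "span B \<subseteq> T" using BT T by (rule span_minimal)
  have dim: "dim N + dim (span B) = dim T"
    unfolding N_def by (rule dim_subspace_orthogonal_to_vectors) (use T sT in auto)
  obtain B' where B': "B' \<subseteq> N" "pairwise orthogonal B'" "\<And>x. x \<in> B' \<Longrightarrow> norm x = 1"
    "independent B'" "card B' = dim N" "span B' = N"
    using orthonormal_basis_subspace[OF N] by metis
  have cross: "orthogonal x y" if "x \<in> B" "y \<in> B'" for x y
    using that B'(1) unfolding N_def by (auto intro: span_base)
  have on: "orthonormal (B \<union> B')"
    using B B' cross unfolding orthonormal_def pairwise_def by (auto intro: orthogonal_commute[THEN iffD1])
  have disj: "B \<inter> B' = {}"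
  proof (rule ccontr)
    assume "B \<inter> B' \<noteq> {}"
    then obtain x where "x \<in> B" "x \<in> B'" by auto
    with cross[of x x] B'(3)[of x] show False by (auto simp: orthogonal_self)
  qed
  have fin: "finite B" "finite B'"
    using orthonormal_independent[OF B] B'(4) independent_imp_finite by auto
  have "dim (span (B \<union> B')) = card (B \<union> B')"
    using orthonormal_independent[OF on] by (simp add: dim_eq_card_independent)
  also have "\<dots> = dim (span B) + dim N"
    using disj fin B'(5) orthonormal_independent[OF B] by (simp add: card_Un_disjoint dim_eq_card_independent)
  finally have "dim T \<le> dim (span (B \<union> B'))" using dim by simp
  moreover have "span (B \<union> B') \<subseteq> T"
    using BT B'(1) T by (intro span_minimal) (auto simp: N_def)
  ultimately have "span (B \<union> B') = T" using T by (intro subspace_dim_equal) auto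
  with on show ?thesis using that by blast
qed

text \<open>A basis of \<open>\<real>\<^sup>T\<close> starting with a basis of \<open>G\<close> and continuing with one of \<open>H\<close>, in which the part of \<open>v\<close>
  orthogonal to \<open>G\<close> lies on a single axis \<open>t0\<close>.\<close>

lemma adapted_onb:
  fixes G H :: "(real^'t) set"
  assumes G: "subspace G" and H: "subspace H" and GH: "G \<subseteq> H" and dim: "dim G < dim H" and v: "v \<in> H"
  obtains b JG J1 t0 m where "onb b" "span (b ` JG) = G" "span (b ` (JG \<union> J1)) = H" "JG \<inter> J1 = {}"
    "card JG = dim G" "card J1 = dim H - dim G" "t0 \<in> J1"
    "\<And>t. t \<in> J1 \<Longrightarrow> b t \<bullet> v = (if t = t0 then m else 0)"
proof -
  obtain B0 where B0': "B0 \<subseteq> G" "pairwise orthogonal B0" "\<And>x. x \<in> B0 \<Longrightarrow> norm x = 1"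
    "independent B0" "card B0 = dim G" "span B0 = G"
    using orthonormal_basis_subspace[OF G] by metis
  have B0: "orthonormal B0" using B0' by (auto simp: orthonormal_def)
  obtain e m where e: "e \<in> H" "norm e = 1" "\<And>s. s \<in> G \<Longrightarrow> s \<bullet> e = 0" and me: "resid G v = m *\<^sub>R e"
  proof -
    have inH: "resid G x \<in> H" if "x \<in> H" for x
      using diff_resid_in[OF G, of x] GH H that subspace_diff[of H x "x - resid G x"] by auto
    obtain x where x: "x \<in> H" "resid G x \<noteq> 0" "resid G v \<noteq> 0 \<longrightarrow> x = v"
    proof (cases "resid G v = 0")
      case True
      have "\<exists>x\<in>H. x \<notin> G" using dim by (metis dim_subset leD subsetI)
      then obtain x where "x \<in> H" "x \<notin> G" by blast
      then show ?thesis using that True resid_eq_0_iff[OF G] by blast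
    qed (use v that in blast)
    let ?e = "resid G x /\<^sub>R norm (resid G x)"
    show ?thesis
    proof (rule that[of ?e "if resid G v = 0 then 0 else norm (resid G v)"])
      show "?e \<in> H" using inH[OF x(1)] H by (simp add: subspace_scale)
      show "norm ?e = 1" using x(2) by simp
      show "\<And>s. s \<in> G \<Longrightarrow> s \<bullet> ?e = 0" using resid_orthogonal[OF G] by simp
      show "resid G v = (if resid G v = 0 then 0 else norm (resid G v)) *\<^sub>R ?e" using x(3) by auto
    qed
  qed
  have eB0: "e \<notin> B0" using e B0'(1) by force
  have on1: "orthonormal (insert e B0)"
    using B0 e B0'(1) unfolding orthonormal_def pairwise_insert by (auto simp: orthogonal_def inner_commute)
  obtain B1 where B1: "orthonormal B1" "insert e B0 \<subseteq> B1" "span B1 = H"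
    using orthonormal_extend[OF on1 H] e(1) B0'(1) GH by blast
  obtain B2 where B2: "orthonormal B2" "B1 \<subseteq> B2" "span B2 = UNIV"
    using orthonormal_extend[OF B1(1) subspace_UNIV] by blast
  have fin: "finite B2" using orthonormal_independent[OF B2(1)] independent_imp_finite by auto
  have "card B2 = CARD('t)"
    using orthonormal_independent[OF B2(1)] B2(3) dim_eq_card_independent[of B2] dim_span[of B2] by simp
  then obtain b :: "'t \<Rightarrow> real^'t" where b: "bij_betw b UNIV B2"
    using finite_same_card_bij[of "UNIV :: 't set" B2] fin by auto
  have inj: "inj b" and rng: "range b = B2" using b by (auto simp: bij_betw_def)
  define JG where "JG = b -` B0"
  define J1 where "J1 = b -` (B1 - B0)"
  have im: "b ` (b -` C) = C" if "C \<subseteq> B2" for C using that rng by (simp add: image_vimage_eq Int_absorb2)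
  have cardv: "card (b -` C) = card C" if "C \<subseteq> B2" for C
    using im[OF that] inj card_image[of b "b -` C"] by (metis inj_on_subset subset_UNIV)
  have B01: "B0 \<subseteq> B1" "e \<in> B1" using B1(2) by auto
  obtain t0 where t0: "b t0 = e" using B01 B2(2) rng by (metis imageE subsetD)
  show ?thesis
  proof (rule that[of b JG J1 t0 m])
    show "onb b" unfolding onb_def
    proof (intro allI)
      fix s t
      have "b s \<in> B2" "b t \<in> B2" using rng by auto
      then show "b s \<bullet> b t = (if s = t then 1 else 0)"
        using B2(1) inj_eq[OF inj, of s t] unfolding orthonormal_def pairwise_def orthogonal_def
        by (cases "s = t") (simp_all add: dot_square_norm)
    qed
    show "span (b ` JG) = G" using im[of B0] B0' B01 B2 by (auto simp: JG_def)
    have "JG \<union> J1 = b -` B1" using B01 by (auto simp: JG_def J1_def)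
    then show "span (b ` (JG \<union> J1)) = H" using im[of B1] B1 B2 by simp
    show "JG \<inter> J1 = {}" by (auto simp: JG_def J1_def)
    show "card JG = dim G" using cardv[of B0] B01 B2 B0' by (auto simp: JG_def)
    have "card B1 = dim H"
      using orthonormal_independent[OF B1(1)] B1(3) dim_eq_card_independent[of B1] dim_span[of B1] by simp
    moreover have "card (B1 - B0) = card B1 - card B0"
      using B01 B2(2) fin by (meson card_Diff_subset finite_subset)
    ultimately show "card J1 = dim H - dim G" using cardv[of "B1 - B0"] B2 B0'(5) by (auto simp: J1_def)
    show "t0 \<in> J1" using t0 B01 eB0 by (auto simp: J1_def)
    show "b t \<bullet> v = (if t = t0 then m else 0)" if "t \<in> J1" for t
    proof -
      have bt: "b t \<in> B1" "b t \<notin> B0" using that by (auto simp: J1_def)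
      have "b t \<bullet> g = 0" if "g \<in> G" for g
      proof -
        have "orthogonal (b t) g"
        proof (rule orthogonal_to_span[of _ B0])
          show "g \<in> span B0" using that B0'(6) by simp
          show "orthogonal (b t) y" if "y \<in> B0" for y
          proof -
            have "b t \<noteq> y" "y \<in> B1" using bt(2) that B01(1) by auto
            then show ?thesis using B1(1) bt(1) by (auto simp: orthonormal_def dest: pairwiseD)
          qed
        qed
        then show ?thesis by (simp add: orthogonal_def)
      qed
      then have "b t \<bullet> (v - resid G v) = 0" using diff_resid_in[OF G] by blast
      then have "b t \<bullet> v = m * (b t \<bullet> e)" by (simp add: inner_diff_right me)
      moreover have "b t \<bullet> e = (if t = t0 then 1 else 0)"
      proof (cases "t = t0")
        case True
        then show ?thesis using t0 e(2) by (simp add: dot_square_norm)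
      next
        case False
        then have "b t \<noteq> e" using t0 inj by (auto simp: inj_eq)
        then show ?thesis using bt B01(2) B1(1) False
          unfolding orthonormal_def pairwise_def orthogonal_def by simp
      qed
      ultimately show ?thesis by simp
    qed
  qed
qed

lemma onb_expansion:
  assumes "onb (b :: 't::finite \<Rightarrow> real^'t)"
  shows "x = (\<Sum>t\<in>UNIV. (b t \<bullet> x) *\<^sub>R b t)"
proof -
  define L :: "real^'t^'t" where "L = (\<chi> t. b t)"
  have L: "L *v x = (\<chi> t. b t \<bullet> x)" for x by (simp add: L_def matrix_vector_mult_def inner_vec_def)
  have "L ** transpose L = mat 1"
    using assms by (simp add: vec_eq_iff matrix_matrix_mult_def transpose_def mat_def L_def onb_def inner_vec_def)
  then have "transpose L ** L = mat 1" by (simp add: matrix_left_right_inverse)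
  then have "x = transpose L *v (L *v x)" by (simp add: matrix_vector_mul_assoc)
  also have "\<dots> = (\<Sum>t\<in>UNIV. (b t \<bullet> x) *\<^sub>R b t)"
    unfolding L by (simp add: vec_eq_iff matrix_vector_mult_def transpose_def L_def mult.commute)
  finally show ?thesis .
qed

lemma resid_onb:
  assumes b: "onb (b :: 't::finite \<Rightarrow> real^'t)"
  shows "resid (span (b ` J)) x = (\<Sum>t\<in>-J. (b t \<bullet> x) *\<^sub>R b t)"
proof (rule resid_eqI)
  have "x = (\<Sum>t\<in>J. (b t \<bullet> x) *\<^sub>R b t) + (\<Sum>t\<in>-J. (b t \<bullet> x) *\<^sub>R b t)"
    by (subst onb_expansion[OF b, of x]) (simp add: sum.union_disjoint[symmetric])
  then have "x - (\<Sum>t\<in>-J. (b t \<bullet> x) *\<^sub>R b t) = (\<Sum>t\<in>J. (b t \<bullet> x) *\<^sub>R b t)" by (simp add: diff_eq_eq)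
  then show "x - (\<Sum>t\<in>-J. (b t \<bullet> x) *\<^sub>R b t) \<in> span (b ` J)"
    by (auto intro!: span_sum span_scale intro: span_base)
  fix s assume "s \<in> span (b ` J)"
  then have "orthogonal (\<Sum>t\<in>-J. (b t \<bullet> x) *\<^sub>R b t) s"
    by (rule orthogonal_to_span)
      (use b in \<open>auto simp: orthogonal_def inner_sum_left onb_def intro!: sum.neutral\<close>)
  then show "s \<bullet> (\<Sum>t\<in>-J. (b t \<bullet> x) *\<^sub>R b t) = 0" by (simp add: orthogonal_def inner_commute)
qed simp

lemma norm_resid_onb:
  assumes b: "onb (b :: 't::finite \<Rightarrow> real^'t)"
  shows "(norm (resid (span (b ` J)) x))\<^sup>2 = (\<Sum>t\<in>-J. (b t \<bullet> x)\<^sup>2)"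
proof -
  have "(norm (resid (span (b ` J)) x))\<^sup>2 = (\<Sum>t\<in>-J. \<Sum>s\<in>-J. (b t \<bullet> x) * (b s \<bullet> x) * (b t \<bullet> b s))"
    unfolding resid_onb[OF b] power2_norm_eq_inner
    by (simp add: inner_sum_left inner_sum_right sum_distrib_left mult_ac inner_commute)
  also have "\<dots> = (\<Sum>t\<in>-J. \<Sum>s\<in>-J. if t = s then (b t \<bullet> x) * (b s \<bullet> x) else 0)"
    using b by (intro sum.cong) (auto simp: onb_def)
  also have "\<dots> = (\<Sum>t\<in>-J. (b t \<bullet> x)\<^sup>2)" by (simp add: power2_eq_square)
  finally show ?thesis .
qed

section \<open>Residuals of Gaussian vectors\<close>

lemma nn_integral_gauss_resid:
  fixes G :: "(real^'t) set"
  assumes G: "subspace G" and dim: "dim G < CARD('t)" and [measurable]: "h \<in> borel_measurable borel"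
  shows "(\<integral>\<^sup>+x. h ((norm (resid G x))\<^sup>2) \<partial>gauss) =
    (\<integral>\<^sup>+s. ennreal (gam (real (CARD('t) - dim G) / 2) s) * h s \<partial>lborel)"
proof -
  interpret Q: prob_space "PiM UNIV (\<lambda>_::'t. std_normal)" by (intro prob_space_PiM prob_space_std_normal)
  obtain b :: "'t \<Rightarrow> real^'t" and JG J1 t0 m where b: "onb b" "span (b ` JG) = G" "card JG = dim G"
    by (rule adapted_onb[OF G subspace_UNIV, of 0]) (use dim in auto)
  have c: "card (- JG) = CARD('t) - dim G" using b(3) by (simp add: Compl_eq_Diff_UNIV card_Diff_subset)
  then have ne: "- JG \<noteq> {}" using dim by auto
  have "(\<integral>\<^sup>+x. h ((norm (resid G x))\<^sup>2) \<partial>gauss) = (\<integral>\<^sup>+x. (\<lambda>y. h (\<Sum>t\<in>-JG. (y t)\<^sup>2)) (\<lambda>t. b t \<bullet> x) \<partial>gauss)"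
    unfolding b(2)[symmetric] norm_resid_onb[OF b(1)] ..
  also have "\<dots> = (\<integral>\<^sup>+x. h (\<Sum>t\<in>-JG. (x t)\<^sup>2) \<partial>PiM UNIV (\<lambda>_. std_normal))"
    by (rule nn_integral_gauss_onb[OF b(1)]) measurable
  also have "\<dots> = (\<integral>\<^sup>+x. (\<integral>\<^sup>+s. ennreal (gam (real (card (- JG)) / 2) s) * h s \<partial>lborel) \<partial>PiM UNIV (\<lambda>_::'t. std_normal))"
    by (rule nn_integral_sum_squares[OF ne, where h = "\<lambda>y x. h y"]) auto
  also have "\<dots> = (\<integral>\<^sup>+s. ennreal (gam (real (CARD('t) - dim G) / 2) s) * h s \<partial>lborel)"
    by (simp add: Q.emeasure_space_1 c)
  finally show ?thesis .
qed

text \<open>Conditional on everything but \<open>x\<close>, the statistic is the left-hand ratio: the residual on \<open>G\<close> splits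
  into the residual on \<open>H\<close>, which does not see the shift \<open>v\<close>, and a noncentral part inside \<open>H\<close>.\<close>

lemma nn_integral_gauss_ratio:
  fixes G H :: "(real^'t) set"
  assumes G: "subspace G" and H: "subspace H" and GH: "G \<subseteq> H" and dim: "dim G < dim H" "dim H < CARD('t)"
    and v: "v \<in> H" and [measurable]: "h \<in> borel_measurable borel"
  shows "(\<integral>\<^sup>+x. h ((norm (resid G (x + v)))\<^sup>2 / (norm (resid H x))\<^sup>2 - 1) \<partial>gauss) =
    (\<Sum>k. ennreal (pois ((norm (resid G v))\<^sup>2 / 2) k) *
      (\<integral>\<^sup>+r. ennreal (bprime (real (dim H - dim G) / 2 + real k) (real (CARD('t) - dim H) / 2) r) * h r \<partial>lborel))"
proof -
  obtain b :: "'t \<Rightarrow> real^'t" and JG J1 t0 m where b: "onb b" "span (b ` JG) = G" "span (b ` (JG \<union> J1)) = H" "JG \<inter> J1 = {}"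
    "card JG = dim G" "card J1 = dim H - dim G" "t0 \<in> J1"
    "\<And>t. t \<in> J1 \<Longrightarrow> b t \<bullet> v = (if t = t0 then m else 0)"
    by (rule adapted_onb[OF G H GH dim(1) v]) (rule that)
  define J3 where "J3 = - (JG \<union> J1)"
  have card13: "card (JG \<union> J1) = dim H" using b dim by (simp add: card_Un_disjoint)
  then have c3: "card J3 = CARD('t) - dim H" by (simp add: J3_def Compl_eq_Diff_UNIV card_Diff_subset)
  then have ne: "J3 \<noteq> {}" using dim by auto
  have disj: "J1 \<inter> J3 = {}" by (auto simp: J3_def)
  have mJG: "- JG = J1 \<union> J3" using b(4) by (auto simp: J3_def)
  have bH0: "b t \<bullet> v = 0" if "t \<in> J3" for t
  proof -
    have "orthogonal (b t) v"
      using v unfolding b(3)[symmetric]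
      by (rule orthogonal_to_span) (use b(1) that in \<open>auto simp: orthogonal_def onb_def J3_def\<close>)
    then show ?thesis by (simp add: orthogonal_def)
  qed
  have rH: "(norm (resid H x))\<^sup>2 = (\<Sum>t\<in>J3. (b t \<bullet> x)\<^sup>2)" for x
    unfolding b(3)[symmetric] norm_resid_onb[OF b(1)] J3_def ..
  have rG: "(norm (resid G (x + v)))\<^sup>2 = (\<Sum>t\<in>J1. (b t \<bullet> x + (if t = t0 then m else 0))\<^sup>2) + (\<Sum>t\<in>J3. (b t \<bullet> x)\<^sup>2)" for x
    unfolding b(2)[symmetric] norm_resid_onb[OF b(1)] mJG
    by (subst sum.union_disjoint) (use disj b(8) bH0 in \<open>auto simp: inner_add_right intro!: sum.cong\<close>)
  have m: "(norm (resid G v))\<^sup>2 = m\<^sup>2"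
  proof -
    have "(norm (resid G v))\<^sup>2 = (\<Sum>t\<in>J1. (b t \<bullet> v)\<^sup>2) + (\<Sum>t\<in>J3. (b t \<bullet> v)\<^sup>2)"
      unfolding b(2)[symmetric] norm_resid_onb[OF b(1)] mJG
      by (subst sum.union_disjoint) (use disj in auto)
    also have "(\<Sum>t\<in>J3. (b t \<bullet> v)\<^sup>2) = 0" using bH0 by simp
    also have "(\<Sum>t\<in>J1. (b t \<bullet> v)\<^sup>2) = (\<Sum>t\<in>J1. if t = t0 then m\<^sup>2 else 0)"
      by (intro sum.cong) (auto simp: b(8))
    finally show ?thesis using b(7) by simp
  qed
  have "(\<integral>\<^sup>+x. h ((norm (resid G (x + v)))\<^sup>2 / (norm (resid H x))\<^sup>2 - 1) \<partial>gauss) =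
    (\<integral>\<^sup>+x. (\<lambda>y. h ((\<Sum>t\<in>J1. (y t + (if t = t0 then m else 0))\<^sup>2) / (\<Sum>t\<in>J3. (y t)\<^sup>2))) (\<lambda>t. b t \<bullet> x) \<partial>gauss)"
    \<comment> \<open>subtracting 1 removes the part orthogonal to \<open>H\<close>, provided the denominator is nonzero\<close>
  proof (rule nn_integral_cong_AE)
    have "AE x in gauss. x \<notin> H" by (rule AE_gauss_not_in_subspace[OF H dim(2)])
    then show "AE x in gauss. h ((norm (resid G (x + v)))\<^sup>2 / (norm (resid H x))\<^sup>2 - 1) =
       (\<lambda>y. h ((\<Sum>t\<in>J1. (y t + (if t = t0 then m else 0))\<^sup>2) / (\<Sum>t\<in>J3. (y t)\<^sup>2))) (\<lambda>t. b t \<bullet> x)"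
    proof eventually_elim
      case (elim x)
      then have "(\<Sum>t\<in>J3. (b t \<bullet> x)\<^sup>2) \<noteq> 0" unfolding rH[symmetric] by (simp add: resid_eq_0_iff[OF H])
      then show ?case unfolding rG rH by (simp add: add_divide_distrib)
    qed
  qed
  also have "\<dots> = (\<integral>\<^sup>+x. h ((\<Sum>t\<in>J1. (x t + (if t = t0 then m else 0))\<^sup>2) / (\<Sum>t\<in>J3. (x t)\<^sup>2)) \<partial>PiM UNIV (\<lambda>_. std_normal))"
    by (rule nn_integral_gauss_onb[OF b(1)]) measurable
  also have "\<dots> = (\<Sum>k. ennreal (pois (m\<^sup>2 / 2) k) *
        (\<integral>\<^sup>+r. ennreal (bprime (real (card J1) / 2 + real k) (real (card J3) / 2) r) * h r \<partial>lborel))"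
    by (rule nn_integral_noncentral_ratio[OF _ b(7) disj ne]) measurable
  finally show ?thesis unfolding m b(6) c3 .
qed

lemma nn_integral_ratio_mixture:
  fixes G :: "(real^'t) set" and c :: "nat \<Rightarrow> ennreal"
  assumes G: "subspace G" and dim: "dim G < CARD('t)"
  shows "(\<integral>\<^sup>+w. (\<Sum>k. ennreal (pois ((norm (resid G (\<rho> *\<^sub>R w)))\<^sup>2 / 2) k) * c k) \<partial>gauss) =
    (\<Sum>k. ennreal (nbin (real (CARD('t) - dim G) / 2) (\<rho>\<^sup>2) k) * c k)"
proof -
  let ?a = "real (CARD('t) - dim G) / 2"
  have a: "?a > 0" using dim by simp
  have [measurable]: "(\<lambda>s. pois (l * s / 2) k) \<in> borel_measurable borel" for l k
    unfolding pois_def by measurable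
  have "(\<integral>\<^sup>+w. (\<Sum>k. ennreal (pois ((norm (resid G (\<rho> *\<^sub>R w)))\<^sup>2 / 2) k) * c k) \<partial>gauss) =
    (\<integral>\<^sup>+w. (\<lambda>s. \<Sum>k. ennreal (pois (\<rho>\<^sup>2 * s / 2) k) * c k) ((norm (resid G w))\<^sup>2) \<partial>gauss)"
    by (simp add: resid_scaleR[OF G] power_mult_distrib)
  also have "\<dots> = (\<integral>\<^sup>+s. ennreal (gam ?a s) * (\<Sum>k. ennreal (pois (\<rho>\<^sup>2 * s / 2) k) * c k) \<partial>lborel)"
    by (rule nn_integral_gauss_resid[OF G dim]) measurable
  also have "\<dots> = (\<integral>\<^sup>+s. (\<Sum>k. (ennreal (gam ?a s) * ennreal (pois (\<rho>\<^sup>2 * s / 2) k)) * c k) \<partial>lborel)"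
    by (simp only: ennreal_suminf_cmult[symmetric] mult.assoc)
  also have "\<dots> = (\<Sum>k. (\<integral>\<^sup>+s. ennreal (gam ?a s) * ennreal (pois (\<rho>\<^sup>2 * s / 2) k) \<partial>lborel) * c k)"
    by (subst nn_integral_suminf, measurable) (intro suminf_cong nn_integral_multc, measurable)
  also have "\<dots> = (\<Sum>k. ennreal (nbin ?a (\<rho>\<^sup>2) k) * c k)"
    using a by (simp only: gam_pois_mixture zero_le_power2)
  finally show ?thesis .
qed

section \<open>Gram matrices and their inverses\<close>

lemma det_eq_0_iff_kernel:
  fixes A :: "real^'n^'n"
  shows "det A = 0 \<longleftrightarrow> (\<exists>x. x \<noteq> 0 \<and> A *v x = 0)"
  by (metis invertible_det_nz invertible_left_inverse matrix_left_invertible_ker)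

text \<open>The Gram matrix of a finite family of vectors.\<close>

definition gram :: "('n::finite \<Rightarrow> real^'m) \<Rightarrow> real^'n^'n" where
  "gram y = (\<chi> a b. y a \<bullet> y b)"

text \<open>The rows of the inverse Gram matrix give the dual basis, whose own Gram matrix is that inverse.\<close>

lemma gram_dual:
  fixes y :: "'n::finite \<Rightarrow> real^'m"
  assumes inv: "invertible (gram y)"
  defines "d \<equiv> \<lambda>a. \<Sum>b\<in>UNIV. matrix_inv (gram y) $ a $ b *\<^sub>R y b"
  shows "d a \<bullet> y b = (if a = b then 1 else 0)"
    and "d a \<bullet> d b = matrix_inv (gram y) $ a $ b"
    and "x \<in> span (range y) \<Longrightarrow> x = (\<Sum>a\<in>UNIV. (x \<bullet> y a) *\<^sub>R d a)"
proof -
  show dy: "d a \<bullet> y b = (if a = b then 1 else 0)" for a b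
  proof -
    have "d a \<bullet> y b = (matrix_inv (gram y) ** gram y) $ a $ b"
      by (simp add: d_def inner_sum_left matrix_matrix_mult_def gram_def)
    then show ?thesis by (simp add: matrix_inv_inverse[OF inv] mat_def)
  qed
  have "d b \<bullet> d a = matrix_inv (gram y) $ a $ b" for a b
  proof -
    have "d b \<bullet> d a = (\<Sum>c\<in>UNIV. matrix_inv (gram y) $ a $ c * (d b \<bullet> y c))"
      by (subst (2) d_def) (simp add: inner_sum_right)
    also have "\<dots> = (\<Sum>c\<in>UNIV. if c = b then matrix_inv (gram y) $ a $ c else 0)"
      by (intro sum.cong) (auto simp: dy)
    finally show ?thesis by simp
  qed
  then show "d a \<bullet> d b = matrix_inv (gram y) $ a $ b" by (subst inner_commute)
  assume x: "x \<in> span (range y)"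
  define z where "z = x - (\<Sum>a\<in>UNIV. (x \<bullet> y a) *\<^sub>R d a)"
  have "d a \<in> span (range y)" for a
    unfolding d_def by (intro span_sum span_scale span_base) auto
  then have "z \<in> span (range y)"
    unfolding z_def using x by (intro span_diff span_sum span_scale) auto
  moreover have "z \<bullet> y b = 0" for b
  proof -
    have "z \<bullet> y b = x \<bullet> y b - (\<Sum>a\<in>UNIV. if a = b then x \<bullet> y a else 0)"
      unfolding z_def inner_diff_left inner_sum_left inner_scaleR_left dy by (simp add: if_distrib cong: if_cong)
    then show ?thesis by simp
  qed
  ultimately have "orthogonal z z"
    by (intro orthogonal_to_span[of z "range y" z]) (auto simp: orthogonal_def)
  then show "x = (\<Sum>a\<in>UNIV. (x \<bullet> y a) *\<^sub>R d a)" by (simp add: orthogonal_self z_def)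
qed

lemma gram_invertible_iff:
  fixes y :: "'n::finite \<Rightarrow> real^'m"
  shows "invertible (gram y) \<longleftrightarrow> inj y \<and> independent (range y)"
proof
  assume inv: "invertible (gram y)"
  define d where "d a = (\<Sum>b\<in>UNIV. matrix_inv (gram y) $ a $ b *\<^sub>R y b)" for a
  note dual = gram_dual[OF inv, folded d_def]
  have inj: "inj y"
    by (rule injI) (metis dual(1) zero_neq_one)
  have "y a \<notin> span (range y - {y a})" for a
  proof
    assume "y a \<in> span (range y - {y a})"
    then have "orthogonal (d a) (y a)"
      by (rule orthogonal_to_span) (auto simp: orthogonal_def dual(1))
    then show False using dual(1)[of a a] by (simp add: orthogonal_def)
  qed
  then have "independent (range y)" unfolding dependent_def by auto
  with inj show "inj y \<and> independent (range y)" by simp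
next
  assume y: "inj y \<and> independent (range y)"
  have "det (gram y) \<noteq> 0"
  proof
    assume "det (gram y) = 0"
    then obtain c where c: "c \<noteq> 0" "gram y *v c = 0"
      using det_eq_0_iff_kernel[of "gram y"] by blast
    define z where "z = (\<Sum>b\<in>UNIV. c $ b *\<^sub>R y b)"
    have "y a \<bullet> z = (gram y *v c) $ a" for a
      by (simp add: z_def inner_sum_right matrix_vector_mult_def gram_def mult.commute)
    then have yz: "y a \<bullet> z = 0" for a by (simp add: c)
    have "z \<bullet> z = 0" unfolding z_def[of] inner_sum_left
      by (subst z_def[symmetric]) (simp add: yz)
    then have "(\<Sum>b\<in>UNIV. c $ b *\<^sub>R y b) = 0" by (simp add: z_def)
    then have "(\<Sum>v\<in>range y. c $ (inv y v) *\<^sub>R v) = 0"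
      using y by (subst sum.reindex) auto
    then have "\<forall>v\<in>range y. c $ (inv y v) = 0"
      using y independentD[of "range y" "range y" "\<lambda>v. c $ (inv y v)"] by auto
    then have "c $ b = 0" for b using y by auto
    then show False using c by (simp add: vec_eq_iff)
  qed
  then show "invertible (gram y)" by (simp add: invertible_det_nz)
qed

lemma dim_span_gram:
  fixes y :: "'n::finite \<Rightarrow> real^'m"
  assumes "invertible (gram y)"
  shows "dim (span (y ` J)) = card J"
proof -
  have y: "inj y" "independent (range y)" using assms by (auto simp: gram_invertible_iff)
  then have "independent (y ` J)" by (meson independent_mono image_mono subset_UNIV)
  moreover have "card (y ` J) = card J" using y(1) by (intro card_image) (auto intro: inj_on_subset)
  ultimately show ?thesis by (simp add: dim_eq_card_independent)
qed

lemma sum_UNIV_Plus: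
  fixes q :: "'a::finite + 'b::finite \<Rightarrow> 'c::comm_monoid_add"
  shows "(\<Sum>a\<in>UNIV. q a) = (\<Sum>a\<in>UNIV. q (Inl a)) + (\<Sum>a\<in>UNIV. q (Inr a))"
  by (simp add: UNIV_Plus_UNIV[symmetric] sum.Plus del: UNIV_Plus_UNIV)

text \<open>For \<open>V = (gram y)\<^sup>-\<^sup>1\<close>, the entry \<open>V\<^sub>j\<^sub>j\<close> is the reciprocal squared length of the residual of
  \<open>y\<^sub>j\<close> on all other vectors. The dual vectors with index in the upper-left block span the orthogonal
  complement of the remaining \<open>y\<close>'s inside \<open>span y\<close>, so the inverse of that block is the Gram matrix
  of the residuals on the \<open>Inr\<close> vectors alone.\<close>

lemma upper_left_inverse_gram:
  fixes y :: "'p::finite + 'k::finite \<Rightarrow> real^'m"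
  assumes inv: "invertible (gram y)"
  shows "upper_left (matrix_inv (gram y)) $ j $ j * matrix_inv (upper_left (matrix_inv (gram y))) $ j $ j =
     (norm (resid (span (y ` range Inr)) (y (Inl j))))\<^sup>2 / (norm (resid (span (y ` (- {Inl j}))) (y (Inl j))))\<^sup>2"
proof -
  define V where "V = matrix_inv (gram y)"
  define d where "d a = (\<Sum>b\<in>UNIV. matrix_inv (gram y) $ a $ b *\<^sub>R y b)" for a
  note dual = gram_dual[OF inv, folded d_def, folded V_def]
  let ?S = "span (y ` range Inr)"
  let ?S' = "span (y ` (- {Inl j}))"
  have inspan: "resid (span (y ` I)) (y a) \<in> span (range y)" for I a
  proof -
    have "y a - resid (span (y ` I)) (y a) \<in> span (range y)"
      using diff_resid_in[OF subspace_span, of "y a" "y ` I"] span_mono[of "y ` I" "range y"] by auto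
    then have "y a - (y a - resid (span (y ` I)) (y a)) \<in> span (range y)"
      by (rule span_diff[rotated]) (simp add: span_base)
    then show ?thesis by simp
  qed
  have dS: "s \<bullet> d a = 0" if "s \<in> span (y ` I)" "a \<notin> I" for s a I
  proof -
    have "orthogonal (d a) s"
      using that(1) by (rule orthogonal_to_span) (use that(2) in \<open>auto simp: orthogonal_def dual(1)\<close>)
    then show ?thesis by (simp add: orthogonal_def inner_commute)
  qed
  define e where "e a = resid ?S (y (Inl a))" for a
  have eS: "s \<bullet> e a = 0" if "s \<in> ?S" for s a
    unfolding e_def using that by (rule resid_orthogonal[OF subspace_span])
  have diffS: "y (Inl a) - e a \<in> ?S" for a unfolding e_def by (rule diff_resid_in) simp
  define E :: "real^'p^'p" where "E = (\<chi> a b. e a \<bullet> e b)"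
  have ey: "e a \<bullet> y (Inl b) = E $ a $ b" for a b
    using eS[OF diffS, of b a] by (simp add: E_def inner_diff_left inner_diff_right inner_commute)
  have ed: "e a \<bullet> d (Inl c) = (if a = c then 1 else 0)" for a c
  proof -
    have "Inl c \<notin> range (Inr :: 'k \<Rightarrow> 'p + 'k)" by auto
    from dS[OF diffS this, of a] dual(1)[of "Inl c" "Inl a"] show ?thesis
      by (auto simp: inner_diff_left inner_diff_right inner_commute)
  qed
  have e_exp: "e a = (\<Sum>b\<in>UNIV. E $ a $ b *\<^sub>R d (Inl b))" for a
  proof -
    have "e a \<bullet> y (Inr k) = 0" for k
      using eS[of "y (Inr k)" a] by (simp add: span_base inner_commute)
    then show ?thesis
      using dual(3)[OF inspan[of "range Inr" "Inl a"]] unfolding e_def[symmetric] sum_UNIV_Plus ey by simp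
  qed
  have "E ** upper_left V = mat 1"
  proof -
    have "(E ** upper_left V) $ a $ c = e a \<bullet> d (Inl c)" for a c
      by (subst e_exp) (simp add: inner_sum_left dual(2) matrix_matrix_mult_def upper_left_def)
    then show ?thesis by (simp add: vec_eq_iff ed mat_def)
  qed
  then have invV: "matrix_inv (upper_left V) = E"
    by (intro matrix_inv_unique) (auto simp: matrix_left_right_inverse)
  define r where "r = resid ?S' (y (Inl j))"
  have ry: "r \<bullet> y a = (if a = Inl j then r \<bullet> r else 0)" for a
  proof (cases "a = Inl j")
    case True
    have "(y (Inl j) - r) \<bullet> r = 0" unfolding r_def
      by (rule resid_orthogonal) (auto intro: diff_resid_in)
    then show ?thesis using True by (simp add: inner_diff_left inner_diff_right inner_commute)
  next
    case False
    then have "y a \<bullet> r = 0" unfolding r_def by (intro resid_orthogonal) (auto intro: span_base)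
    then show ?thesis using False by (simp add: inner_commute)
  qed
  have "r = (\<Sum>a\<in>UNIV. (r \<bullet> y a) *\<^sub>R d a)"
    by (rule dual(3)) (unfold r_def, rule inspan)
  also have "\<dots> = (\<Sum>a\<in>UNIV. if a = Inl j then (r \<bullet> r) *\<^sub>R d a else 0)"
    by (intro sum.cong) (auto simp: ry)
  finally have r_eq: "r = (r \<bullet> r) *\<^sub>R d (Inl j)" by simp
  have "r \<bullet> d (Inl j) = 1"
    using dS[OF diff_resid_in[OF subspace_span], of "Inl j" "- {Inl j}" "y (Inl j)"] dual(1)[of "Inl j" "Inl j"]
    by (simp add: r_def[symmetric] inner_diff_left inner_diff_right inner_commute)
  then have "(r \<bullet> r) * V $ Inl j $ Inl j = 1"
    using arg_cong[OF r_eq, of "\<lambda>x. x \<bullet> d (Inl j)"] by (simp add: dual(2))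
  moreover from this have "r \<bullet> r \<noteq> 0" by auto
  ultimately have "V $ Inl j $ Inl j = 1 / (norm r)\<^sup>2"
    unfolding power2_norm_eq_inner by (simp only: eq_divide_eq mult.commute simp_thms if_False if_True)
  then show ?thesis
    unfolding V_def[symmetric] invV by (simp add: upper_left_def E_def e_def r_def power2_norm_eq_inner)
qed

text \<open>The family of linear combinations of the vectors \<open>w\<close> with coefficients in the rows of \<open>A\<close>.\<close>

definition lin_comb :: "real^'n^'n \<Rightarrow> ('n::finite \<Rightarrow> real^'m) \<Rightarrow> 'n \<Rightarrow> real^'m" where
  "lin_comb A w a = (\<Sum>b\<in>UNIV. A $ a $ b *\<^sub>R w b)"

lemma gram_lin_comb: "gram (lin_comb A w) = A ** gram w ** transpose A"
  by (simp add: vec_eq_iff gram_def lin_comb_def matrix_matrix_mult_def transpose_def inner_sum_left inner_sum_right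
      sum_distrib_left sum_distrib_right mult_ac)

lemma invertible_transpose_matrix: "invertible A \<Longrightarrow> invertible (transpose (A :: real^'n^'n))"
  by (simp add: invertible_det_nz det_transpose)

lemma invertible_gram_lin_comb:
  "invertible A \<Longrightarrow> invertible (gram w) \<Longrightarrow> invertible (gram (lin_comb A w))"
  by (simp add: gram_lin_comb invertible_mult invertible_transpose_matrix)

text \<open>If the rows of \<open>A\<close> in \<open>J\<close> only use columns in \<open>J\<close>, one inclusion is clear and the dimensions agree.\<close>

lemma span_lin_comb:
  assumes A: "invertible A" and w: "invertible (gram w)"
    and block: "\<And>a b. a \<in> J \<Longrightarrow> b \<notin> J \<Longrightarrow> A $ a $ b = 0"
  shows "span (lin_comb A w ` J) = span (w ` J)"
proof (rule subspace_dim_equal)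
  show "dim (span (w ` J)) \<le> dim (span (lin_comb A w ` J))"
    by (simp only: dim_span_gram[OF w] dim_span_gram[OF invertible_gram_lin_comb[OF A w]])
  have "lin_comb A w a \<in> span (w ` J)" if "a \<in> J" for a
    unfolding lin_comb_def
  proof (rule span_sum)
    fix b
    show "A $ a $ b *\<^sub>R w b \<in> span (w ` J)"
      using block[OF that, of b] by (cases "b \<in> J") (auto intro: span_scale span_base span_zero)
  qed
  then show "span (lin_comb A w ` J) \<subseteq> span (w ` J)" by (intro span_minimal) auto
qed auto

text \<open>Up to a vector in the span of the \<open>Inr\<close> vectors, which both residuals annihilate, combination \<open>j\<close>
  only involves \<open>w\<^sub>j\<close> and \<open>w\<^sub>i\<close>; by homogeneity the ratio depends on their coefficients only through the
  quotient.\<close>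

lemma upper_left_ratio_lin_comb:
  fixes w :: "'p::finite + 'k::finite \<Rightarrow> real^'m"
  assumes A: "invertible A" and w: "invertible (gram w)" and ij: "i \<noteq> j"
    and block: "\<And>k a. A $ Inr k $ Inl a = 0" and col: "\<And>a. a \<noteq> Inl j \<Longrightarrow> A $ a $ Inl j = 0"
    and row: "\<And>a. a \<noteq> i \<Longrightarrow> a \<noteq> j \<Longrightarrow> A $ Inl j $ Inl a = 0"
  shows "upper_left (matrix_inv (gram (lin_comb A w))) $ j $ j *
      matrix_inv (upper_left (matrix_inv (gram (lin_comb A w)))) $ j $ j =
     (norm (resid (span (w ` range Inr)) (w (Inl j) + (A $ Inl j $ Inl i / A $ Inl j $ Inl j) *\<^sub>R w (Inl i))))\<^sup>2
      / (norm (resid (span (w ` (- {Inl j}))) (w (Inl j))))\<^sup>2"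
proof -
  let ?G = "span (w ` range Inr)" and ?H = "span (w ` (- {Inl j}))"
  let ?s = "A $ Inl j $ Inl j" and ?t = "A $ Inl j $ Inl i"
  have s0: "?s \<noteq> 0"
  proof
    assume "?s = 0"
    then have "A *v axis (Inl j) 1 = 0" using col
      by (simp add: matrix_vector_mult_basis column_def vec_eq_iff) metis
    then show False
      using matrix_vector_mult_eq_iff[OF A, of "axis (Inl j) 1" 0] by (simp add: axis_eq_0_iff)
  qed
  define g where "g = (\<Sum>k\<in>UNIV. A $ Inl j $ Inr k *\<^sub>R w (Inr k))"
  have gG: "g \<in> ?G" unfolding g_def by (intro span_sum span_scale span_base) auto
  have "(\<Sum>a\<in>UNIV. A $ Inl j $ Inl a *\<^sub>R w (Inl a)) = (\<Sum>a\<in>{i, j}. A $ Inl j $ Inl a *\<^sub>R w (Inl a))"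
    using row by (intro sum.mono_neutral_right) auto
  then have "lin_comb A w (Inl j) = g + (?s *\<^sub>R w (Inl j) + ?t *\<^sub>R w (Inl i))"
    using ij by (simp add: lin_comb_def sum_UNIV_Plus g_def add_ac)
  also have "?s *\<^sub>R w (Inl j) + ?t *\<^sub>R w (Inl i) = ?s *\<^sub>R (w (Inl j) + (?t / ?s) *\<^sub>R w (Inl i))"
    using s0 by (simp add: scaleR_add_right)
  finally have y: "lin_comb A w (Inl j) = g + ?s *\<^sub>R (w (Inl j) + (?t / ?s) *\<^sub>R w (Inl i))" .
  have GH: "?G \<subseteq> ?H" by (intro span_mono) auto
  have h: "g + ?s *\<^sub>R (?t / ?s) *\<^sub>R w (Inl i) \<in> ?H"
    using subsetD[OF GH gG] ij by (intro span_add[OF _ span_scale[OF span_scale[OF span_base]]]) auto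
  have y': "lin_comb A w (Inl j) = (g + ?s *\<^sub>R (?t / ?s) *\<^sub>R w (Inl i)) + ?s *\<^sub>R w (Inl j)"
    unfolding y by (simp add: scaleR_add_right add_ac)
  have "resid ?H (lin_comb A w (Inl j)) = ?s *\<^sub>R resid ?H (w (Inl j))"
    unfolding y' using h by (simp add: resid_add_left resid_scaleR)
  moreover have "resid ?G (lin_comb A w (Inl j)) = ?s *\<^sub>R resid ?G (w (Inl j) + (?t / ?s) *\<^sub>R w (Inl i))"
    unfolding y using gG by (simp add: resid_add_left resid_scaleR)
  moreover have "span (lin_comb A w ` range Inr) = ?G"
    by (rule span_lin_comb[OF A w]) (use block in \<open>auto simp: image_iff split: sum.splits; metis sum.exhaust\<close>)
  moreover have "span (lin_comb A w ` (- {Inl j})) = ?H"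
    by (rule span_lin_comb[OF A w]) (use col in auto)
  ultimately show ?thesis
    unfolding upper_left_inverse_gram[OF invertible_gram_lin_comb[OF A w]]
    using s0 by (simp add: power_mult_distrib)
qed

text \<open>The principal minor of the Gram matrix for the index set \<open>I\<close>, padded with an identity block so that
  all minors are determinants of one size.\<close>

definition gram_minor :: "'n set \<Rightarrow> ('n::finite \<Rightarrow> real^'m) \<Rightarrow> real" where
  "gram_minor I w = det (\<chi> a b. if a \<in> I \<and> b \<in> I then w a \<bullet> w b else if a = b then 1 else 0)"

lemma gram_minor_UNIV: "gram_minor UNIV w \<noteq> 0 \<longleftrightarrow> invertible (gram w)"
  by (simp add: gram_minor_def gram_def invertible_det_nz)

lemma gram_minor_empty: "gram_minor {} w = 1"
proof -
  have "(\<chi> a b. if a = b then 1 else 0) = (mat 1 :: real^'a^'a)" by (simp add: mat_def)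
  then show ?thesis by (simp add: gram_minor_def)
qed

lemma gram_minor_insert:
  fixes w :: "'n::finite \<Rightarrow> real^'m"
  assumes nz: "gram_minor I w \<noteq> 0" and i: "i \<notin> I" and z: "gram_minor (insert i I) w = 0"
  shows "w i \<in> span (w ` I)"
proof -
  define M where "M J = (\<chi> a b. if a \<in> J \<and> b \<in> J then w a \<bullet> w b else if a = b then 1 else 0 :: real^'n^'n)" for J
  have comp: "(M J *v c) $ a = (if a \<in> J then w a \<bullet> (\<Sum>b\<in>J. c $ b *\<^sub>R w b) else c $ a)" for J c a
  proof (cases "a \<in> J")
    case True
    have "(M J *v c) $ a = (\<Sum>b\<in>UNIV. if b \<in> J then (w a \<bullet> w b) * c $ b else 0)"
      unfolding matrix_vector_mult_def M_def using True by (auto intro!: sum.cong)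
    also have "\<dots> = (\<Sum>b\<in>J. (w a \<bullet> w b) * c $ b)" by (simp add: sum.If_cases)
    finally show ?thesis using True by (simp add: inner_sum_right mult.commute)
  next
    case False
    have "(M J *v c) $ a = (\<Sum>b\<in>UNIV. (if a = b then 1 else 0) * c $ b)"
      unfolding matrix_vector_mult_def M_def using False by simp
    also have "\<dots> = (\<Sum>b\<in>UNIV. if b = a then c $ b else 0)" by (intro sum.cong) auto
    finally show ?thesis using False by simp
  qed
  obtain c where c: "c \<noteq> 0" "M (insert i I) *v c = 0"
    using det_eq_0_iff_kernel[of "M (insert i I)"] z unfolding gram_minor_def M_def by blast
  define x where "x = (\<Sum>b\<in>insert i I. c $ b *\<^sub>R w b)"
  have "w a \<bullet> x = 0" if "a \<in> insert i I" for a
    using comp[of "insert i I" c a] that c by (simp add: x_def)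
  then have "x \<bullet> x = 0" by (subst (1) x_def) (simp add: inner_sum_left)
  then have x0: "c $ i *\<^sub>R w i + (\<Sum>b\<in>I. c $ b *\<^sub>R w b) = 0"
    using i by (simp add: x_def)
  have c0: "c $ a = 0" if "a \<notin> insert i I" for a
    using comp[of "insert i I" c a] that c by simp
  have "c $ i \<noteq> 0"
  proof
    assume ci: "c $ i = 0"
    have "M I *v c = 0"
    proof (simp add: vec_eq_iff, intro allI)
      fix a show "(M I *v c) $ a = 0"
        using x0 c0[of a] ci by (cases "a = i") (auto simp: comp)
    qed
    then have "gram_minor I w = 0"
      using det_eq_0_iff_kernel[of "M I"] c(1) unfolding gram_minor_def M_def by blast
    then show False using nz by simp
  qed
  then have "w i = (1 / c $ i) *\<^sub>R (c $ i *\<^sub>R w i)" by simp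
  also have "c $ i *\<^sub>R w i = - (\<Sum>b\<in>I. c $ b *\<^sub>R w b)" using x0 by (simp add: eq_neg_iff_add_eq_0)
  also have "(1 / c $ i) *\<^sub>R - (\<Sum>b\<in>I. c $ b *\<^sub>R w b) \<in> span (w ` I)"
    by (intro span_scale span_neg span_sum span_base) auto
  finally show ?thesis .
qed

section \<open>Factors of positive definite matrices\<close>

text \<open>One Gram--Schmidt step for the inner product given by \<open>\<Sigma>\<close>. The supports are tracked, so that the order
  in which the indices are added shows up as a zero pattern.\<close>

lemma pos_def_extend_basis:
  fixes \<Sigma> :: "real^'n^'n"
  assumes pd: "pos_def \<Sigma>" and i: "i \<notin> I"
    and c: "\<And>a b. a \<in> I \<Longrightarrow> b \<in> I \<Longrightarrow> c a \<bullet> (\<Sigma> *v c b) = (if a = b then 1 else 0)"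
    and supp: "\<And>a m. a \<in> I \<Longrightarrow> m \<notin> I \<Longrightarrow> c a $ m = 0"
  obtains c' where "\<And>a. a \<in> I \<Longrightarrow> c' a = c a"
    "\<And>a b. a \<in> insert i I \<Longrightarrow> b \<in> insert i I \<Longrightarrow> c' a \<bullet> (\<Sigma> *v c' b) = (if a = b then 1 else 0)"
    "\<And>a m. a \<in> insert i I \<Longrightarrow> m \<notin> insert i I \<Longrightarrow> c' a $ m = (0::real)"
proof -
  have sym: "x \<bullet> (\<Sigma> *v y) = y \<bullet> (\<Sigma> *v x)" for x y
    using pd unfolding pos_def_def by (metis dot_lmul_matrix inner_commute transpose_matrix_vector)
  define v where "v = axis i 1 - (\<Sum>a\<in>I. (c a \<bullet> (\<Sigma> *v axis i 1)) *\<^sub>R c a)"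
  have fin: "finite I" by simp
  have orth: "c b \<bullet> (\<Sigma> *v v) = 0" if b: "b \<in> I" for b
  proof -
    have "c b \<bullet> (\<Sigma> *v v) = c b \<bullet> (\<Sigma> *v axis i 1) - (\<Sum>a\<in>I. (c a \<bullet> (\<Sigma> *v axis i 1)) * (c b \<bullet> (\<Sigma> *v c a)))"
      by (simp add: v_def matrix_vector_mult_diff_distrib linear_sum[OF matrix_vector_mul_linear]
        matrix_vector_mult_scaleR inner_diff_right inner_sum_right)
    also have "(\<Sum>a\<in>I. (c a \<bullet> (\<Sigma> *v axis i 1)) * (c b \<bullet> (\<Sigma> *v c a))) = (\<Sum>a\<in>I. if a = b then c a \<bullet> (\<Sigma> *v axis i 1) else 0)"
      using c b by (intro sum.cong) auto
    finally show ?thesis using b by simp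
  qed
  have "v $ i = 1" using supp i by (simp add: v_def sum_nonneg sum.neutral)
  then have "v \<noteq> 0" by auto
  then have pos: "v \<bullet> (\<Sigma> *v v) > 0" using pd by (simp add: pos_def_def)
  define q where "q = sqrt (v \<bullet> (\<Sigma> *v v))"
  have q: "q > 0" "q * q = v \<bullet> (\<Sigma> *v v)" using pos by (auto simp: q_def)
  have vsupp: "v $ m = 0" if "m \<notin> insert i I" for m
    using that supp by (auto simp: v_def axis_def intro!: sum.neutral)
  show ?thesis
  proof (rule that[of "c(i := (1 / q) *\<^sub>R v)"])
    fix a b assume ab: "a \<in> insert i I" "b \<in> insert i I"
    let ?c = "c(i := (1 / q) *\<^sub>R v)"
    define v' where "v' = (1 / q) *\<^sub>R v"
    have vi: "v' \<bullet> (\<Sigma> *v v') = 1"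
      using q pos by (simp add: v'_def matrix_vector_mult_scaleR)
    have cv: "c a \<bullet> (\<Sigma> *v v') = 0" "v' \<bullet> (\<Sigma> *v c a) = 0" if "a \<in> I" for a
      using orth[OF that] sym[of v' "c a"] by (simp_all add: v'_def matrix_vector_mult_scaleR)
    show "?c a \<bullet> (\<Sigma> *v ?c b) = (if a = b then 1 else 0)"
      unfolding v'_def[symmetric] using ab vi cv c i by auto
  qed (use i supp vsupp in auto)
qed

lemma pos_def_basis:
  fixes \<Sigma> :: "real^'n^'n"
  assumes pd: "pos_def \<Sigma>"
  obtains c where
    "\<And>a b. a \<in> I \<Longrightarrow> b \<in> I \<Longrightarrow> c a \<bullet> (\<Sigma> *v c b) = (if a = b then 1 else 0 :: real)"
    "\<And>a m. a \<in> I \<Longrightarrow> m \<notin> I \<Longrightarrow> c a $ m = (0::real)"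
proof -
  have "finite I" by simp
  then have "\<exists>c. (\<forall>a\<in>I. \<forall>b\<in>I. c a \<bullet> (\<Sigma> *v c b) = (if a = b then 1 else 0 :: real)) \<and> (\<forall>a\<in>I. \<forall>m. m \<notin> I \<longrightarrow> c a $ m = (0::real))"
  proof (induction I rule: finite_induct)
    case (insert i I)
    then obtain c where c: "\<forall>a\<in>I. \<forall>b\<in>I. c a \<bullet> (\<Sigma> *v c b) = (if a = b then 1 else 0 :: real)" "\<forall>a\<in>I. \<forall>m. m \<notin> I \<longrightarrow> c a $ m = (0::real)"
      by blast
    obtain c' where "\<And>a b. a \<in> insert i I \<Longrightarrow> b \<in> insert i I \<Longrightarrow> c' a \<bullet> (\<Sigma> *v c' b) = (if a = b then 1 else 0)"
      "\<And>a m. a \<in> insert i I \<Longrightarrow> m \<notin> insert i I \<Longrightarrow> c' a $ m = (0::real)"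
      by (rule pos_def_extend_basis[OF pd insert.hyps(2), of c]) (use c in \<open>blast+\<close>)
    then show ?case by blast
  qed simp
  then show ?thesis using that by blast
qed

text \<open>Orthonormalizing with \<open>j\<close> as the last index makes column \<open>j\<close> of the factor vanish off the
  diagonal.\<close>

lemma pos_def_factor_column:
  fixes \<Sigma> :: "real^'n^'n"
  assumes pd: "pos_def \<Sigma>"
  obtains L where "L ** transpose L = \<Sigma>" "invertible L" "\<And>a. a \<noteq> j \<Longrightarrow> L $ a $ j = (0::real)"
proof -
  obtain c0 where c0: "\<And>a b. a \<in> -{j} \<Longrightarrow> b \<in> -{j} \<Longrightarrow> c0 a \<bullet> (\<Sigma> *v c0 b) = (if a = b then 1 else 0 :: real)"
    "\<And>a m. a \<in> -{j} \<Longrightarrow> m \<notin> -{j} \<Longrightarrow> c0 a $ m = (0::real)"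
    using pos_def_basis[OF pd, of "-{j}"] by metis
  obtain c where c: "\<And>a. a \<in> -{j} \<Longrightarrow> c a = c0 a"
    "\<And>a b. a \<in> insert j (-{j}) \<Longrightarrow> b \<in> insert j (-{j}) \<Longrightarrow> c a \<bullet> (\<Sigma> *v c b) = (if a = b then 1 else 0 :: real)"
  proof (rule pos_def_extend_basis[OF pd _ c0])
    show "j \<notin> - {j}" by simp
  qed (assumption+, rule that)
  have cj: "c a $ j = 0" if "a \<noteq> j" for a using c(1)[of a] c0(2)[of a j] that by simp
  define C where "C = (\<chi> a. c a)"
  have "C ** (\<Sigma> ** transpose C) = mat 1"
  proof -
    have "(C ** (\<Sigma> ** transpose C)) $ a $ b = c a \<bullet> (\<Sigma> *v c b)" for a b
      by (simp add: C_def matrix_matrix_mult_def transpose_def matrix_vector_mult_def inner_vec_def)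
    then show ?thesis using c(2) by (simp add: vec_eq_iff mat_def)
  qed
  then have inv: "invertible C" and CS: "(\<Sigma> ** transpose C) ** C = mat 1"
    by (auto simp: invertible_def matrix_left_right_inverse)
  define L where "L = matrix_inv C"
  have LC: "C ** L = mat 1" "L ** C = mat 1" using matrix_inv_inverse[OF inv] by (auto simp: L_def)
  have L: "L = \<Sigma> ** transpose C" unfolding L_def by (rule matrix_inv_unique) fact+
  have TT: "transpose C ** transpose L = mat 1"
    by (simp only: matrix_transpose_mul[symmetric] LC(2) transpose_mat)
  have "L ** transpose L = \<Sigma> ** (transpose C ** transpose L)" by (subst (1) L) (simp only: matrix_mul_assoc)
  then have LL: "L ** transpose L = \<Sigma>" by (simp add: TT)
  have invL: "invertible L" using LC by (auto simp: invertible_def)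
  have "C *v axis j 1 = (C $ j $ j) *\<^sub>R axis j 1"
  proof -
    have "(C *v axis j 1) $ a = c a $ j" for a
      by (simp add: matrix_vector_mult_basis column_def C_def)
    then show ?thesis using cj by (simp only: vec_eq_iff) (simp add: C_def axis_def)
  qed
  then have "L *v (C *v axis j 1) = (C $ j $ j) *\<^sub>R (L *v axis j 1)"
    by (simp add: matrix_vector_mult_scaleR)
  then have e: "axis j 1 = (C $ j $ j) *\<^sub>R (L *v axis j 1)"
    by (simp add: matrix_vector_mul_assoc LC)
  have Cjj: "C $ j $ j \<noteq> 0" using e by (auto simp: axis_eq_0_iff)
  have "L $ a $ j = 0" if "a \<noteq> j" for a
    using arg_cong[OF e, of "\<lambda>x. x $ a"] Cjj that
    by (simp add: axis_def matrix_vector_mult_basis[unfolded axis_def] column_def)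
  with LL invL show ?thesis using that by blast
qed

text \<open>A reflection that fixes the \<open>j\<close>-th axis then moves the rest of row \<open>j\<close> to the \<open>i\<close>-th axis. In the case
  \<open>u = 0\<close> the map \<open>f\<close> below is the identity, because division by zero yields zero.\<close>

lemma pos_def_factor:
  fixes \<Sigma> :: "real^'n^'n"
  assumes pd: "pos_def \<Sigma>" and ij: "i \<noteq> j"
  obtains L where "L ** transpose L = \<Sigma>" "invertible L" "\<And>a. a \<noteq> j \<Longrightarrow> L $ a $ j = (0::real)"
    "\<And>a. a \<noteq> i \<Longrightarrow> a \<noteq> j \<Longrightarrow> L $ j $ a = 0"
proof -
  obtain L0 where L0: "L0 ** transpose L0 = \<Sigma>" "invertible L0" "\<And>a. a \<noteq> j \<Longrightarrow> L0 $ a $ j = (0::real)"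
    using pos_def_factor_column[OF pd, of j] by metis
  define s where "s = L0 $ j $ j"
  define t where "t = L0 $ j - s *\<^sub>R axis j 1"
  define u where "u = t - norm t *\<^sub>R axis i 1"
  define f where "f x = x - (2 * (u \<bullet> x) / (u \<bullet> u)) *\<^sub>R u" for x :: "real^'n"
  have tj: "t $ j = 0" by (simp add: t_def s_def axis_def)
  have uj: "u $ j = 0" using tj ij by (simp add: u_def axis_def)
  have f_inner: "f x \<bullet> f y = x \<bullet> y" for x y
    by (cases "u = 0") (simp_all add: f_def inner_diff_left inner_diff_right inner_commute field_simps)
  have ft: "f t = norm t *\<^sub>R axis i 1"
  proof (cases "u = 0")
    case True then show ?thesis by (simp add: f_def u_def)
  next
    case False
    have n: "t \<bullet> t = norm t * norm t" by (simp add: dot_square_norm power2_eq_square)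
    have "u \<bullet> u = 2 * (u \<bullet> t)"
      unfolding u_def inner_diff_left inner_diff_right inner_scaleR_left inner_scaleR_right n
      by (simp add: inner_commute algebra_simps)
    moreover have "u \<bullet> u \<noteq> 0" using False by simp
    ultimately show ?thesis by (simp add: f_def u_def)
  qed
  have lj: "L0 $ j = s *\<^sub>R axis j 1 + t" by (simp add: t_def)
  have "u \<bullet> (s *\<^sub>R axis j 1 + t) = u \<bullet> t" using uj by (simp add: inner_add_right inner_axis)
  then have fj: "f (L0 $ j) = s *\<^sub>R axis j 1 + norm t *\<^sub>R axis i 1"
    unfolding ft[symmetric] by (simp add: lj f_def)
  define L :: "real^'n^'n" where "L = (\<chi> a. f (L0 $ a))"
  have LLab: "(A ** transpose A) $ a $ b = A $ a \<bullet> A $ b" for A :: "real^'n^'n" and a b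
    by (simp add: matrix_matrix_mult_def transpose_def inner_vec_def)
  have "L ** transpose L = L0 ** transpose L0"
    unfolding vec_eq_iff LLab by (simp add: L_def f_inner)
  then have LL: "L ** transpose L = \<Sigma>" by (simp add: L0)
  have "det L * det L = det L0 * det L0"
    using arg_cong[OF \<open>L ** transpose L = L0 ** transpose L0\<close>, of det] by (simp add: det_mul det_transpose)
  then have invL: "invertible L" using L0(2) by (auto simp: invertible_det_nz)
  show ?thesis
  proof (rule that[OF LL invL])
    show "L $ a $ j = 0" if "a \<noteq> j" for a using L0(3)[OF that] uj by (simp add: L_def f_def)
    show "L $ j $ a = 0" if "a \<noteq> i" "a \<noteq> j" for a using that fj by (simp add: L_def axis_def)
  qed
qed

section \<open>The law of the ratio for independent Gaussian vectors\<close>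

lemma borel_measurable_inner_PiM [measurable]:
  "(\<lambda>w. w a \<bullet> w b) \<in> borel_measurable (PiM UNIV (\<lambda>_. gauss :: (real^'t) measure))"
  by measurable

lemma borel_measurable_gram_minor [measurable]:
  "gram_minor I \<in> borel_measurable (PiM (UNIV :: 'n::finite set) (\<lambda>_. gauss :: (real^'t) measure))"
  unfolding gram_minor_def[abs_def]
proof (rule borel_measurable_det)
  fix a b :: 'n
  show "(\<lambda>w. (\<chi> a b. if a \<in> I \<and> b \<in> I then w a \<bullet> w b else if a = b then 1 else 0) $ a $ b)
    \<in> borel_measurable (PiM (UNIV :: 'n::finite set) (\<lambda>_. gauss :: (real^'t) measure))"
    by (cases "a \<in> I \<and> b \<in> I") (auto simp: borel_measurable_inner_PiM)
qed

text \<open>Gaussian vectors are almost surely independent: each further vector avoids the proper subspace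
  spanned by those before it.\<close>

lemma AE_gram_minor_nz:
  fixes I :: "'n::finite set"
  assumes card: "CARD('n) \<le> CARD('t::finite)"
  shows "AE w in PiM UNIV (\<lambda>_. gauss :: (real^'t) measure). gram_minor I w \<noteq> 0"
proof -
  have "finite I" by simp
  then show ?thesis
  proof (induction I rule: finite_induct)
    case empty show ?case by (simp add: gram_minor_empty)
  next
    case (insert i I)
    have "AE w in PiM UNIV (\<lambda>_. gauss :: (real^'t) measure). gram_minor I w \<noteq> 0 \<longrightarrow> gram_minor (insert i I) w \<noteq> 0"
    proof (rule AE_PiM_resampleI[OF prob_space_gauss])
      fix w :: "'n \<Rightarrow> real^'t"
      have im: "w(i := x) ` I = w ` I" for x using insert.hyps(2) by auto
      have "card I < CARD('n)" using insert.hyps(2) by (intro psubset_card_mono) auto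
      then have "dim (span (w ` I)) < CARD('t)"
        using card card_image_le[of I w] dim_le_card'[of "w ` I"] by simp
      then have "AE x in gauss. x \<notin> span (w ` I)"
        by (intro AE_gauss_not_in_subspace) auto
      then show "AE x in gauss. gram_minor I (w(i := x)) \<noteq> 0 \<longrightarrow> gram_minor (insert i I) (w(i := x)) \<noteq> 0"
      proof eventually_elim
        case (elim x)
        then show ?case using gram_minor_insert[of I "w(i := x)" i] insert.hyps(2) by (auto simp only: im fun_upd_same)
      qed
    qed measurable
    with insert.IH show ?case by eventually_elim auto
  qed
qed

lemma AE_gram_invertible:
  assumes "CARD('n) \<le> CARD('t::finite)"
  shows "AE w in PiM (UNIV :: 'n::finite set) (\<lambda>_. gauss :: (real^'t) measure). invertible (gram w)"
  using AE_gram_minor_nz[OF assms, of UNIV] by (simp add: gram_minor_UNIV)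

text \<open>The law of the statistic, up to its scale factor, as a negative binomial mixture of beta prime
  laws.\<close>

lemma nn_integral_statistic:
  fixes A :: "real^('p::finite + 'k::finite)^('p + 'k)" and h :: "real \<Rightarrow> ennreal"
  assumes A: "invertible A" and ij: "i \<noteq> j"
    and block: "\<And>k a. A $ Inr k $ Inl a = 0" and col: "\<And>a. a \<noteq> Inl j \<Longrightarrow> A $ a $ Inl j = 0"
    and row: "\<And>a. a \<noteq> i \<Longrightarrow> a \<noteq> j \<Longrightarrow> A $ Inl j $ Inl a = 0"
    and card: "CARD('p) + CARD('k) < CARD('t::finite)" and h [measurable]: "h \<in> borel_measurable borel"
  defines "R \<equiv> \<lambda>w :: 'p + 'k \<Rightarrow> real^'t. upper_left (matrix_inv (gram (lin_comb A w))) $ j $ j *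
      matrix_inv (upper_left (matrix_inv (gram (lin_comb A w)))) $ j $ j - 1"
  shows "R \<in> borel_measurable (PiM UNIV (\<lambda>_. gauss))"
    and "(\<integral>\<^sup>+w. h (R w) \<partial>PiM UNIV (\<lambda>_. gauss)) =
      (\<Sum>k. ennreal (nbin (real (CARD('t) - CARD('k)) / 2) ((A $ Inl j $ Inl i / A $ Inl j $ Inl j)\<^sup>2) k) *
        (\<integral>\<^sup>+r. ennreal (bprime (real (CARD('p) - 1) / 2 + real k) (real (CARD('t) - (CARD('p) + CARD('k) - 1)) / 2) r) * h r \<partial>lborel))"
proof -
  let ?P = "PiM (UNIV :: ('p + 'k) set) (\<lambda>_. gauss :: (real^'t) measure)"
  interpret P: prob_space ?P by (intro prob_space_PiM prob_space_gauss)
  interpret g: prob_space "gauss :: (real^'t) measure" by (rule prob_space_gauss)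
  let ?\<rho> = "A $ Inl j $ Inl i / A $ Inl j $ Inl j"
  have ent: "(\<lambda>w. gram (lin_comb A w) $ a $ b) \<in> borel_measurable ?P" for a b
    unfolding gram_def lin_comb_def by simp
  have inv1: "(\<lambda>w. matrix_inv (gram (lin_comb A w)) $ a $ b) \<in> borel_measurable ?P" for a b
    by (rule borel_measurable_matrix_inv) (rule ent)
  have inv2: "(\<lambda>w. matrix_inv (upper_left (matrix_inv (gram (lin_comb A w)))) $ a $ b) \<in> borel_measurable ?P" for a b
    by (rule borel_measurable_matrix_inv) (simp add: upper_left_def inv1)
  show R [measurable]: "R \<in> borel_measurable ?P"
    unfolding R_def upper_left_def using inv1 inv2[unfolded upper_left_def]
    by (intro borel_measurable_diff borel_measurable_times) simp_all
  have upd [measurable]: "(\<lambda>(w, x). w(l := x)) \<in> measurable (?P \<Otimes>\<^sub>M gauss) ?P" for l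
    by (rule measurable_PiM_resample)
  \<comment> \<open>the integral over \<open>w\<^sub>j\<close>, with the other vectors held fixed\<close>
  define F1 where "F1 w = (\<integral>\<^sup>+x. h (R (w(Inl j := x))) \<partial>gauss)" for w
  have F1 [measurable]: "F1 \<in> borel_measurable ?P"
  proof -
    have "(\<lambda>(w, x). h (R (w(Inl j := x)))) \<in> borel_measurable (?P \<Otimes>\<^sub>M gauss)"
      using measurable_compose[OF upd[of "Inl j"], of "\<lambda>w. h (R w)" borel] by (simp add: case_prod_beta')
    then show ?thesis unfolding F1_def by (rule g.borel_measurable_nn_integral)
  qed
  define G where "G w = span (w ` range Inr)" for w :: "'p + 'k \<Rightarrow> real^'t"
  define c where "c k = (\<integral>\<^sup>+r. ennreal (bprime (real (CARD('p) - 1) / 2 + real k) (real (CARD('t) - (CARD('p) + CARD('k) - 1)) / 2) r) * h r \<partial>lborel)" for k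
  define Psi where "Psi S x = (\<Sum>k. ennreal (pois ((norm (resid S (?\<rho> *\<^sub>R x)))\<^sup>2 / 2) k) * c k)" for S :: "(real^'t) set" and x
  have AEinv: "AE w in ?P. invertible (gram w)"
    using card by (intro AE_gram_invertible) simp
  have AEminor: "AE w in ?P. gram_minor UNIV w \<noteq> 0" using AEinv by (simp add: gram_minor_UNIV)
  have AEres: "AE w in ?P. AE x in gauss. invertible (gram (w(l := x)))" for l
  proof -
    have "Measurable.pred ?P (\<lambda>w. gram_minor UNIV w \<noteq> 0)" by measurable
    from AE_PiM_resampleD[OF prob_space_gauss this AEminor, of l] show ?thesis
      by (simp add: gram_minor_UNIV)
  qed
  have cG: "card (range (Inr :: 'k \<Rightarrow> 'p + 'k)) = CARD('k)" by (simp add: card_image)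
  have cH: "card (- {Inl j} :: ('p + 'k) set) = CARD('p) + CARD('k) - 1"
    by (simp add: Compl_eq_Diff_UNIV card_Diff_singleton)
  have p2: "CARD('p) \<ge> 2"
  proof -
    have "card {i, j} \<le> CARD('p)" by (intro card_mono) auto
    then show ?thesis using ij by simp
  qed
  have F1_eq: "AE w in ?P. F1 w = Psi (G w) (w (Inl i))"
    using AEinv AEres[of "Inl j"]
  proof eventually_elim
    case (elim w)
    let ?H = "span (w ` (- {Inl j}))"
    have dG: "dim (G w) = CARD('k)" unfolding G_def dim_span_gram[OF elim(1)] cG ..
    have dH: "dim ?H = CARD('p) + CARD('k) - 1" unfolding dim_span_gram[OF elim(1)] cH ..
    have "F1 w = (\<integral>\<^sup>+x. h ((norm (resid (G w) (x + ?\<rho> *\<^sub>R w (Inl i))))\<^sup>2 / (norm (resid ?H x))\<^sup>2 - 1) \<partial>gauss)"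
      unfolding F1_def
    proof (rule nn_integral_cong_AE, use elim(2) in eventually_elim)
      fix x assume inv: "invertible (gram (w(Inl j := x)))"
      have im: "w(Inl j := x) ` range Inr = w ` range Inr" "w(Inl j := x) ` (- {Inl j}) = w ` (- {Inl j})"
        by (auto simp: image_iff)
      have wi: "(w(Inl j := x)) (Inl i) = w (Inl i)" "(w(Inl j := x)) (Inl j) = x" using ij by auto
      show "h (R (w(Inl j := x))) = h ((norm (resid (G w) (x + ?\<rho> *\<^sub>R w (Inl i))))\<^sup>2 / (norm (resid ?H x))\<^sup>2 - 1)"
        unfolding R_def G_def
        by (subst upper_left_ratio_lin_comb[OF A inv ij]) (simp_all only: block col row im wi not_False_eq_True)
    qed
    also have "\<dots> = (\<Sum>k. ennreal (pois ((norm (resid (G w) (?\<rho> *\<^sub>R w (Inl i))))\<^sup>2 / 2) k) *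
      (\<integral>\<^sup>+r. ennreal (bprime (real (dim ?H - dim (G w)) / 2 + real k) (real (CARD('t) - dim ?H) / 2) r) * h r \<partial>lborel))"
    proof (rule nn_integral_gauss_ratio)
      show "subspace (G w)" "subspace ?H" by (simp_all add: G_def)
      show "G w \<subseteq> ?H" unfolding G_def by (intro span_mono) auto
      show "dim (G w) < dim ?H" "dim ?H < CARD('t)" using dG dH p2 card by auto
      show "?\<rho> *\<^sub>R w (Inl i) \<in> ?H" using ij by (intro span_scale span_base) auto
    qed measurable
    also have "\<dots> = Psi (G w) (w (Inl i))"
      unfolding Psi_def c_def dG dH using p2 by simp
    finally show ?case .
  qed
  have "(\<integral>\<^sup>+w. h (R w) \<partial>?P) = (\<integral>\<^sup>+w. F1 w \<partial>?P)"
    unfolding F1_def by (rule nn_integral_PiM_resample[OF prob_space_gauss]) measurable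
  also have "\<dots> = (\<integral>\<^sup>+w. (\<integral>\<^sup>+x. F1 (w(Inl i := x)) \<partial>gauss) \<partial>?P)"
    by (rule nn_integral_PiM_resample[OF prob_space_gauss]) measurable
  also have "\<dots> = (\<integral>\<^sup>+w. (\<Sum>k. ennreal (nbin (real (CARD('t) - CARD('k)) / 2) (?\<rho>\<^sup>2) k) * c k) \<partial>?P)"
  proof (rule nn_integral_cong_AE)
    \<comment> \<open>the closed form of \<open>F1\<close> is not known to be measurable, so its exceptional set is enclosed
        in a measurable null set before resampling \<open>w\<^sub>i\<close>\<close>
    obtain N where N0: "{w \<in> space ?P. \<not> F1 w = Psi (G w) (w (Inl i))} \<subseteq> N" "emeasure ?P N = 0" "N \<in> sets ?P"
      by (rule AE_E[OF F1_eq])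
    then have N: "N \<in> null_sets ?P" "{w \<in> space ?P. \<not> F1 w = Psi (G w) (w (Inl i))} \<subseteq> N" by auto
    have "AE w in ?P. AE x in gauss. w(Inl i := x) \<notin> N"
      using N(1) by (intro AE_PiM_resampleD[OF prob_space_gauss] AE_not_in) auto
    then show "AE w in ?P. (\<integral>\<^sup>+x. F1 (w(Inl i := x)) \<partial>gauss) =
      (\<Sum>k. ennreal (nbin (real (CARD('t) - CARD('k)) / 2) (?\<rho>\<^sup>2) k) * c k)"
      using AEinv
    proof eventually_elim
      case (elim w)
      have dG: "dim (G w) = CARD('k)" unfolding G_def dim_span_gram[OF elim(2)] cG ..
      have "(\<integral>\<^sup>+x. F1 (w(Inl i := x)) \<partial>gauss) = (\<integral>\<^sup>+x. Psi (G w) x \<partial>gauss)"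
      proof (rule nn_integral_cong_AE, use elim(1) in eventually_elim)
        fix x assume "w(Inl i := x) \<notin> N"
        then have "F1 (w(Inl i := x)) = Psi (G (w(Inl i := x))) x"
          using subsetD[OF N(2), of "w(Inl i := x)"] by (auto simp: space_PiM)
        moreover have "G (w(Inl i := x)) = G w"
          unfolding G_def by (intro arg_cong[where f = span]) (auto simp: image_iff)
        ultimately show "F1 (w(Inl i := x)) = Psi (G w) x" by simp
      qed
      also have "\<dots> = (\<Sum>k. ennreal (nbin (real (CARD('t) - dim (G w)) / 2) (?\<rho>\<^sup>2) k) * c k)"
        unfolding Psi_def by (rule nn_integral_ratio_mixture) (use card dG in \<open>auto simp: G_def\<close>)
      finally show ?case unfolding dG .
    qed
  qed
  also have "\<dots> = (\<Sum>k. ennreal (nbin (real (CARD('t) - CARD('k)) / 2) (?\<rho>\<^sup>2) k) * c k)"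
    by (simp add: P.emeasure_space_1)
  finally show "(\<integral>\<^sup>+w. h (R w) \<partial>?P) =
      (\<Sum>k. ennreal (nbin (real (CARD('t) - CARD('k)) / 2) (?\<rho>\<^sup>2) k) *
        (\<integral>\<^sup>+r. ennreal (bprime (real (CARD('p) - 1) / 2 + real k) (real (CARD('t) - (CARD('p) + CARD('k) - 1)) / 2) r) * h r \<partial>lborel))"
    unfolding c_def .
qed

section \<open>Standardizing the factor model\<close>

lemma indep_pair_distr:
  assumes "prob_space M" and ind: "indep_pair M N U N' W"
  shows "distr M (N \<Otimes>\<^sub>M N') (\<lambda>x. (U x, W x)) = distr M N U \<Otimes>\<^sub>M distr M N' W"
proof -
  interpret prob_space M by fact
  have U [measurable]: "U \<in> measurable M N" and W [measurable]: "W \<in> measurable M N'"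
    and iset: "indep_set {U -` A \<inter> space M | A. A \<in> sets N} {W -` A \<inter> space M | A. A \<in> sets N'}"
    using ind by (auto simp: indep_pair_def)
  interpret U: prob_space "distr M N U" by (rule prob_space_distr) fact
  interpret W: prob_space "distr M N' W" by (rule prob_space_distr) fact
  show ?thesis
  proof (rule pair_measure_eqI[symmetric])
    fix A B assume "A \<in> sets (distr M N U)" "B \<in> sets (distr M N' W)"
    then have A [measurable]: "A \<in> sets N" and B [measurable]: "B \<in> sets N'" by auto
    have "prob ((U -` A \<inter> space M) \<inter> (W -` B \<inter> space M)) = prob (U -` A \<inter> space M) * prob (W -` B \<inter> space M)"
      using A B by (intro indep_setD[OF iset]) auto
    moreover have "(\<lambda>x. (U x, W x)) -` (A \<times> B) \<inter> space M = (U -` A \<inter> space M) \<inter> (W -` B \<inter> space M)" by auto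
    ultimately show "emeasure (distr M N U) A * emeasure (distr M N' W) B = emeasure (distr M (N \<Otimes>\<^sub>M N') (\<lambda>x. (U x, W x))) (A \<times> B)"
      by (simp add: emeasure_distr emeasure_eq_measure ennreal_mult'[symmetric])
  qed (auto intro: prob_space_imp_sigma_finite U.prob_space_axioms W.prob_space_axioms cong: sets_pair_measure_cong)
qed

lemma normal_vector_standardize:
  fixes Z :: "'t::finite \<Rightarrow> 'a \<Rightarrow> real^'n" and L \<Sigma> :: "real^'n^'n"
  assumes M: "prob_space M" and nv: "\<And>t. normal_vector M 0 \<Sigma> (Z t)"
    and ind: "prob_space.indep_vars M (\<lambda>_. borel) Z UNIV"
    and L: "L ** transpose L = \<Sigma>" "invertible L"
  shows "distr M (PiM UNIV (\<lambda>_. borel)) (\<lambda>\<omega> t. matrix_inv L *v Z t \<omega>) = PiM UNIV (\<lambda>_. gauss)"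
proof -
  interpret prob_space M by fact
  note [measurable] = borel_measurable_matrix_vector_mult
  have Z [measurable]: "Z t \<in> borel_measurable M" for t
    using ind by (auto simp: indep_vars_def)
  have law: "distr M borel (\<lambda>\<omega>. matrix_inv L *v Z t \<omega>) = gauss" for t
  proof -
    have "distr M lborel (Z t) = density lborel (\<lambda>x. ennreal (mvn_density 0 \<Sigma> x))"
      using nv[of t] by (auto simp: normal_vector_def distributed_def)
    moreover have "distr M lborel (Z t) = distr M borel (Z t)" by (rule distr_cong) auto
    ultimately have d: "distr M borel (Z t) = density lborel (\<lambda>x. ennreal (mvn_density 0 \<Sigma> x))" by simp
    have "prob_space (density lborel (\<lambda>x. ennreal (mvn_density 0 \<Sigma> x)))"
      unfolding d[symmetric] by (rule prob_space_distr) measurable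
    from distr_gauss_matrix[OF L this] have d': "distr M borel (Z t) = distr gauss borel (\<lambda>x. L *v x)"
      by (simp add: d)
    have "distr M borel (\<lambda>\<omega>. matrix_inv L *v Z t \<omega>) = distr (distr M borel (Z t)) borel (\<lambda>x. matrix_inv L *v x)"
      by (subst distr_distr) (auto simp: o_def)
    also have "\<dots> = distr gauss borel (\<lambda>x. x)"
      unfolding d' by (subst distr_distr) (auto simp: o_def matrix_vector_mul_assoc matrix_inv_inverse[OF L(2)])
    also have "\<dots> = gauss" by (simp add: distr_id2)
    finally show ?thesis .
  qed
  have "indep_vars (\<lambda>_. borel) (\<lambda>t \<omega>. matrix_inv L *v Z t \<omega>) UNIV"
    using ind by (rule indep_vars_compose2) measurable
  then have "distr M (PiM UNIV (\<lambda>_. borel)) (\<lambda>\<omega>. \<lambda>t\<in>UNIV. matrix_inv L *v Z t \<omega>) =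
      PiM UNIV (\<lambda>t. distr M borel (\<lambda>\<omega>. matrix_inv L *v Z t \<omega>))"
    by (subst (asm) indep_vars_iff_distr_eq_PiM) auto
  then show ?thesis by (simp add: law restrict_UNIV)
qed

lemma distr_PiM_case_sum:
  assumes N: "prob_space N"
  shows "distr (PiM (UNIV :: 'b::finite set) (\<lambda>_. N) \<Otimes>\<^sub>M PiM (UNIV :: 'c::finite set) (\<lambda>_. N)) (PiM UNIV (\<lambda>_. N))
    (\<lambda>(x, y). case_sum y x) = PiM (UNIV :: ('c + 'b) set) (\<lambda>_. N)"
proof -
  interpret P: product_prob_space "\<lambda>_::'c + 'b. N" UNIV by (rule product_prob_spaceI) fact
  interpret B: product_prob_space "\<lambda>_::'b. N" UNIV by (rule product_prob_spaceI) fact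
  interpret C: product_prob_space "\<lambda>_::'c. N" UNIV by (rule product_prob_spaceI) fact
  let ?B = "PiM (UNIV :: 'b set) (\<lambda>_. N)" and ?C = "PiM (UNIV :: 'c set) (\<lambda>_. N)"
  have sf: "sigma_finite_measure ?C" by (intro prob_space_imp_sigma_finite prob_space_PiM N)
  have meas [measurable]: "(\<lambda>(x, y). case_sum y x) \<in> measurable (?B \<Otimes>\<^sub>M ?C) (PiM UNIV (\<lambda>_. N))"
  proof (rule measurable_PiM_single')
    fix i :: "'c + 'b"
    show "(\<lambda>z. (case z of (x, y) \<Rightarrow> case_sum y x) i) \<in> measurable (?B \<Otimes>\<^sub>M ?C) N"
      by (cases i) (simp_all add: case_prod_beta')
  qed (auto simp: space_pair_measure space_PiM PiE_UNIV split: sum.splits)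
  show ?thesis
  proof (rule P.PiM_eqI)
    fix A :: "'c + 'b \<Rightarrow> 'a set" assume A: "\<And>i. i \<in> UNIV \<Longrightarrow> A i \<in> sets N"
    have [measurable]: "Pi\<^sub>E UNIV A \<in> sets (PiM UNIV (\<lambda>_. N))" using A by (intro sets_PiM_I_finite) auto
    have "(\<lambda>(x, y). case_sum y x) -` PiE UNIV A \<inter> space (?B \<Otimes>\<^sub>M ?C) = PiE UNIV (\<lambda>i. A (Inr i)) \<times> PiE UNIV (\<lambda>i. A (Inl i))"
      using A[THEN sets.sets_into_space]
      by (fastforce simp: PiE_UNIV space_pair_measure space_PiM split: sum.splits)
    then have "emeasure (distr (?B \<Otimes>\<^sub>M ?C) (PiM UNIV (\<lambda>_. N)) (\<lambda>(x, y). case_sum y x)) (PiE UNIV A) =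
      emeasure (?B \<Otimes>\<^sub>M ?C) (PiE UNIV (\<lambda>i. A (Inr i)) \<times> PiE UNIV (\<lambda>i. A (Inl i)))"
      by (simp add: emeasure_distr)
    also have "\<dots> = emeasure ?B (PiE UNIV (\<lambda>i. A (Inr i))) * emeasure ?C (PiE UNIV (\<lambda>i. A (Inl i)))"
      using A by (intro sigma_finite_measure.emeasure_pair_measure_Times[OF sf] sets_PiM_I_finite) auto
    also have "\<dots> = (\<Prod>i\<in>UNIV. emeasure N (A (Inr i))) * (\<Prod>i\<in>UNIV. emeasure N (A (Inl i)))"
      using A by (simp add: B.emeasure_PiM C.emeasure_PiM)
    also have "\<dots> = (\<Prod>i\<in>UNIV. emeasure N (A i))"
      by (simp add: UNIV_Plus_UNIV[symmetric] prod.Plus mult.commute del: UNIV_Plus_UNIV)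
    finally show "emeasure (distr (?B \<Otimes>\<^sub>M ?C) (PiM UNIV (\<lambda>_. N)) (\<lambda>(x, y). case_sum y x)) (PiE UNIV A) = (\<Prod>i\<in>UNIV. emeasure N (A i))" .
  qed auto
qed

text \<open>The coordinate vectors of two independent Gaussian samples form one i.i.d. Gaussian family.\<close>

lemma distr_standardized_rows:
  fixes g :: "'a \<Rightarrow> 't::finite \<Rightarrow> real^'k" and z :: "'a \<Rightarrow> 't \<Rightarrow> real^'p"
  assumes M: "prob_space M"
    and g: "g \<in> measurable M (PiM UNIV (\<lambda>_. borel))" and z: "z \<in> measurable M (PiM UNIV (\<lambda>_. borel))"
    and joint: "distr M (PiM UNIV (\<lambda>_. borel) \<Otimes>\<^sub>M PiM UNIV (\<lambda>_. borel)) (\<lambda>\<omega>. (g \<omega>, z \<omega>)) =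
      PiM UNIV (\<lambda>_. gauss) \<Otimes>\<^sub>M PiM UNIV (\<lambda>_. gauss)"
  shows "distr M (PiM UNIV (\<lambda>_. borel)) (\<lambda>\<omega> i. \<chi> t. case i of Inl a \<Rightarrow> z \<omega> t $ a | Inr b \<Rightarrow> g \<omega> t $ b)
    = PiM (UNIV :: ('p + 'k) set) (\<lambda>_. gauss :: (real^'t) measure)"
proof -
  let ?Bk = "PiM UNIV (\<lambda>_. borel) :: ('t \<Rightarrow> real^'k) measure" and ?Bp = "PiM UNIV (\<lambda>_. borel) :: ('t \<Rightarrow> real^'p) measure"
  let ?Ck = "PiM UNIV (\<lambda>_. borel) :: ('k \<Rightarrow> real^'t) measure" and ?Cp = "PiM UNIV (\<lambda>_. borel) :: ('p \<Rightarrow> real^'t) measure"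
  let ?Gk = "PiM UNIV (\<lambda>_. gauss) :: ('t \<Rightarrow> real^'k) measure" and ?Gp = "PiM UNIV (\<lambda>_. gauss) :: ('t \<Rightarrow> real^'p) measure"
  let ?Hk = "PiM UNIV (\<lambda>_. gauss) :: ('k \<Rightarrow> real^'t) measure" and ?Hp = "PiM UNIV (\<lambda>_. gauss) :: ('p \<Rightarrow> real^'t) measure"
  let ?D = "PiM UNIV (\<lambda>_. borel) :: ('p + 'k \<Rightarrow> real^'t) measure"
  have setsG: "sets (PiM UNIV (\<lambda>_::'i. gauss :: (real^'j) measure)) = sets (PiM UNIV (\<lambda>_. borel))"
    by (rule sets_PiM_cong) auto
  have tk: "(\<lambda>w b. \<chi> a. w a $ b) \<in> measurable ?Bk ?Ck" and tp: "(\<lambda>w b. \<chi> a. w a $ b) \<in> measurable ?Bp ?Cp"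
    by (rule measurable_transpose_rows)+
  have tt: "(\<lambda>(x, y). ((\<lambda>b. \<chi> a. x a $ b), (\<lambda>b. \<chi> a. y a $ b))) \<in> measurable (?Bk \<Otimes>\<^sub>M ?Bp) (?Ck \<Otimes>\<^sub>M ?Cp)"
    using tk tp by measurable
  have cs: "(\<lambda>(x, y). case_sum y x) \<in> measurable (?Ck \<Otimes>\<^sub>M ?Cp) ?D"
  proof (rule measurable_PiM_single')
    fix i :: "'p + 'k"
    show "(\<lambda>z. (case z of (x, y) \<Rightarrow> case_sum y x) i) \<in> measurable (?Ck \<Otimes>\<^sub>M ?Cp) borel"
      by (cases i) (simp_all add: case_prod_beta')
  qed (auto simp: space_pair_measure space_PiM PiE_UNIV)
  have gz: "(\<lambda>\<omega>. (g \<omega>, z \<omega>)) \<in> measurable M (?Bk \<Otimes>\<^sub>M ?Bp)" using g z by measurable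
  let ?t = "\<lambda>(x, y). ((\<lambda>b. \<chi> a. x a $ b), (\<lambda>b. \<chi> a. y a $ b)) :: ('k \<Rightarrow> real^'t) \<times> ('p \<Rightarrow> real^'t)"
  have fe: "(\<lambda>(x, y). case_sum y x) \<circ> (?t \<circ> (\<lambda>\<omega>. (g \<omega>, z \<omega>))) =
     (\<lambda>\<omega> i. \<chi> t. case i of Inl a \<Rightarrow> z \<omega> t $ a | Inr b \<Rightarrow> g \<omega> t $ b)"
  proof (intro ext)
    fix \<omega> :: 'a and i :: "'p + 'k"
    show "((\<lambda>(x, y). case_sum y x) \<circ> (?t \<circ> (\<lambda>\<omega>. (g \<omega>, z \<omega>)))) \<omega> i =
      (\<chi> t. case i of Inl a \<Rightarrow> z \<omega> t $ a | Inr b \<Rightarrow> g \<omega> t $ b)"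
      by (cases i) simp_all
  qed
  have "distr M ?D (\<lambda>\<omega> i. \<chi> t. case i of Inl a \<Rightarrow> z \<omega> t $ a | Inr b \<Rightarrow> g \<omega> t $ b)
    = distr (distr (distr M (?Bk \<Otimes>\<^sub>M ?Bp) (\<lambda>\<omega>. (g \<omega>, z \<omega>))) (?Ck \<Otimes>\<^sub>M ?Cp) ?t) ?D (\<lambda>(x, y). case_sum y x)"
    by (simp only: distr_distr[OF tt gz] distr_distr[OF cs measurable_comp[OF gz tt]] fe)
  also have "distr (distr M (?Bk \<Otimes>\<^sub>M ?Bp) (\<lambda>\<omega>. (g \<omega>, z \<omega>))) (?Ck \<Otimes>\<^sub>M ?Cp)
       (\<lambda>(x, y). ((\<lambda>b. \<chi> a. x a $ b), (\<lambda>b. \<chi> a. y a $ b))) = ?Hk \<Otimes>\<^sub>M ?Hp"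
  proof -
    have sf: "sigma_finite_measure (distr ?Gp ?Cp (\<lambda>w b. \<chi> a. w a $ b))"
      unfolding distr_PiM_gauss_transpose by (intro prob_space_imp_sigma_finite prob_space_PiM prob_space_gauss)
    have "distr ?Gk ?Ck (\<lambda>w b. \<chi> a. w a $ b) \<Otimes>\<^sub>M distr ?Gp ?Cp (\<lambda>w b. \<chi> a. w a $ b) =
      distr (?Gk \<Otimes>\<^sub>M ?Gp) (?Ck \<Otimes>\<^sub>M ?Cp) (\<lambda>(x, y). ((\<lambda>b. \<chi> a. x a $ b), (\<lambda>b. \<chi> a. y a $ b)))"
      using tk tp by (intro pair_measure_distr sf) (simp_all cong: measurable_cong_sets add: setsG)
    then show ?thesis unfolding joint distr_PiM_gauss_transpose by simp
  qed
  also have "distr (?Hk \<Otimes>\<^sub>M ?Hp) ?D (\<lambda>(x, y). case_sum y x) = PiM UNIV (\<lambda>_. gauss)"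
    by (rule trans[OF distr_cong distr_PiM_case_sum[OF prob_space_gauss]]) (simp_all add: setsG)
  finally show ?thesis .
qed

section \<open>The density of the statistic\<close>

text \<open>The noncentral density claimed for the statistic, with \<open>a = p - 1\<close>, \<open>b = T - K - p + 1\<close> and \<open>l\<close> the noncentrality.\<close>

definition mix_density :: "real \<Rightarrow> real \<Rightarrow> real \<Rightarrow> real \<Rightarrow> real" where
  "mix_density a b l x = (if x > 0 then
     F_density a b x * (1 + l) powr (- (a + b) / 2) *
     hyp2F1 ((a + b) / 2) ((a + b) / 2) (a / 2) (a * x / (b + a * x) * (l / (1 + l))) else 0)"

lemma borel_measurable_F_density [measurable]: "F_density a b \<in> borel_measurable borel"
  unfolding F_density_def[abs_def] by measurable

lemma borel_measurable_hyp2F1 [measurable]: "hyp2F1 a b c \<in> borel_measurable borel"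
  unfolding hyp2F1_def[abs_def] by measurable

lemma borel_measurable_mix_density [measurable]: "mix_density a b l \<in> borel_measurable borel"
  unfolding mix_density_def[abs_def] by measurable

lemma mix_density_sums:
  assumes a: "a > 0" and b: "b > 0" and l: "l \<ge> 0" and x: "x > 0"
  shows "(\<lambda>k. nbin ((a + b) / 2) l k * bprime (a / 2 + real k) (b / 2) (a / b * x) * (a / b)) sums mix_density a b l x"
proof -
  define N where "N = (a + b) / 2"
  define r where "r = a / b * x"
  define q where "q = r / (1 + r) * (l / (1 + l))"
  have r: "r > 0" using a b x by (simp add: r_def)
  have N: "N > 0" using a b by (simp add: N_def)
  have q: "0 \<le> q" "q < 1"
  proof -
    show "0 \<le> q" using r l by (simp add: q_def)
    have "q \<le> r / (1 + r) * 1" unfolding q_def using r l by (intro mult_left_mono) auto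
    also have "\<dots> < 1" using r by simp
    finally show "q < 1" .
  qed
  have qeq: "a * x / (b + a * x) * (l / (1 + l)) = q"
  proof -
    have "b + a * x = b * (1 + r)" "a * x = b * r" using b by (simp_all add: r_def field_simps)
    then have "a * x / (b + a * x) = r / (1 + r)" using b by simp
    then show ?thesis by (simp add: q_def)
  qed
  define C where "C = (1 + l) powr (- N) * (1 + r) powr (- N) * r powr (a / 2 - 1) * (a / b) / (Gamma N * Gamma (b / 2))"
  define t where "t k = Gamma (N + real k) * Gamma (N + real k) / Gamma (a / 2 + real k) * (q ^ k / fact k)" for k
  have pos: "Gamma N > 0" "Gamma (a / 2) > 0" "Gamma (b / 2) > 0" using a b N by (auto intro!: Gamma_real_pos)
  have "summable t" unfolding t_def using a N q by (intro summable_hyp2F1) auto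
  then have "(\<lambda>k. C * t k) sums (C * (\<Sum>k. t k))" by (intro sums_mult summable_sums)
  moreover have "C * t k = nbin ((a + b) / 2) l k * bprime (a / 2 + real k) (b / 2) (a / b * x) * (a / b)" for k
  proof -
    have e: "a / 2 + real k + b / 2 = N + real k" by (simp add: N_def field_simps)
    have p1: "(1 + l) powr (- (N + real k)) = (1 + l) powr (- N) / (1 + l) ^ k"
      using l powr_realpow[of "1 + l" k] by (simp add: powr_diff)
    have p2: "(1 + r) powr (- (N + real k)) = (1 + r) powr (- N) / (1 + r) ^ k"
      using r powr_realpow[of "1 + r" k] by (simp add: powr_diff)
    have p3: "r powr (a / 2 + real k - 1) = r powr (a / 2 - 1) * r ^ k"
    proof -
      have "r powr (a / 2 + real k - 1) = r powr ((a / 2 - 1) + real k)" by (simp add: algebra_simps)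
      then show ?thesis using r by (simp only: powr_add powr_realpow)
    qed
    have q_k: "q ^ k = r ^ k / (1 + r) ^ k * (l ^ k / (1 + l) ^ k)"
      by (simp add: q_def power_mult_distrib power_divide)
    have gen: "L * R * X * c / (G * B) * (S * S / U * (xk / rk * (lk / ek) / F)) =
       S / (G * F) * lk * (L / ek) * (S / (U * B) * (X * xk) * (R / rk)) * c"
      for L R X c G B S U xk rk lk ek F :: real by (simp add: mult_ac)
    show ?thesis
      unfolding C_def t_def nbin_def bprime_def N_def[symmetric] r_def[symmetric] e p1 p2 p3 q_k
      using r by (simp only: if_True gen)
  qed
  moreover have "C * (\<Sum>k. t k) = mix_density a b l x"
  proof -
    have rp: "(a / b) powr (a / 2) * x powr (a / 2 - 1) = r powr (a / 2 - 1) * (a / b)"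
    proof -
      have "(a / b) powr (a / 2) = (a / b) powr (a / 2 - 1) * (a / b)"
        using a b powr_add[of "a / b" "a / 2 - 1" 1] by simp
      moreover have "r powr (a / 2 - 1) = (a / b) powr (a / 2 - 1) * x powr (a / 2 - 1)"
        using a b x unfolding r_def by (intro powr_mult)
      ultimately show ?thesis by simp
    qed
    have Nm: "- (a + b) / 2 = - N" by (simp only: N_def minus_divide_left)
    have gen: "L * R * X * c / (G * B) * S = G / (U * B) * Z * W * R * L * (U / (G * G) * S)"
      if "G \<noteq> 0" "U \<noteq> 0" "Z * W = X * c" for L R X c G B S U Z W :: real
    proof -
      have "G / (U * B) * Z * W * R * L * (U / (G * G) * S) = (Z * W) * R * L * S * (G * U / (U * B * (G * G)))" by simp
      also have "G * U / (U * B * (G * G)) = 1 / (G * B)" using that by simp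
      finally show ?thesis unfolding that(3) by simp
    qed
    have "mix_density a b l x = Gamma N / (Gamma (a / 2) * Gamma (b / 2)) * (a / b) powr (a / 2) * x powr (a / 2 - 1) * (1 + r) powr (- N)
      * (1 + l) powr (- N) * (Gamma (a / 2) / (Gamma N * Gamma N) * (\<Sum>k. t k))"
      using x unfolding mix_density_def F_density_def hyp2F1_def qeq Nm N_def[symmetric] r_def[symmetric] t_def by simp
    also have "\<dots> = C * (\<Sum>k. t k)"
      unfolding C_def by (rule gen[symmetric]) (use pos rp in auto)
    finally show ?thesis ..
  qed
  ultimately show ?thesis by simp
qed

lemma nn_integral_mix_density:
  assumes a: "a > 0" and b: "b > 0" and l: "l \<ge> 0" and [measurable]: "h \<in> borel_measurable borel"
  shows "(\<Sum>k. ennreal (nbin ((a + b) / 2) l k) * (\<integral>\<^sup>+r. ennreal (bprime (a / 2 + real k) (b / 2) r) * h (b / a * r) \<partial>lborel))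
    = (\<integral>\<^sup>+x. ennreal (mix_density a b l x) * h x \<partial>lborel)"
proof -
  let ?f = "\<lambda>k x. nbin ((a + b) / 2) l k * bprime (a / 2 + real k) (b / 2) (a / b * x) * (a / b)"
  have ab: "a / b > 0" using a b by simp
  have nn: "nbin ((a + b) / 2) l k \<ge> 0" "bprime (a / 2 + real k) (b / 2) y \<ge> 0" for k y
    using a b l by (auto intro!: nbin_nonneg bprime_nonneg add_pos_nonneg)
  have "ennreal (nbin ((a + b) / 2) l k) * (\<integral>\<^sup>+r. ennreal (bprime (a / 2 + real k) (b / 2) r) * h (b / a * r) \<partial>lborel) =
     (\<integral>\<^sup>+x. ennreal (?f k x) * h x \<partial>lborel)" for k
  proof -
    let ?I = "\<integral>\<^sup>+x. ennreal (bprime (a / 2 + real k) (b / 2) (a / b * x)) * h x \<partial>lborel"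
    let ?n = "ennreal (nbin ((a + b) / 2) l k)"
    have "(\<integral>\<^sup>+r. ennreal (bprime (a / 2 + real k) (b / 2) r) * h (b / a * r) \<partial>lborel) =
      ennreal (a / b) * (\<integral>\<^sup>+x. ennreal (bprime (a / 2 + real k) (b / 2) (a / b * x)) * h (b / a * (a / b * x)) \<partial>lborel)"
      by (rule nn_integral_scale[OF _ ab]) measurable
    then have I: "(\<integral>\<^sup>+r. ennreal (bprime (a / 2 + real k) (b / 2) r) * h (b / a * r) \<partial>lborel) = ennreal (a / b) * ?I"
      using a b by simp
    have "?n * (\<integral>\<^sup>+r. ennreal (bprime (a / 2 + real k) (b / 2) r) * h (b / a * r) \<partial>lborel) = (?n * ennreal (a / b)) * ?I"
      unfolding I by (rule mult.assoc[symmetric])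
    also have "\<dots> = (\<integral>\<^sup>+x. (?n * ennreal (a / b)) * (ennreal (bprime (a / 2 + real k) (b / 2) (a / b * x)) * h x) \<partial>lborel)"
      by (rule nn_integral_cmult[symmetric]) measurable
    also have "\<dots> = (\<integral>\<^sup>+x. ennreal (?f k x) * h x \<partial>lborel)"
    proof (rule nn_integral_cong)
      fix x :: real
      have "ennreal (?f k x) = ennreal (nbin ((a + b) / 2) l k) * ennreal (bprime (a / 2 + real k) (b / 2) (a / b * x)) * ennreal (a / b)"
        using nn ab by (simp only: ennreal_mult mult_nonneg_nonneg less_imp_le)
      then show "(ennreal (nbin ((a + b) / 2) l k) * ennreal (a / b)) * (ennreal (bprime (a / 2 + real k) (b / 2) (a / b * x)) * h x) = ennreal (?f k x) * h x"
        by (simp only: mult_ac)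
    qed
    finally show ?thesis .
  qed
  then have "(\<Sum>k. ennreal (nbin ((a + b) / 2) l k) * (\<integral>\<^sup>+r. ennreal (bprime (a / 2 + real k) (b / 2) r) * h (b / a * r) \<partial>lborel))
    = (\<Sum>k. \<integral>\<^sup>+x. ennreal (?f k x) * h x \<partial>lborel)" by (simp only:)
  also have "\<dots> = (\<integral>\<^sup>+x. (\<Sum>k. ennreal (?f k x) * h x) \<partial>lborel)"
    by (rule nn_integral_suminf[symmetric]) (simp add: nbin_def)
  also have "\<dots> = (\<integral>\<^sup>+x. ennreal (mix_density a b l x) * h x \<partial>lborel)"
  proof (rule nn_integral_cong)
    fix x :: real
    have "(\<Sum>k. ennreal (?f k x)) = ennreal (mix_density a b l x)"
    proof (cases "x > 0")
      case True
      show ?thesis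
        by (intro suminf_ennreal_eq mix_density_sums a b l True mult_nonneg_nonneg nn less_imp_le[OF ab])
    next
      case False
      then have "\<not> a / b * x > 0" using ab mult_nonneg_nonpos[of "a / b" x] by linarith
      then have "?f k x = 0" for k by (simp only: bprime_def if_False mult_zero_left mult_zero_right)
      moreover have "mix_density a b l x = 0" using False by (simp add: mix_density_def)
      ultimately show ?thesis by (simp only: ennreal_0 suminf_zero)
    qed
    then show "(\<Sum>k. ennreal (?f k x) * h x) = ennreal (mix_density a b l x) * h x"
      by (simp only: ennreal_suminf_multc)
  qed
  finally show ?thesis .
qed

lemma mix_density_central:
  assumes a: "a > 0" and b: "b > 0"
  shows "mix_density a b 0 x = F_density a b x"
proof (cases "x > 0")
  case True
  have "Gamma ((a + b) / 2) > 0" "Gamma (a / 2) > 0" using a b by (auto intro!: Gamma_real_pos)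
  moreover have "(\<Sum>k. Gamma ((a + b) / 2 + real k) * Gamma ((a + b) / 2 + real k) / Gamma (a / 2 + real k) * ((0::real) ^ k / fact k))
    = (\<Sum>k\<in>{0}. Gamma ((a + b) / 2 + real k) * Gamma ((a + b) / 2 + real k) / Gamma (a / 2 + real k) * (0 ^ k / fact k))"
    by (rule suminf_finite) auto
  ultimately have "hyp2F1 ((a + b) / 2) ((a + b) / 2) (a / 2) 0 = 1" by (simp add: hyp2F1_def)
  then show ?thesis using True by (simp add: mix_density_def)
qed (simp add: mix_density_def F_density_def)

lemma cov_matrix_linear:
  fixes A :: "real^'n^'m"
  assumes Z: "Z \<in> borel_measurable M" and law: "distr M borel Z = gauss"
  shows "cov_matrix M (\<lambda>\<omega>. A *v Z \<omega>) = A ** transpose A"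
proof -
  have E: "(\<integral>\<omega>. \<phi> (Z \<omega>) \<partial>M) = (\<integral>w. \<phi> w \<partial>gauss)" if "\<phi> \<in> borel_measurable borel" for \<phi> :: "real^'n \<Rightarrow> real"
    using integral_distr[OF Z that] by (simp add: law)
  note [measurable] = borel_measurable_matrix_vector_mult
  have row: "(A *v w) $ i = (\<Sum>a\<in>UNIV. A $ i $ a * w $ a)" for w i
    by (simp add: matrix_vector_mult_def)
  have mean: "(\<integral>\<omega>. (A *v Z \<omega>) $ i \<partial>M) = 0" for i
  proof -
    have "(\<integral>\<omega>. (A *v Z \<omega>) $ i \<partial>M) = (\<integral>w. (\<Sum>a\<in>UNIV. A $ i $ a * w $ a) \<partial>gauss)"
      by (subst E) (simp_all add: row)
    also have "\<dots> = 0"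
      by (subst Bochner_Integration.integral_sum) (simp_all add: gauss_moments)
    finally show ?thesis .
  qed
  have "cov_matrix M (\<lambda>\<omega>. A *v Z \<omega>) $ i $ k = (A ** transpose A) $ i $ k" for i k
  proof -
    have "cov_matrix M (\<lambda>\<omega>. A *v Z \<omega>) $ i $ k = (\<integral>w. (A *v w) $ i * (A *v w) $ k \<partial>gauss)"
      unfolding cov_matrix_def by (simp add: mean) (subst E, simp_all)
    also have "\<dots> = (\<integral>w. (\<Sum>a\<in>UNIV. \<Sum>b\<in>UNIV. (A $ i $ a * A $ k $ b) * (w $ a * w $ b)) \<partial>gauss)"
      unfolding row sum_product by (simp add: mult_ac)
    also have "\<dots> = (\<Sum>a\<in>UNIV. \<Sum>b\<in>UNIV. (A $ i $ a * A $ k $ b) * (if a = b then 1 else 0))"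
      by (simp add: Bochner_Integration.integral_sum Bochner_Integration.integrable_sum gauss_moments)
    also have "\<dots> = (A ** transpose A) $ i $ k"
      by (simp add: matrix_matrix_mult_def transpose_def if_distrib cong: if_cong)
    finally show ?thesis .
  qed
  then show ?thesis by (simp add: vec_eq_iff)
qed

text \<open>The population counterpart of the ratio is the same formula at the standard basis vectors.\<close>

lemma upper_left_ratio_population:
  fixes A :: "real^('p::finite + 'k::finite)^('p + 'k)"
  assumes A: "invertible A" and ij: "i \<noteq> j"
    and block: "\<And>k a. A $ Inr k $ Inl a = 0" and col: "\<And>a. a \<noteq> Inl j \<Longrightarrow> A $ a $ Inl j = 0"
    and row: "\<And>a. a \<noteq> i \<Longrightarrow> a \<noteq> j \<Longrightarrow> A $ Inl j $ Inl a = 0"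
  shows "upper_left (matrix_inv (A ** transpose A)) $ j $ j * matrix_inv (upper_left (matrix_inv (A ** transpose A))) $ j $ j
    = 1 + (A $ Inl j $ Inl i / A $ Inl j $ Inl j)\<^sup>2"
proof -
  let ?e = "\<lambda>m :: 'p + 'k. axis m (1::real)"
  let ?\<rho> = "A $ Inl j $ Inl i / A $ Inl j $ Inl j"
  have ee: "?e a \<bullet> ?e b = (if a = b then 1 else 0)" for a b by (simp add: inner_axis_axis)
  have ge: "gram ?e = mat 1" by (simp add: gram_def mat_def ee vec_eq_iff)
  then have inv: "invertible (gram ?e)" by (simp add: invertible_def)
  have gA: "gram (lin_comb A ?e) = A ** transpose A" by (simp add: gram_lin_comb ge)
  have rH: "resid (span (?e ` (- {Inl j}))) (?e (Inl j)) = ?e (Inl j)"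
  proof (rule resid_eqI)
    fix s assume "s \<in> span (?e ` (- {Inl j}))"
    then have "orthogonal (?e (Inl j)) s"
      by (rule orthogonal_to_span) (auto simp: orthogonal_def ee split: if_splits)
    then show "s \<bullet> ?e (Inl j) = 0" by (simp add: orthogonal_def inner_commute)
  qed (simp_all add: span_zero)
  have rG: "resid (span (?e ` range Inr)) (?e (Inl j) + ?\<rho> *\<^sub>R ?e (Inl i)) = ?e (Inl j) + ?\<rho> *\<^sub>R ?e (Inl i)"
  proof (rule resid_eqI)
    fix s assume "s \<in> span (?e ` range Inr)"
    then have "orthogonal (?e (Inl j) + ?\<rho> *\<^sub>R ?e (Inl i)) s"
      by (rule orthogonal_to_span) (auto simp: orthogonal_def ee inner_add_left)
    then show "s \<bullet> (?e (Inl j) + ?\<rho> *\<^sub>R ?e (Inl i)) = 0" by (simp add: orthogonal_def inner_commute)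
  qed (simp_all add: span_zero)
  have "upper_left (matrix_inv (gram (lin_comb A ?e))) $ j $ j * matrix_inv (upper_left (matrix_inv (gram (lin_comb A ?e)))) $ j $ j
    = (norm (?e (Inl j) + ?\<rho> *\<^sub>R ?e (Inl i)))\<^sup>2 / (norm (?e (Inl j)))\<^sup>2"
    by (subst upper_left_ratio_lin_comb[OF A inv ij]) (simp_all only: block col row rG rH not_False_eq_True)
  also have "(norm (?e (Inl j) + ?\<rho> *\<^sub>R ?e (Inl i)))\<^sup>2 = 1 + ?\<rho>\<^sup>2"
    unfolding power2_norm_eq_inner using ij
    by (simp add: inner_add_left inner_add_right ee power2_eq_square)
  finally show ?thesis by (simp add: gA)
qed

section \<open>The statistic in the factor model\<close>

theorem theorem2:
  fixes M :: "'a measure"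
    and B :: "real^'k::finite^'p::finite"
    and f :: "'t::finite \<Rightarrow> 'a \<Rightarrow> real^'k"
    and u X :: "'t \<Rightarrow> 'a \<Rightarrow> real^'p"
    and \<Sigma>f :: "real^'k^'k"
    and \<Sigma>u :: "real^'p^'p"
    and Yt :: "'t \<Rightarrow> 'a \<Rightarrow> real^('p + 'k)"
    and Y :: "'a \<Rightarrow> real^'t^('p + 'k)"
    and \<Omega> :: "real^('p + 'k)^('p + 'k)"
    and S V :: "'a \<Rightarrow> real^('p + 'k)^('p + 'k)"
    and Tj :: "'a \<Rightarrow> real"
    and p K T lam_j :: real
    and j :: 'p
    and s :: 't
  assumes "prob_space M"
    and p_def: "p = real CARD('p)" and K_def: "K = real CARD('k)" and T_def: "T = real CARD('t)"
    and "p \<ge> 2" and "p + K < T"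
    and "\<And>t. normal_vector M 0 \<Sigma>f (f t)"
    and "prob_space.indep_vars M (\<lambda>_. borel) f UNIV"
    and "\<And>t. normal_vector M 0 \<Sigma>u (u t)"
    and "prob_space.indep_vars M (\<lambda>_. borel) u UNIV"
    and "indep_pair M
           (PiM UNIV (\<lambda>_. borel)) (\<lambda>\<omega> t. f t \<omega>) (PiM UNIV (\<lambda>_. borel)) (\<lambda>\<omega> t. u t \<omega>)"
    and X_def: "\<And>t \<omega>. X t \<omega> = B *v f t \<omega> + u t \<omega>"
    and Yt_def: "\<And>t \<omega>. Yt t \<omega> = stack_vec (X t \<omega>) (f t \<omega>)"
    and \<Omega>_def: "\<Omega> = matrix_inv (cov_matrix M (Yt s))"
    and Y_def: "\<And>\<omega>. Y \<omega> = (\<chi> i t. Yt t \<omega> $ i)"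
    and S_def: "\<And>\<omega>. S \<omega> = (1 / T) *\<^sub>R (Y \<omega> ** transpose (Y \<omega>))"
    and V_def: "\<And>\<omega>. V \<omega> = matrix_inv (T *\<^sub>R S \<omega>)"
    and Tj_def: "\<And>\<omega>. Tj \<omega> = (T - K - p + 1) / (p - 1) *
           (upper_left (V \<omega>) $ j $ j * matrix_inv (upper_left (V \<omega>)) $ j $ j - 1)"
    and lam_j_def: "lam_j = upper_left \<Omega> $ j $ j * matrix_inv (upper_left \<Omega>) $ j $ j - 1"
  shows "distributed M lborel Tj (\<lambda>x. ennreal (if x > 0 then
             F_density (p - 1) (T - K - p + 1) x * (1 + lam_j) powr (- (T - K) / 2) *
             hyp2F1 ((T - K) / 2) ((T - K) / 2) ((p - 1) / 2)
               ((p - 1) * x / (T - K - p + 1 + (p - 1) * x) * (lam_j / (1 + lam_j)))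
           else 0)) \<and>
         (upper_left \<Omega> $ j $ j * matrix_inv (upper_left \<Omega>) $ j $ j = 1 \<longrightarrow>
           distr M borel Tj = F_distribution (p - 1) (T - K - p + 1))"
proof -
  interpret M: prob_space M by fact
  note Mprob = \<open>prob_space M\<close>
  note f_normal = \<open>\<And>t. normal_vector M 0 \<Sigma>f (f t)\<close> and u_normal = \<open>\<And>t. normal_vector M 0 \<Sigma>u (u t)\<close>
  note f_indep = \<open>prob_space.indep_vars M (\<lambda>_. borel) f UNIV\<close> and u_indep = \<open>prob_space.indep_vars M (\<lambda>_. borel) u UNIV\<close>
  note [measurable] = borel_measurable_matrix_vector_mult
  have p2: "CARD('p) \<ge> 2" using \<open>p \<ge> 2\<close> p_def by simp
  have cardT: "CARD('p) + CARD('k) < CARD('t)" using \<open>p + K < T\<close> p_def K_def T_def by simp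
  obtain i :: 'p where ij: "i \<noteq> j"
  proof -
    have "(UNIV :: 'p set) \<noteq> {j}"
    proof
      assume "(UNIV :: 'p set) = {j}"
      from arg_cong[OF this, of card] p2 show False by simp
    qed
    then show ?thesis using that by blast
  qed
  have "pos_def \<Sigma>f" "pos_def \<Sigma>u" using f_normal u_normal by (auto simp: normal_vector_def)
  obtain Lf :: "real^'k^'k" where Lf: "Lf ** transpose Lf = \<Sigma>f" "invertible Lf"
    by (rule pos_def_factor_column[OF \<open>pos_def \<Sigma>f\<close>]) (rule that)
  obtain Lu where Lu: "Lu ** transpose Lu = \<Sigma>u" "invertible Lu" "\<And>a. a \<noteq> j \<Longrightarrow> Lu $ a $ j = 0"
    "\<And>a. a \<noteq> i \<Longrightarrow> a \<noteq> j \<Longrightarrow> Lu $ j $ a = 0"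
    by (rule pos_def_factor[OF \<open>pos_def \<Sigma>u\<close> ij]) (rule that)
  \<comment> \<open>\<open>A\<close> maps the standardized noise and factors of one observation to the observation\<close>
  define A :: "real^('p + 'k)^('p + 'k)" where "A = (\<chi> a b. case a of
      Inl a' \<Rightarrow> (case b of Inl b' \<Rightarrow> Lu $ a' $ b' | Inr b' \<Rightarrow> (B ** Lf) $ a' $ b')
    | Inr a' \<Rightarrow> (case b of Inl b' \<Rightarrow> 0 | Inr b' \<Rightarrow> Lf $ a' $ b'))"
  have A_simps: "A $ Inl a $ Inl b = Lu $ a $ b" "A $ Inl a $ Inr c = (B ** Lf) $ a $ c"
    "A $ Inr c $ Inl b = 0" "A $ Inr c $ Inr d = Lf $ c $ d" for a b c d
    by (simp_all add: A_def)
  have A_stack: "A *v stack_vec x y = stack_vec (B *v (Lf *v y) + Lu *v x) (Lf *v y)" for x :: "real^'p" and y :: "real^'k"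
  proof -
    have "(A *v stack_vec x y) $ a = stack_vec ((B ** Lf) *v y + Lu *v x) (Lf *v y) $ a" for a
      by (cases a) (simp_all add: stack_vec_def matrix_vector_mult_def sum_UNIV_Plus A_simps add.commute)
    then show ?thesis by (simp add: vec_eq_iff matrix_vector_mul_assoc)
  qed
  have A_inv: "invertible A"
  proof -
    have "v = 0" if v: "A *v v = 0" for v
    proof -
      define x where "x = (\<chi> a. v $ Inl a)"
      define y where "y = (\<chi> a. v $ Inr a)"
      have v_stack: "v = stack_vec x y"
        by (simp add: vec_eq_iff stack_vec_def x_def y_def split: sum.splits)
      have "stack_vec (B *v (Lf *v y) + Lu *v x) (Lf *v y) = 0" using v by (simp add: v_stack A_stack)
      then have s: "stack_vec (B *v (Lf *v y) + Lu *v x) (Lf *v y) $ a = 0" for a by simp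
      have "Lf *v y = 0" using s[of "Inr _"] by (simp add: vec_eq_iff stack_vec_def)
      then have y: "y = 0" using matrix_vector_mult_eq_iff[OF Lf(2), of y 0] by simp
      have "Lu *v x = 0" using s[of "Inl _"] y by (simp add: vec_eq_iff stack_vec_def)
      then have "x = 0" using matrix_vector_mult_eq_iff[OF Lu(2), of x 0] by simp
      with y show ?thesis by (simp add: v_stack vec_eq_iff stack_vec_def split: sum.splits)
    qed
    then show ?thesis using det_eq_0_iff_kernel[of A] by (auto simp: invertible_det_nz)
  qed
  have A_col: "A $ a $ Inl j = 0" if "a \<noteq> Inl j" for a
    using that Lu(3) by (cases a) (auto simp: A_simps)
  have A_row: "A $ Inl j $ Inl a = 0" if "a \<noteq> i" "a \<noteq> j" for a
    using that Lu(4) by (simp add: A_simps)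
  define \<rho> where "\<rho> = A $ Inl j $ Inl i / A $ Inl j $ Inl j"

  define g where "g \<omega> t = matrix_inv Lf *v f t \<omega>" for \<omega> t
  define z where "z \<omega> t = matrix_inv Lu *v u t \<omega>" for \<omega> t
  have f_meas [measurable]: "f t \<in> borel_measurable M" and u_meas [measurable]: "u t \<in> borel_measurable M" for t
    using f_indep u_indep by (auto simp: M.indep_vars_def)
  have f_eq: "f t \<omega> = Lf *v g \<omega> t" and u_eq: "u t \<omega> = Lu *v z \<omega> t" for t \<omega>
    by (simp_all add: g_def z_def matrix_vector_mul_assoc matrix_inv_inverse Lf Lu)
  have g_law: "distr M (PiM UNIV (\<lambda>_. borel)) g = PiM UNIV (\<lambda>_. gauss)"
    using normal_vector_standardize[OF Mprob f_normal f_indep Lf] by (simp add: g_def[abs_def])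
  have z_law: "distr M (PiM UNIV (\<lambda>_. borel)) z = PiM UNIV (\<lambda>_. gauss)"
    using normal_vector_standardize[OF Mprob u_normal u_indep Lu(1,2)] by (simp add: z_def[abs_def])
  let ?Bk = "PiM UNIV (\<lambda>_. borel) :: ('t \<Rightarrow> real^'k) measure" and ?Bp = "PiM UNIV (\<lambda>_. borel) :: ('t \<Rightarrow> real^'p) measure"
  let ?F = "\<lambda>\<omega> t. f t \<omega>" and ?U = "\<lambda>\<omega> t. u t \<omega>"
  have F_meas: "?F \<in> measurable M ?Bk" and U_meas: "?U \<in> measurable M ?Bp"
    by (rule measurable_PiM_single'; simp)+
  have sk: "(\<lambda>x t. matrix_inv Lf *v x t) \<in> measurable ?Bk ?Bk"
    by (rule measurable_PiM_single') (auto intro!: measurable_compose[OF _ borel_measurable_matrix_vector_mult])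
  have sp: "(\<lambda>x t. matrix_inv Lu *v x t) \<in> measurable ?Bp ?Bp"
    by (rule measurable_PiM_single') (auto intro!: measurable_compose[OF _ borel_measurable_matrix_vector_mult])
  have g_comp: "g = (\<lambda>x t. matrix_inv Lf *v x t) \<circ> ?F" and z_comp: "z = (\<lambda>x t. matrix_inv Lu *v x t) \<circ> ?U"
    by (auto simp: g_def z_def fun_eq_iff)
  have g_meas: "g \<in> measurable M ?Bk" and z_meas: "z \<in> measurable M ?Bp"
    unfolding g_comp z_comp by (rule measurable_comp[OF F_meas sk], rule measurable_comp[OF U_meas sp])
  have joint: "distr M (?Bk \<Otimes>\<^sub>M ?Bp) (\<lambda>\<omega>. (g \<omega>, z \<omega>)) = PiM UNIV (\<lambda>_. gauss) \<Otimes>\<^sub>M PiM UNIV (\<lambda>_. gauss)"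
  proof -
    let ?s = "\<lambda>(x, y). ((\<lambda>t. matrix_inv Lf *v x t), (\<lambda>t. matrix_inv Lu *v y t)) :: ('t \<Rightarrow> real^'k) \<times> ('t \<Rightarrow> real^'p)"
    have s: "?s \<in> measurable (?Bk \<Otimes>\<^sub>M ?Bp) (?Bk \<Otimes>\<^sub>M ?Bp)" using sk sp by measurable
    have FU: "(\<lambda>\<omega>. (?F \<omega>, ?U \<omega>)) \<in> measurable M (?Bk \<Otimes>\<^sub>M ?Bp)" using F_meas U_meas by measurable
    have sf: "sigma_finite_measure (distr (distr M ?Bp ?U) ?Bp (\<lambda>x t. matrix_inv Lu *v x t))"
      using U_meas sp by (intro prob_space_imp_sigma_finite prob_space.prob_space_distr) (auto intro: M.prob_space_axioms prob_space.prob_space_distr)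
    have "distr M (?Bk \<Otimes>\<^sub>M ?Bp) (\<lambda>\<omega>. (g \<omega>, z \<omega>)) = distr (distr M (?Bk \<Otimes>\<^sub>M ?Bp) (\<lambda>\<omega>. (?F \<omega>, ?U \<omega>))) (?Bk \<Otimes>\<^sub>M ?Bp) ?s"
      by (subst distr_distr[OF s FU]) (simp add: o_def g_def[abs_def] z_def[abs_def])
    also have "distr M (?Bk \<Otimes>\<^sub>M ?Bp) (\<lambda>\<omega>. (?F \<omega>, ?U \<omega>)) = distr M ?Bk ?F \<Otimes>\<^sub>M distr M ?Bp ?U"
      by (rule indep_pair_distr[OF Mprob]) fact
    also have "distr (distr M ?Bk ?F \<Otimes>\<^sub>M distr M ?Bp ?U) (?Bk \<Otimes>\<^sub>M ?Bp) ?s =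
      distr (distr M ?Bk ?F) ?Bk (\<lambda>x t. matrix_inv Lf *v x t) \<Otimes>\<^sub>M distr (distr M ?Bp ?U) ?Bp (\<lambda>x t. matrix_inv Lu *v x t)"
      using sk sp by (intro pair_measure_distr[symmetric] sf) simp_all
    also have "\<dots> = distr M ?Bk g \<Otimes>\<^sub>M distr M ?Bp z"
      by (simp only: distr_distr[OF sk F_meas] distr_distr[OF sp U_meas] g_comp z_comp)
    finally show ?thesis by (simp only: g_law z_law)
  qed
  \<comment> \<open>the standardized coordinate vectors, each collecting one coordinate over time\<close>
  define W where "W \<omega> = (\<lambda>i. \<chi> t. case i of Inl a \<Rightarrow> z \<omega> t $ a | Inr b \<Rightarrow> g \<omega> t $ b)" for \<omega>
  let ?D = "PiM UNIV (\<lambda>_. borel) :: ('p + 'k \<Rightarrow> real^'t) measure"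
  let ?P = "PiM UNIV (\<lambda>_. gauss) :: ('p + 'k \<Rightarrow> real^'t) measure"
  have setsD: "sets ?D = sets ?P" by (rule sets_PiM_cong) auto
  have W_law: "distr M ?D W = ?P"
    using distr_standardized_rows[OF Mprob g_meas z_meas joint] by (simp add: W_def[abs_def])
  have gz_comp: "(\<lambda>\<omega>. g \<omega> t $ b) \<in> borel_measurable M" "(\<lambda>\<omega>. z \<omega> t $ a) \<in> borel_measurable M" for t a b
    unfolding g_def z_def by measurable
  have W_meas: "W \<in> measurable M ?D"
  proof (rule measurable_PiM_single')
    fix a :: "'p + 'k"
    show "(\<lambda>\<omega>. W \<omega> a) \<in> borel_measurable M"
      by (rule borel_measurable_vec) (cases a, simp_all add: W_def gz_comp)
  qed auto

  \<comment> \<open>the covariance matrix is \<open>A A\<^sup>T\<close>, because an observation is \<open>A\<close> applied to a standard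
      Gaussian vector\<close>
  have Yt_eq: "Yt t \<omega> = A *v stack_vec (z \<omega> t) (g \<omega> t)" for t \<omega>
    by (simp add: Yt_def X_def f_eq u_eq A_stack)
  define Z where "Z \<omega> = stack_vec (z \<omega> s) (g \<omega> s)" for \<omega>
  have Z_W: "Z \<omega> = (\<chi> a. W \<omega> a $ s)" for \<omega>
    by (simp add: Z_def W_def stack_vec_def vec_eq_iff split: sum.splits)
  have Z_meas: "Z \<in> borel_measurable M"
  proof (rule borel_measurable_vec)
    show "(\<lambda>\<omega>. Z \<omega> $ a) \<in> borel_measurable M" for a
      by (cases a) (simp_all add: Z_def stack_vec_def gz_comp)
  qed
  have Z_law: "distr M borel Z = gauss"
  proof -
    let ?tr = "\<lambda>w t. (\<chi> a. w a $ t) :: real^('p + 'k)"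
    let ?E = "PiM UNIV (\<lambda>_. borel) :: ('t \<Rightarrow> real^('p + 'k)) measure"
    have tr: "?tr \<in> measurable ?D ?E" by (rule measurable_transpose_rows)
    have comp: "Z = (\<lambda>x. x s) \<circ> (?tr \<circ> W)" by (auto simp: Z_W fun_eq_iff)
    have cs: "(\<lambda>x. x s) \<in> measurable ?E borel" by measurable
    have "distr M borel Z = distr (distr (distr M ?D W) ?E ?tr) borel (\<lambda>x. x s)"
      by (simp only: comp distr_distr[OF tr W_meas] distr_distr[OF cs measurable_comp[OF W_meas tr]])
    also have "distr (distr M ?D W) ?E ?tr = PiM UNIV (\<lambda>_. gauss)"
      unfolding W_law by (rule distr_PiM_gauss_transpose)
    also have "distr (PiM UNIV (\<lambda>_. gauss)) borel (\<lambda>x. x s) = distr (PiM UNIV (\<lambda>_. gauss)) (gauss :: (real^('p + 'k)) measure) (\<lambda>x. x s)"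
      by (rule distr_cong) auto
    also have "\<dots> = gauss" by (rule distr_PiM_component) (auto intro: prob_space_gauss)
    finally show ?thesis .
  qed
  have "Yt s = (\<lambda>\<omega>. A *v Z \<omega>)" by (simp add: Yt_eq Z_def fun_eq_iff)
  then have "\<Omega> = matrix_inv (A ** transpose A)"
    by (simp only: \<Omega>_def cov_matrix_linear[OF Z_meas Z_law])
  then have ratio: "upper_left \<Omega> $ j $ j * matrix_inv (upper_left \<Omega>) $ j $ j = 1 + \<rho>\<^sup>2"
    unfolding \<rho>_def using upper_left_ratio_population[OF A_inv ij] A_col A_row by (simp add: A_simps)
  then have lam: "lam_j = \<rho>\<^sup>2" by (simp add: lam_j_def)

  define a b where "a = p - 1" and "b = T - K - p + 1"
  have ab: "a > 0" "b > 0" using \<open>p \<ge> 2\<close> \<open>p + K < T\<close> by (simp_all add: a_def b_def)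
  define R where "R w = upper_left (matrix_inv (gram (lin_comb A w))) $ j $ j *
      matrix_inv (upper_left (matrix_inv (gram (lin_comb A w)))) $ j $ j - 1" for w :: "'p + 'k \<Rightarrow> real^'t"
  \<comment> \<open>\<open>T S\<close> is the Gram matrix of the combinations of \<open>W\<close> with coefficients \<open>A\<close>\<close>
  have TS: "T *\<^sub>R S \<omega> = gram (lin_comb A (W \<omega>))" for \<omega>
  proof -
    have "T > 0" using \<open>p + K < T\<close> \<open>p \<ge> 2\<close> K_def by simp
    then have "T *\<^sub>R S \<omega> = Y \<omega> ** transpose (Y \<omega>)" by (simp add: S_def)
    also have "Y \<omega> = (\<chi> a. lin_comb A (W \<omega>) a)"
    proof -
      have "Y \<omega> $ a $ t = lin_comb A (W \<omega>) a $ t" for a t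
      proof -
        have "stack_vec (z \<omega> t) (g \<omega> t) $ m = W \<omega> m $ t" for m
          by (cases m) (simp_all add: stack_vec_def W_def)
        then show ?thesis
          by (simp add: Y_def Yt_eq matrix_vector_mult_def lin_comb_def)
      qed
      then show ?thesis by (simp add: vec_eq_iff)
    qed
    finally show ?thesis
      by (simp add: gram_def matrix_matrix_mult_def transpose_def inner_vec_def vec_eq_iff)
  qed
  have Tj_eq: "Tj \<omega> = b / a * R (W \<omega>)" for \<omega>
    by (simp add: Tj_def V_def TS R_def a_def b_def)
  have R_meas: "R \<in> borel_measurable ?P"
    using nn_integral_statistic(1)[where 't = 't and h = "\<lambda>_. 0", OF A_inv ij _ _ _ cardT] A_simps(3) A_col A_row
    by (simp add: R_def[abs_def])
  have R_meas': "R \<in> borel_measurable ?D"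
    using R_meas setsD by (simp cong: measurable_cong_sets)
  have RW: "(\<lambda>\<omega>. R (W \<omega>)) \<in> borel_measurable M" using measurable_compose[OF W_meas R_meas'] .
  have Tj_meas [measurable]: "Tj \<in> borel_measurable M"
    unfolding Tj_eq[abs_def] using RW by measurable
  have reals: "real (CARD('t) - CARD('k)) = a + b" "real (CARD('p) - 1) = a"
    "real (CARD('t) - (CARD('p) + CARD('k) - 1)) = b"
    using p2 cardT by (simp_all add: a_def b_def p_def K_def T_def of_nat_diff)
  have E: "(\<integral>\<^sup>+\<omega>. h (Tj \<omega>) \<partial>M) = (\<integral>\<^sup>+x. ennreal (mix_density a b lam_j x) * h x \<partial>lborel)"
    if h [measurable]: "h \<in> borel_measurable borel" for h
  proof -
    have h': "(\<lambda>r. h (b / a * r)) \<in> borel_measurable borel" by measurable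
    have "(\<integral>\<^sup>+\<omega>. h (Tj \<omega>) \<partial>M) = (\<integral>\<^sup>+w. h (b / a * R w) \<partial>distr M ?D W)"
      unfolding Tj_eq by (subst nn_integral_distr[OF W_meas]) (use measurable_compose[OF R_meas' h'] in auto)
    also have "\<dots> = (\<integral>\<^sup>+w. h (b / a * R w) \<partial>?P)" by (simp only: W_law)
    also have "\<dots> = (\<Sum>k. ennreal (nbin ((a + b) / 2) (\<rho>\<^sup>2) k) *
        (\<integral>\<^sup>+r. ennreal (bprime (a / 2 + real k) (b / 2) r) * h (b / a * r) \<partial>lborel))"
      using nn_integral_statistic(2)[where 't = 't and h = "\<lambda>r. h (b / a * r)", OF A_inv ij _ _ _ cardT h'] A_simps(3) A_col A_row
      by (simp only: R_def[abs_def] reals \<rho>_def not_False_eq_True)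
    also have "\<dots> = (\<integral>\<^sup>+x. ennreal (mix_density a b (\<rho>\<^sup>2) x) * h x \<partial>lborel)"
      by (rule nn_integral_mix_density[OF ab]) simp_all
    finally show ?thesis unfolding lam .
  qed
  have law: "distr M lborel Tj = density lborel (\<lambda>x. ennreal (mix_density a b lam_j x))"
  proof (rule measure_eqI)
    fix C assume "C \<in> sets (distr M lborel Tj)"
    then have [measurable]: "C \<in> sets borel" by simp
    have "emeasure (distr M lborel Tj) C = (\<integral>\<^sup>+\<omega>. indicator C (Tj \<omega>) \<partial>M)"
      by (subst nn_integral_indicator[symmetric], simp, subst nn_integral_distr) auto
    also have "\<dots> = emeasure (density lborel (\<lambda>x. ennreal (mix_density a b lam_j x))) C"
      by (subst E) (simp_all add: emeasure_density)
    finally show "emeasure (distr M lborel Tj) C = emeasure (density lborel (\<lambda>x. ennreal (mix_density a b lam_j x))) C" .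
  qed simp
  have dens: "mix_density a b lam_j x = (if x > 0 then
             F_density (p - 1) (T - K - p + 1) x * (1 + lam_j) powr (- (T - K) / 2) *
             hyp2F1 ((T - K) / 2) ((T - K) / 2) ((p - 1) / 2)
               ((p - 1) * x / (T - K - p + 1 + (p - 1) * x) * (lam_j / (1 + lam_j)))
           else 0)" for x
  proof -
    have "a + b = T - K" by (simp add: a_def b_def)
    then show ?thesis by (simp only: mix_density_def) (simp only: a_def b_def)
  qed
  show ?thesis
  proof (intro conjI impI)
    show "distributed M lborel Tj (\<lambda>x. ennreal (if x > 0 then
             F_density (p - 1) (T - K - p + 1) x * (1 + lam_j) powr (- (T - K) / 2) *
             hyp2F1 ((T - K) / 2) ((T - K) / 2) ((p - 1) / 2)
               ((p - 1) * x / (T - K - p + 1 + (p - 1) * x) * (lam_j / (1 + lam_j)))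
           else 0))"
      unfolding dens[symmetric] distributed_def using law by simp
    assume "upper_left \<Omega> $ j $ j * matrix_inv (upper_left \<Omega>) $ j $ j = 1"
    then have "lam_j = 0" by (simp add: lam_j_def)
    have "distr M borel Tj = distr M lborel Tj" by (rule distr_cong) auto
    also have "\<dots> = F_distribution (p - 1) (T - K - p + 1)"
      by (simp only: law \<open>lam_j = 0\<close> mix_density_central[OF ab] F_distribution_def) (simp only: a_def b_def)
    finally show "distr M borel Tj = F_distribution (p - 1) (T - K - p + 1)" .
  qed
qed

end
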